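(* Let $\mathcal{A}$ be an abelian category and let $(\Phi,\{\Pi_\varphi\}_{\varphi\in\Phi})$ be stability data on $\mathcal{A}$. Equip $\mathbb{Z}\times\Phi$ with the lexicographic order (integer coordinate first). Then $\left(\mathbb{Z}\times\Phi,\{\Pi_\varphi[i]\}_{(i,\varphi)\in\mathbb{Z}\times\Phi}\right)$ is a t-stability on the bounded derived category $D^b(\mathcal{A})$, where $\mathcal{A}$ is identified with the complexes concentrated in degree $0$.
   Context: Stability data on an abelian category $\mathcal{A}$: a linearly ordered set $\Phi$ and, for each $\varphi\in\Phi$, a strictly full, nonempty subcategory $\Pi_\varphi\subset\mathcal{A}$ closed under extensions, such that (i) $\mathrm{Hom}_{\mathcal{A}}(A,B)=0$ for all $A\in\Pi_{\varphi'}$, $B\in\Pi_{\varphi''}$ with $\varphi'>\varphi''$; (ii) every nonzero $X\in\mathcal{A}$ has a finite filtration $X=F^0X\supset F^1X\supset\dots\supset F^{n+1}X=0$ with nonzero quotients $G_i=F^iX/F^{i+1}X\in\Pi_{\varphi_i}$ ($0\le i\le n$) and $\varphi_i<\varphi_j$ for $i<j$. Let $\mathcal{T}$ be a triangulated category. Write $\mathrm{Hom}^i(X,Y)=\mathrm{Hom}_{\mathcal{T}}(X,Y[i])$; $\mathrm{Hom}^{\le 0}(\mathcal{X},\mathcal{Y})=0$ means $\mathrm{Hom}^i(X,Y)=0$ for all $i\le 0$, $X\in\mathcal{X}$, $Y\in\mathcal{Y}$. A subcategory $\mathcal{X}\subset\mathcal{T}$ is extension-closed if for every distinguished triangle $A\to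 B\to C\to A[1]$ with $A,C\in\mathcal{X}$ also $B\in\mathcal{X}$. A t-stability (stability data) on $\mathcal{T}$ is a pair $(\Phi,\{\Pi_\varphi\}_{\varphi\in\Phi})$, where $\Phi$ is a linearly ordered set and each $\Pi_\varphi\subset\mathcal{T}$ is a nonempty, strictly full (full and closed under isomorphisms), extension-closed subcategory (zero objects are regarded as belonging to every $\Pi_\varphi$), such that: (1) there is an automorphism $\tau$ of the ordered set $\Phi$ with $\Pi_\varphi[1]=\Pi_{\tau(\varphi)}$ and $\tau(\varphi)\ge\varphi$ for all $\varphi$; (2) $\mathrm{Hom}^{\le 0}(\Pi_\psi,\Pi_\varphi)=0$ whenever $\psi>\varphi$; (3) every nonzero $X\in\mathcal{T}$ has a finite system of distinguished triangles $F^{i+1}X\to F^iX\to X_{\varphi_i}\to F^{i+1}X[1]$, $0\le i\le n$, with $F^0X=X$, $F^{n+1}X=0$, $0\ne X_{\varphi_i}\in\Pi_{\varphi_i}$ and $\varphi_0<\varphi_1<\dots<\varphi_n$. *)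

theory Defs
  imports "HOL-Algebra.Group"
begin

section \<open>Abelian categories\<close>

text \<open>
  Composition \<open>g \<bullet> f\<close> is "g after f". Addition of arrows is only meaningful for parallel arrows.
\<close>

record ('o, 'm) precat =
  Obj :: "'o set"
  Arr :: "'m set"
  Dom :: "'m \<Rightarrow> 'o"
  Cod :: "'m \<Rightarrow> 'o"
  Ident :: "'o \<Rightarrow> 'm"
  Comp :: "'m \<Rightarrow> 'm \<Rightarrow> 'm"  (infixl "\<bullet>\<index>" 70)
  Add :: "'m \<Rightarrow> 'm \<Rightarrow> 'm"  (infixl "\<oplus>\<index>" 65)
  ZeroArr :: "'o \<Rightarrow> 'o \<Rightarrow> 'm"

definition Hom :: "('o, 'm, 'z) precat_scheme \<Rightarrow> 'o \<Rightarrow> 'o \<Rightarrow> 'm set" where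
  "Hom C X Y = {f \<in> Arr C. Dom C f = X \<and> Cod C f = Y}"

definition hom_group :: "('o, 'm, 'z) precat_scheme \<Rightarrow> 'o \<Rightarrow> 'o \<Rightarrow> 'm monoid" where
  "hom_group C X Y = \<lparr>carrier = Hom C X Y, mult = Add C, one = ZeroArr C X Y\<rparr>"

definition Neg :: "('o, 'm, 'z) precat_scheme \<Rightarrow> 'm \<Rightarrow> 'm" where
  "Neg C f = inv\<^bsub>hom_group C (Dom C f) (Cod C f)\<^esub> f"

locale preadditive_category =
  fixes C :: "('o, 'm, 'z) precat_scheme" (structure)
  assumes dom_obj: "f \<in> Arr C \<Longrightarrow> Dom C f \<in> Obj C"
    and cod_obj: "f \<in> Arr C \<Longrightarrow> Cod C f \<in> Obj C"
    and ident_hom: "X \<in> Obj C \<Longrightarrow> Ident C X \<in> Hom C X X"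
    and comp_hom: "f \<in> Hom C X Y \<Longrightarrow> g \<in> Hom C Y Z \<Longrightarrow> g \<bullet> f \<in> Hom C X Z"
    and comp_ident_right: "f \<in> Hom C X Y \<Longrightarrow> f \<bullet> Ident C X = f"
    and comp_ident_left: "f \<in> Hom C X Y \<Longrightarrow> Ident C Y \<bullet> f = f"
    and comp_assoc:
      "f \<in> Hom C W X \<Longrightarrow> g \<in> Hom C X Y \<Longrightarrow> h \<in> Hom C Y Z \<Longrightarrow> (h \<bullet> g) \<bullet> f = h \<bullet> (g \<bullet> f)"
    and hom_comm_group: "X \<in> Obj C \<Longrightarrow> Y \<in> Obj C \<Longrightarrow> comm_group (hom_group C X Y)"
    and comp_add_left:
      "f \<in> Hom C X Y \<Longrightarrow> g \<in> Hom C Y Z \<Longrightarrow> g' \<in> Hom C Y Z \<Longrightarrow>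
        (g \<oplus> g') \<bullet> f = (g \<bullet> f) \<oplus> (g' \<bullet> f)"
    and comp_add_right:
      "f \<in> Hom C X Y \<Longrightarrow> f' \<in> Hom C X Y \<Longrightarrow> g \<in> Hom C Y Z \<Longrightarrow>
        g \<bullet> (f \<oplus> f') = (g \<bullet> f) \<oplus> (g \<bullet> f')"

definition is_zero :: "('o, 'm, 'z) precat_scheme \<Rightarrow> 'o \<Rightarrow> bool" where
  "is_zero C Z \<longleftrightarrow> Z \<in> Obj C \<and>
    (\<forall>X\<in>Obj C. (\<exists>!f. f \<in> Hom C X Z) \<and> (\<exists>!f. f \<in> Hom C Z X))"

definition iso_arr :: "('o, 'm, 'z) precat_scheme \<Rightarrow> 'm \<Rightarrow> bool" where
  "iso_arr C f \<longleftrightarrow> f \<in> Arr C \<and>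
    (\<exists>g\<in>Hom C (Cod C f) (Dom C f).
      g \<bullet>\<^bsub>C\<^esub> f = Ident C (Dom C f) \<and> f \<bullet>\<^bsub>C\<^esub> g = Ident C (Cod C f))"

definition isomorphic :: "('o, 'm, 'z) precat_scheme \<Rightarrow> 'o \<Rightarrow> 'o \<Rightarrow> bool" where
  "isomorphic C X Y \<longleftrightarrow> (\<exists>f\<in>Hom C X Y. iso_arr C f)"

definition mono_arr :: "('o, 'm, 'z) precat_scheme \<Rightarrow> 'm \<Rightarrow> bool" where
  "mono_arr C f \<longleftrightarrow> f \<in> Arr C \<and>
    (\<forall>W\<in>Obj C. \<forall>g\<in>Hom C W (Dom C f). \<forall>h\<in>Hom C W (Dom C f). f \<bullet>\<^bsub>C\<^esub> g = f \<bullet>\<^bsub>C\<^esub> h \<longrightarrow> g = h)"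

definition epi_arr :: "('o, 'm, 'z) precat_scheme \<Rightarrow> 'm \<Rightarrow> bool" where
  "epi_arr C f \<longleftrightarrow> f \<in> Arr C \<and>
    (\<forall>W\<in>Obj C. \<forall>g\<in>Hom C (Cod C f) W. \<forall>h\<in>Hom C (Cod C f) W. g \<bullet>\<^bsub>C\<^esub> f = h \<bullet>\<^bsub>C\<^esub> f \<longrightarrow> g = h)"

definition is_kernel :: "('o, 'm, 'z) precat_scheme \<Rightarrow> 'm \<Rightarrow> 'm \<Rightarrow> bool" where
  "is_kernel C f k \<longleftrightarrow> f \<in> Arr C \<and> k \<in> Arr C \<and> Cod C k = Dom C f \<and>
    f \<bullet>\<^bsub>C\<^esub> k = ZeroArr C (Dom C k) (Cod C f) \<and>
    (\<forall>W\<in>Obj C. \<forall>t\<in>Hom C W (Dom C f). f \<bullet>\<^bsub>C\<^esub> t = ZeroArr C W (Cod C f) \<longrightarrow>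
      (\<exists>!u. u \<in> Hom C W (Dom C k) \<and> k \<bullet>\<^bsub>C\<^esub> u = t))"

definition is_cokernel :: "('o, 'm, 'z) precat_scheme \<Rightarrow> 'm \<Rightarrow> 'm \<Rightarrow> bool" where
  "is_cokernel C f q \<longleftrightarrow> f \<in> Arr C \<and> q \<in> Arr C \<and> Dom C q = Cod C f \<and>
    q \<bullet>\<^bsub>C\<^esub> f = ZeroArr C (Dom C f) (Cod C q) \<and>
    (\<forall>W\<in>Obj C. \<forall>t\<in>Hom C (Cod C f) W. t \<bullet>\<^bsub>C\<^esub> f = ZeroArr C (Dom C f) W \<longrightarrow>
      (\<exists>!u. u \<in> Hom C (Cod C q) W \<and> u \<bullet>\<^bsub>C\<^esub> q = t))"

definition is_biproduct ::
  "('o, 'm, 'z) precat_scheme \<Rightarrow> 'o \<Rightarrow> 'o \<Rightarrow> 'o \<Rightarrow> 'm \<Rightarrow> 'm \<Rightarrow> 'm \<Rightarrow> 'm \<Rightarrow> bool" where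
  "is_biproduct C X Y S i1 i2 p1 p2 \<longleftrightarrow>
    i1 \<in> Hom C X S \<and> i2 \<in> Hom C Y S \<and> p1 \<in> Hom C S X \<and> p2 \<in> Hom C S Y \<and>
    p1 \<bullet>\<^bsub>C\<^esub> i1 = Ident C X \<and> p2 \<bullet>\<^bsub>C\<^esub> i2 = Ident C Y \<and>
    p2 \<bullet>\<^bsub>C\<^esub> i1 = ZeroArr C X Y \<and> p1 \<bullet>\<^bsub>C\<^esub> i2 = ZeroArr C Y X \<and>
    (i1 \<bullet>\<^bsub>C\<^esub> p1) \<oplus>\<^bsub>C\<^esub> (i2 \<bullet>\<^bsub>C\<^esub> p2) = Ident C S"

locale abelian_category = preadditive_category +
  assumes zero_exists: "\<exists>Z. is_zero C Z"
    and biproduct_exists: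
      "X \<in> Obj C \<Longrightarrow> Y \<in> Obj C \<Longrightarrow> \<exists>S i1 i2 p1 p2. is_biproduct C X Y S i1 i2 p1 p2"
    and kernel_exists: "f \<in> Arr C \<Longrightarrow> \<exists>k. is_kernel C f k"
    and cokernel_exists: "f \<in> Arr C \<Longrightarrow> \<exists>q. is_cokernel C f q"
    and mono_is_kernel: "mono_arr C f \<Longrightarrow> \<exists>g. is_kernel C g f"
    and epi_is_cokernel: "epi_arr C f \<Longrightarrow> \<exists>g. is_cokernel C g f"

definition short_exact :: "('o, 'm, 'z) precat_scheme \<Rightarrow> 'm \<Rightarrow> 'm \<Rightarrow> bool" where
  "short_exact C i p \<longleftrightarrow> is_kernel C p i \<and> is_cokernel C i p"


section \<open>Stability data on an abelian category\<close>

text \<open>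
  A full subcategory is given by its set of objects. The linearly ordered set \<open>\<Phi>\<close> is a carrier set
  with its (reflexive) order relation \<open>r\<close>; it may be empty.
\<close>

definition strictly_full :: "('o, 'm, 'z) precat_scheme \<Rightarrow> 'o set \<Rightarrow> bool" where
  "strictly_full C P \<longleftrightarrow> P \<subseteq> Obj C \<and> (\<forall>X\<in>P. \<forall>Y\<in>Obj C. isomorphic C X Y \<longrightarrow> Y \<in> P)"

definition extension_closed :: "('o, 'm, 'z) precat_scheme \<Rightarrow> 'o set \<Rightarrow> bool" where
  "extension_closed C P \<longleftrightarrow>
    (\<forall>i p. short_exact C i p \<and> Dom C i \<in> P \<and> Cod C p \<in> P \<longrightarrow> Cod C i \<in> P)"

definition less_in :: "('p \<times> 'p) set \<Rightarrow> 'p \<Rightarrow> 'p \<Rightarrow> bool" where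
  "less_in r x y \<longleftrightarrow> (x, y) \<in> r \<and> x \<noteq> y"

text \<open>
  A descending filtration \<open>X = F 0 \<supset> F 1 \<supset> \<dots> \<supset> F (n + 1) = 0\<close> with quotients \<open>G i\<close> is given by
  short exact sequences \<open>0 \<rightarrow> F (i + 1) \<rightarrow> F i \<rightarrow> G i \<rightarrow> 0\<close>.
\<close>

definition stability_data ::
  "('o, 'm, 'z) precat_scheme \<Rightarrow> 'p set \<Rightarrow> ('p \<times> 'p) set \<Rightarrow> ('p \<Rightarrow> 'o set) \<Rightarrow> bool" where
  "stability_data C \<Phi> r S \<longleftrightarrow>
    linear_order_on \<Phi> r \<and>
    (\<forall>\<phi>\<in>\<Phi>. S \<phi> \<noteq> {} \<and> strictly_full C (S \<phi>) \<and> extension_closed C (S \<phi>)) \<and>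
    (\<forall>\<phi>\<in>\<Phi>. \<forall>\<psi>\<in>\<Phi>. less_in r \<phi> \<psi> \<longrightarrow>
      (\<forall>X\<in>S \<psi>. \<forall>Y\<in>S \<phi>. Hom C X Y = {ZeroArr C X Y})) \<and>
    (\<forall>X\<in>Obj C. \<not> is_zero C X \<longrightarrow>
      (\<exists>n::nat. \<exists>F G \<phi> i p.
        F 0 = X \<and> is_zero C (F (Suc n)) \<and>
        (\<forall>k\<le>n. i k \<in> Hom C (F (Suc k)) (F k) \<and> p k \<in> Hom C (F k) (G k) \<and>
          short_exact C (i k) (p k) \<and>
          \<not> is_zero C (G k) \<and> \<phi> k \<in> \<Phi> \<and> G k \<in> S (\<phi> k)) \<and>
        (\<forall>k l. k < l \<and> l \<le> n \<longrightarrow> less_in r (\<phi> k) (\<phi> l))))"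


section \<open>t-stabilities\<close>

text \<open>
  The structure carried by a triangulated category: \<open>Shift k X\<close> is \<open>X[k]\<close>, and \<open>(u, v, w)\<close> belongs
  to \<open>Dist\<close> if \<open>X \<rightarrow> Y \<rightarrow> Z \<rightarrow> X[1]\<close>, with arrows \<open>u\<close>, \<open>v\<close>, \<open>w\<close>, is a distinguished triangle.
  Only this structure, not the axioms it satisfies, enters the definition of a t-stability.
\<close>

record ('o, 'm) tri_cat = "('o, 'm) precat" +
  Shift :: "int \<Rightarrow> 'o \<Rightarrow> 'o"
  ShiftArr :: "int \<Rightarrow> 'm \<Rightarrow> 'm"
  Dist :: "('m \<times> 'm \<times> 'm) set"

definition triangle ::
  "('o, 'm, 'z) tri_cat_scheme \<Rightarrow> 'o \<Rightarrow> 'o \<Rightarrow> 'o \<Rightarrow> 'm \<Rightarrow> 'm \<Rightarrow> 'm \<Rightarrow> bool" where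
  "triangle T X Y Z u v w \<longleftrightarrow>
    u \<in> Hom T X Y \<and> v \<in> Hom T Y Z \<and> w \<in> Hom T Z (Shift T 1 X) \<and> (u, v, w) \<in> Dist T"

definition tri_extension_closed :: "('o, 'm, 'z) tri_cat_scheme \<Rightarrow> 'o set \<Rightarrow> bool" where
  "tri_extension_closed T P \<longleftrightarrow>
    (\<forall>X Y Z u v w. triangle T X Y Z u v w \<and> X \<in> P \<and> Z \<in> P \<longrightarrow> Y \<in> P)"

definition with_zeros :: "('o, 'm, 'z) precat_scheme \<Rightarrow> 'o set \<Rightarrow> 'o set" where
  "with_zeros T P = P \<union> {Z. is_zero T Z}"

text \<open>
  Zero objects are regarded as belonging to every slice, whether or not they are listed in \<open>S \<phi>\<close>:
  the conditions are imposed on \<open>P \<phi> = with_zeros T (S \<phi>)\<close>.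
\<close>

definition t_stability ::
  "('o, 'm, 'z) tri_cat_scheme \<Rightarrow> 'p set \<Rightarrow> ('p \<times> 'p) set \<Rightarrow> ('p \<Rightarrow> 'o set) \<Rightarrow> bool" where
  "t_stability T \<Phi> r S \<longleftrightarrow>
    linear_order_on \<Phi> r \<and>
    (\<forall>\<phi>\<in>\<Phi>. S \<phi> \<noteq> {} \<and> strictly_full T (S \<phi>)) \<and>
    (let P = (\<lambda>\<phi>. with_zeros T (S \<phi>)) in
      (\<forall>\<phi>\<in>\<Phi>. tri_extension_closed T (P \<phi>)) \<and>
      (\<exists>\<tau>. bij_betw \<tau> \<Phi> \<Phi> \<and>
        (\<forall>\<phi>\<in>\<Phi>. \<forall>\<psi>\<in>\<Phi>. (\<phi>, \<psi>) \<in> r \<longleftrightarrow> (\<tau> \<phi>, \<tau> \<psi>) \<in> r) \<and>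
        (\<forall>\<phi>\<in>\<Phi>. Shift T 1 ` P \<phi> = P (\<tau> \<phi>) \<and> (\<phi>, \<tau> \<phi>) \<in> r)) \<and>
      (\<forall>\<phi>\<in>\<Phi>. \<forall>\<psi>\<in>\<Phi>. less_in r \<phi> \<psi> \<longrightarrow>
        (\<forall>X\<in>P \<psi>. \<forall>Y\<in>P \<phi>. \<forall>i\<le>0. Hom T X (Shift T i Y) = {ZeroArr T X (Shift T i Y)})) \<and>
      (\<forall>X\<in>Obj T. \<not> is_zero T X \<longrightarrow>
        (\<exists>n::nat. \<exists>F G \<phi> u v w.
          F 0 = X \<and> is_zero T (F (Suc n)) \<and>
          (\<forall>k\<le>n. triangle T (F (Suc k)) (F k) (G k) (u k) (v k) (w k) \<and>
            \<not> is_zero T (G k) \<and> \<phi> k \<in> \<Phi> \<and> G k \<in> P (\<phi> k)) \<and>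
          (\<forall>k l. k < l \<and> l \<le> n \<longrightarrow> less_in r (\<phi> k) (\<phi> l)))))"


section \<open>Bounded cochain complexes\<close>

record ('o, 'm) cplx =
  ob :: "int \<Rightarrow> 'o"
  df :: "int \<Rightarrow> 'm"

definition bounded_complex :: "('o, 'm, 'z) precat_scheme \<Rightarrow> ('o, 'm) cplx \<Rightarrow> bool" where
  "bounded_complex C X \<longleftrightarrow>
    (\<forall>n. ob X n \<in> Obj C \<and> df X n \<in> Hom C (ob X n) (ob X (n + 1)) \<and>
      df X (n + 1) \<bullet>\<^bsub>C\<^esub> df X n = ZeroArr C (ob X n) (ob X (n + 1 + 1))) \<and>
    (\<exists>N. \<forall>n. \<bar>n\<bar> > N \<longrightarrow> is_zero C (ob X n))"

definition chain_map ::
  "('o, 'm, 'z) precat_scheme \<Rightarrow> ('o, 'm) cplx \<Rightarrow> ('o, 'm) cplx \<Rightarrow> (int \<Rightarrow> 'm) \<Rightarrow> bool" where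
  "chain_map C X Y f \<longleftrightarrow>
    (\<forall>n. f n \<in> Hom C (ob X n) (ob Y n) \<and> df Y n \<bullet>\<^bsub>C\<^esub> f n = f (n + 1) \<bullet>\<^bsub>C\<^esub> df X n)"

definition homotopic ::
  "('o, 'm, 'z) precat_scheme \<Rightarrow> ('o, 'm) cplx \<Rightarrow> ('o, 'm) cplx \<Rightarrow>
    (int \<Rightarrow> 'm) \<Rightarrow> (int \<Rightarrow> 'm) \<Rightarrow> bool" where
  "homotopic C X Y f g \<longleftrightarrow>
    (\<exists>h. \<forall>n. h n \<in> Hom C (ob X n) (ob Y (n - 1)) \<and>
      f n = g n \<oplus>\<^bsub>C\<^esub> ((df Y (n - 1) \<bullet>\<^bsub>C\<^esub> h n) \<oplus>\<^bsub>C\<^esub> (h (n + 1) \<bullet>\<^bsub>C\<^esub> df X n)))"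

definition ch_id :: "('o, 'm, 'z) precat_scheme \<Rightarrow> ('o, 'm) cplx \<Rightarrow> int \<Rightarrow> 'm" where
  "ch_id C X = (\<lambda>n. Ident C (ob X n))"

definition ch_zero ::
  "('o, 'm, 'z) precat_scheme \<Rightarrow> ('o, 'm) cplx \<Rightarrow> ('o, 'm) cplx \<Rightarrow> int \<Rightarrow> 'm" where
  "ch_zero C X Y = (\<lambda>n. ZeroArr C (ob X n) (ob Y n))"

definition ch_comp ::
  "('o, 'm, 'z) precat_scheme \<Rightarrow> (int \<Rightarrow> 'm) \<Rightarrow> (int \<Rightarrow> 'm) \<Rightarrow> int \<Rightarrow> 'm" where
  "ch_comp C g f = (\<lambda>n. g n \<bullet>\<^bsub>C\<^esub> f n)"

definition ch_add ::
  "('o, 'm, 'z) precat_scheme \<Rightarrow> (int \<Rightarrow> 'm) \<Rightarrow> (int \<Rightarrow> 'm) \<Rightarrow> int \<Rightarrow> 'm" where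
  "ch_add C f g = (\<lambda>n. f n \<oplus>\<^bsub>C\<^esub> g n)"

text \<open>
  \<open>cohomology_at C X n k q\<close>: \<open>k : Z \<rightarrow> X\<^sup>n\<close> is a kernel of the outgoing differential and
  \<open>q : Z \<rightarrow> H\<close> a cokernel of the map induced by the incoming one, so that \<open>H\<close>, the codomain of
  \<open>q\<close>, is the \<open>n\<close>-th cohomology of \<open>X\<close>. Kernels and cokernels are unique only up to isomorphism,
  which is harmless in the definition of a quasi-isomorphism.
\<close>

definition cohomology_at ::
  "('o, 'm, 'z) precat_scheme \<Rightarrow> ('o, 'm) cplx \<Rightarrow> int \<Rightarrow> 'm \<Rightarrow> 'm \<Rightarrow> bool" where
  "cohomology_at C X n k q \<longleftrightarrow>
    is_kernel C (df X n) k \<and>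
    (\<exists>l\<in>Hom C (ob X (n - 1)) (Dom C k). k \<bullet>\<^bsub>C\<^esub> l = df X (n - 1) \<and> is_cokernel C l q)"

definition quasi_iso ::
  "('o, 'm, 'z) precat_scheme \<Rightarrow> ('o, 'm) cplx \<Rightarrow> ('o, 'm) cplx \<Rightarrow> (int \<Rightarrow> 'm) \<Rightarrow> bool" where
  "quasi_iso C X Y f \<longleftrightarrow> chain_map C X Y f \<and>
    (\<forall>n. \<exists>k q k' q'. cohomology_at C X n k q \<and> cohomology_at C Y n k' q' \<and>
      (\<exists>\<kappa>\<in>Hom C (Dom C k) (Dom C k'). \<exists>\<eta>\<in>Hom C (Cod C q) (Cod C q').
        k' \<bullet>\<^bsub>C\<^esub> \<kappa> = f n \<bullet>\<^bsub>C\<^esub> k \<and> \<eta> \<bullet>\<^bsub>C\<^esub> q = q' \<bullet>\<^bsub>C\<^esub> \<kappa> \<and> iso_arr C \<eta>))"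

definition sh_cplx ::
  "('o, 'm, 'z) precat_scheme \<Rightarrow> int \<Rightarrow> ('o, 'm) cplx \<Rightarrow> ('o, 'm) cplx" where
  "sh_cplx C k X =
    \<lparr>ob = (\<lambda>n. ob X (n + k)),
     df = (\<lambda>n. if even k then df X (n + k) else Neg C (df X (n + k)))\<rparr>"

definition sh_map :: "int \<Rightarrow> (int \<Rightarrow> 'm) \<Rightarrow> int \<Rightarrow> 'm" where
  "sh_map k f = (\<lambda>n. f (n + k))"

text \<open>
  \<open>K\<close> is the mapping cone of \<open>f : X \<rightarrow> Y\<close>, that is, \<open>K\<^sup>n\<close> is the direct sum of \<open>X\<^sup>n\<^sup>+\<^sup>1\<close> and \<open>Y\<^sup>n\<close> (with
  injections \<open>i1\<close>, \<open>i2\<close> and projections \<open>p1\<close>, \<open>p2\<close>) and \<open>d (x, y) = (- d x, f x + d y)\<close>.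
\<close>

definition mapping_cone ::
  "('o, 'm, 'z) precat_scheme \<Rightarrow> ('o, 'm) cplx \<Rightarrow> ('o, 'm) cplx \<Rightarrow> (int \<Rightarrow> 'm) \<Rightarrow> ('o, 'm) cplx \<Rightarrow>
    (int \<Rightarrow> 'm) \<Rightarrow> (int \<Rightarrow> 'm) \<Rightarrow> (int \<Rightarrow> 'm) \<Rightarrow> (int \<Rightarrow> 'm) \<Rightarrow> bool" where
  "mapping_cone C X Y f K i1 i2 p1 p2 \<longleftrightarrow>
    bounded_complex C K \<and>
    (\<forall>n. is_biproduct C (ob X (n + 1)) (ob Y n) (ob K n) (i1 n) (i2 n) (p1 n) (p2 n) \<and>
      df K n = (i1 (n + 1) \<bullet>\<^bsub>C\<^esub> (Neg C (df X (n + 1)) \<bullet>\<^bsub>C\<^esub> p1 n)) \<oplus>\<^bsub>C\<^esub>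
        (i2 (n + 1) \<bullet>\<^bsub>C\<^esub> ((f (n + 1) \<bullet>\<^bsub>C\<^esub> p1 n) \<oplus>\<^bsub>C\<^esub> (df Y n \<bullet>\<^bsub>C\<^esub> p2 n))))"


section \<open>The bounded derived category\<close>

text \<open>
  The derived category is the localization of the homotopy category of bounded complexes at the
  quasi-isomorphisms. Its arrows \<open>X \<rightarrow> Y\<close> are equivalence classes of roofs \<open>X \<leftarrow> Z \<rightarrow> Y\<close> whose
  left leg \<open>s\<close> is a quasi-isomorphism; a roof is a triple \<open>(Z, s, f)\<close>. Legs are chain maps, and all
  diagrams are required to commute up to homotopy, so homotopic legs give equivalent roofs and no
  separate quotient by homotopy is needed.
\<close>

type_synonym ('o, 'm) roof = "('o, 'm) cplx \<times> (int \<Rightarrow> 'm) \<times> (int \<Rightarrow> 'm)"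
type_synonym ('o, 'm) darr = "('o, 'm) cplx \<times> ('o, 'm) cplx \<times> ('o, 'm) roof set"

definition roofs ::
  "('o, 'm, 'z) precat_scheme \<Rightarrow> ('o, 'm) cplx \<Rightarrow> ('o, 'm) cplx \<Rightarrow> ('o, 'm) roof set" where
  "roofs C X Y = {(Z, s, f). bounded_complex C Z \<and> quasi_iso C Z X s \<and> chain_map C Z Y f}"

definition roof_rel ::
  "('o, 'm, 'z) precat_scheme \<Rightarrow> ('o, 'm) cplx \<Rightarrow> ('o, 'm) cplx \<Rightarrow>
    (('o, 'm) roof \<times> ('o, 'm) roof) set" where
  "roof_rel C X Y = {((Z, s, f), (Z', s', f')).
    (Z, s, f) \<in> roofs C X Y \<and> (Z', s', f') \<in> roofs C X Y \<and>
    (\<exists>W p p'. bounded_complex C W \<and> chain_map C W Z p \<and> chain_map C W Z' p' \<and>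
      quasi_iso C W X (ch_comp C s p) \<and>
      homotopic C W X (ch_comp C s p) (ch_comp C s' p') \<and>
      homotopic C W Y (ch_comp C f p) (ch_comp C f' p'))}"

text \<open>The image of a chain map under the localization functor.\<close>

definition loc ::
  "('o, 'm, 'z) precat_scheme \<Rightarrow> ('o, 'm) cplx \<Rightarrow> ('o, 'm) cplx \<Rightarrow> (int \<Rightarrow> 'm) \<Rightarrow> ('o, 'm) darr" where
  "loc C X Y f = (X, Y, roof_rel C X Y `` {(X, ch_id C X, f)})"

text \<open>
  Roofs \<open>X \<leftarrow> V \<rightarrow> Y\<close> and \<open>Y \<leftarrow> V' \<rightarrow> Z\<close> are composed by completing \<open>V \<rightarrow> Y \<leftarrow> V'\<close> to a homotopy
  commutative square with a quasi-isomorphism \<open>t : W \<rightarrow> V\<close> and a chain map \<open>h : W \<rightarrow> V'\<close>; arrows are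
  added by means of a common denominator. The unions below run over all choices of
  representatives and completions, which all yield the same equivalence class.
\<close>

fun darr_comp ::
  "('o, 'm, 'z) precat_scheme \<Rightarrow> ('o, 'm) darr \<Rightarrow> ('o, 'm) darr \<Rightarrow> ('o, 'm) darr" where
  "darr_comp C (Y', Z, Q) (X, Y, P) =
    (X, Z, \<Union>{roof_rel C X Z `` {(W, ch_comp C s t, ch_comp C g h)} | V s f V' u g W t h.
      (V, s, f) \<in> P \<and> (V', u, g) \<in> Q \<and> bounded_complex C W \<and>
      quasi_iso C W V t \<and> chain_map C W V' h \<and>
      homotopic C W Y (ch_comp C f t) (ch_comp C u h)})"

fun darr_add ::
  "('o, 'm, 'z) precat_scheme \<Rightarrow> ('o, 'm) darr \<Rightarrow> ('o, 'm) darr \<Rightarrow> ('o, 'm) darr" where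
  "darr_add C (X, Y, P) (X', Y', Q) =
    (X, Y, \<Union>{roof_rel C X Y `` {(V, s, ch_add C f g)} | V s f g.
      (V, s, f) \<in> P \<and> (V, s, g) \<in> Q})"

fun darr_shift :: "('o, 'm, 'z) precat_scheme \<Rightarrow> int \<Rightarrow> ('o, 'm) darr \<Rightarrow> ('o, 'm) darr" where
  "darr_shift C k (X, Y, P) =
    (sh_cplx C k X, sh_cplx C k Y, (\<lambda>(Z, s, f). (sh_cplx C k Z, sh_map k s, sh_map k f)) ` P)"

definition Db_cat ::
  "('o, 'm, 'z) precat_scheme \<Rightarrow> (('o, 'm) cplx, ('o, 'm) darr) precat" where
  "Db_cat C =
    \<lparr>Obj = {X. bounded_complex C X},
     Arr = {(X, Y, P). bounded_complex C X \<and> bounded_complex C Y \<and>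
       P \<in> roofs C X Y // roof_rel C X Y},
     Dom = fst,
     Cod = fst \<circ> snd,
     Ident = (\<lambda>X. loc C X X (ch_id C X)),
     Comp = darr_comp C,
     Add = darr_add C,
     ZeroArr = (\<lambda>X Y. loc C X Y (ch_zero C X Y))\<rparr>"

text \<open>
  Distinguished triangles are those isomorphic to \<open>X' \<rightarrow> Y' \<rightarrow> K \<rightarrow> X'[1]\<close> for \<open>K\<close> the mapping cone
  of a chain map \<open>f : X' \<rightarrow> Y'\<close>.
\<close>

definition Db_dist ::
  "('o, 'm, 'z) precat_scheme \<Rightarrow> (('o, 'm) darr \<times> ('o, 'm) darr \<times> ('o, 'm) darr) set" where
  "Db_dist C = {(u, v, w). \<exists>X Y Z X' Y' K f i1 i2 p1 p2 a b c.
    u \<in> Hom (Db_cat C) X Y \<and> v \<in> Hom (Db_cat C) Y Z \<and> w \<in> Hom (Db_cat C) Z (sh_cplx C 1 X) \<and>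
    bounded_complex C X' \<and> bounded_complex C Y' \<and> chain_map C X' Y' f \<and>
    mapping_cone C X' Y' f K i1 i2 p1 p2 \<and>
    a \<in> Hom (Db_cat C) X X' \<and> iso_arr (Db_cat C) a \<and>
    b \<in> Hom (Db_cat C) Y Y' \<and> iso_arr (Db_cat C) b \<and>
    c \<in> Hom (Db_cat C) Z K \<and> iso_arr (Db_cat C) c \<and>
    b \<bullet>\<^bsub>Db_cat C\<^esub> u = loc C X' Y' f \<bullet>\<^bsub>Db_cat C\<^esub> a \<and>
    c \<bullet>\<^bsub>Db_cat C\<^esub> v = loc C Y' K i2 \<bullet>\<^bsub>Db_cat C\<^esub> b \<and>
    darr_shift C 1 a \<bullet>\<^bsub>Db_cat C\<^esub> w = loc C K (sh_cplx C 1 X') p1 \<bullet>\<^bsub>Db_cat C\<^esub> c}"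

definition Db ::
  "('o, 'm, 'z) precat_scheme \<Rightarrow> (('o, 'm) cplx, ('o, 'm) darr) tri_cat" where
  "Db C = precat.extend (Db_cat C)
    (tri_cat.fields (sh_cplx C) (darr_shift C) (Db_dist C))"


section \<open>Shifted slices\<close>

definition zero_obj :: "('o, 'm, 'z) precat_scheme \<Rightarrow> 'o" where
  "zero_obj C = (SOME Z. is_zero C Z)"

definition deg0 :: "('o, 'm, 'z) precat_scheme \<Rightarrow> 'o \<Rightarrow> ('o, 'm) cplx" where
  "deg0 C A =
    (let X = (\<lambda>n. if n = 0 then A else zero_obj C)
     in \<lparr>ob = X, df = (\<lambda>n. ZeroArr C (X n) (X (n + 1)))\<rparr>)"

text \<open>
  \<open>P[i]\<close> as a strictly full subcategory of the derived category, for a full subcategory \<open>P\<close> of \<open>C\<close>.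
\<close>

definition shifted_slice ::
  "('o, 'm, 'z) precat_scheme \<Rightarrow> 'o set \<Rightarrow> int \<Rightarrow> ('o, 'm) cplx set" where
  "shifted_slice C P i =
    {X \<in> Obj (Db C). \<exists>A\<in>P. isomorphic (Db C) X (Shift (Db C) i (deg0 C A))}"

definition int_lex :: "'p set \<Rightarrow> ('p \<times> 'p) set \<Rightarrow> ((int \<times> 'p) \<times> (int \<times> 'p)) set" where
  "int_lex \<Phi> r = {((i, \<phi>), (j, \<psi>)). \<phi> \<in> \<Phi> \<and> \<psi> \<in> \<Phi> \<and> (i < j \<or> i = j \<and> (\<phi>, \<psi>) \<in> r)}"

end

(*
  Truncating a complex at degree n and splitting its top cohomology H along the filtration of H given by
  the stability data yields distinguished triangles whose third terms are the shifted quotients; doing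
  this degree by degree from the top produces the filtration by phases (-n, phi), in increasing order.
  Membership in a slice is a statement about cohomology: X lies in P[i] iff its cohomology vanishes
  outside degree -i and lies in P there. With this, closure under extensions is the long exact
  sequence of a cone, and Hom vanishes because a roof between complexes with cohomology in degrees
  at most n and at least n that induces zero on the n-th cohomology factors, after truncation, through
  an acyclic complex.

  Diagram chases use generalized elements: arrows T -> X^n, which may be refined along epimorphisms
  onto T. A chain map is a quasi-isomorphism iff it is injective and surjective on cohomology in this
  sense, so no cohomology functor is chosen. That roofs compose well follows from two properties of
  cones: a chain map into an acyclic complex becomes null-homotopic after composing with a
  quasi-isomorphism, and a chain map that becomes null-homotopic in the cone of u factors through u.
*)
theory Submission
  imports Defs
begin

text \<open>Composition in the derived category is a union over all representatives and completions,
  so arrows can be computed with only once that union is known to be a single class. The main profit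
  is a criterion: isomorphic complexes are joined by a roof with two quasi-isomorphic legs. It makes
  acyclicity and cohomology objects invariants of the derived category and turns the axioms of a
  t-stability into statements about complexes.

  The integer part of a phase is minus a cohomological degree because \<open>A[i]\<close> has its
  cohomology in degree -i. In a filtration the smallest phase is the outermost quotient, and this is
  what forces the descent from the top degree.

  Two conventions shape the details. Kernels, cokernels and cones are only known to exist, so
  cohomology is a relation between complexes and objects. Zero objects are adjoined to every slice,
  whereas a slice of the abelian category need not contain them, so closure under extensions has to
  be shown for enlarged slices.\<close>

section \<open>Arithmetic of arrows\<close>

context preadditive_category
begin

text \<open>Typing is done by equations: the rules below state their side conditions in terms of
  \<open>Dom\<close> and \<open>Cod\<close>, which the simplifier computes along a composite, so
  that later chases need no explicit sources and targets.\<close>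

lemma Hom_iff [simp]: "f \<in> Hom C X Y \<longleftrightarrow> f \<in> Arr C \<and> Dom C f = X \<and> Cod C f = Y"
  by (simp add: Hom_def)

lemmas [simp] = dom_obj cod_obj

lemma comp_arr [simp]:
  assumes "f \<in> Arr C" "g \<in> Arr C" "Cod C f = Dom C g"
  shows "g \<bullet> f \<in> Arr C" "Dom C (g \<bullet> f) = Dom C f" "Cod C (g \<bullet> f) = Cod C g"
  using comp_hom[of f "Dom C f" "Cod C f" g "Cod C g"] assms by auto

lemma ident_arr [simp]:
  assumes "X \<in> Obj C"
  shows "Ident C X \<in> Arr C" "Dom C (Ident C X) = X" "Cod C (Ident C X) = X"
  using ident_hom[OF assms] by auto

lemma comp_id [simp]:
  assumes "f \<in> Arr C"
  shows "Dom C f = X \<Longrightarrow> f \<bullet> Ident C X = f" "Cod C f = Y \<Longrightarrow> Ident C Y \<bullet> f = f"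
  using comp_ident_right[of f X "Cod C f"] comp_ident_left[of f "Dom C f" Y] assms by auto

lemma comp_assoc' [simp]:
  assumes "f \<in> Arr C" "g \<in> Arr C" "h \<in> Arr C" "Cod C f = Dom C g" "Cod C g = Dom C h"
  shows "(h \<bullet> g) \<bullet> f = h \<bullet> (g \<bullet> f)"
  using comp_assoc[of f "Dom C f" "Dom C g" g "Dom C h" h "Cod C h"] assms by auto

lemma hom_group_simps [simp]:
  "carrier (hom_group C X Y) = Hom C X Y" "x \<otimes>\<^bsub>hom_group C X Y\<^esub> y = x \<oplus> y"
  "\<one>\<^bsub>hom_group C X Y\<^esub> = ZeroArr C X Y"
  by (auto simp: hom_group_def)

lemma zero_arr [simp]:
  assumes "X \<in> Obj C" "Y \<in> Obj C"
  shows "ZeroArr C X Y \<in> Arr C" "Dom C (ZeroArr C X Y) = X" "Cod C (ZeroArr C X Y) = Y"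
proof -
  interpret G: comm_group "hom_group C X Y" using hom_comm_group assms by blast
  show "ZeroArr C X Y \<in> Arr C" "Dom C (ZeroArr C X Y) = X" "Cod C (ZeroArr C X Y) = Y"
    using G.one_closed by auto
qed

lemma add_arr [simp]:
  assumes "f \<in> Arr C" "g \<in> Arr C" "Dom C f = Dom C g" "Cod C f = Cod C g"
  shows "f \<oplus> g \<in> Arr C" "Dom C (f \<oplus> g) = Dom C g" "Cod C (f \<oplus> g) = Cod C g"
proof -
  interpret G: comm_group "hom_group C (Dom C g) (Cod C g)" using hom_comm_group assms by auto
  show "f \<oplus> g \<in> Arr C" "Dom C (f \<oplus> g) = Dom C g" "Cod C (f \<oplus> g) = Cod C g"
    using G.m_closed[of f g] assms by auto
qed

lemma neg_arr [simp]:
  assumes "f \<in> Arr C"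
  shows "Neg C f \<in> Arr C" "Dom C (Neg C f) = Dom C f" "Cod C (Neg C f) = Cod C f"
proof -
  interpret G: comm_group "hom_group C (Dom C f) (Cod C f)" using hom_comm_group assms by auto
  show "Neg C f \<in> Arr C" "Dom C (Neg C f) = Dom C f" "Cod C (Neg C f) = Cod C f"
    using G.inv_closed[of f] assms by (auto simp: Neg_def)
qed

lemma add_assoc [simp]:
  assumes "f \<in> Arr C" "g \<in> Arr C" "h \<in> Arr C"
    "Dom C f = Dom C h" "Dom C g = Dom C h" "Cod C f = Cod C h" "Cod C g = Cod C h"
  shows "(f \<oplus> g) \<oplus> h = f \<oplus> (g \<oplus> h)"
proof -
  interpret G: comm_group "hom_group C (Dom C h) (Cod C h)" using hom_comm_group assms by auto
  show ?thesis using G.m_assoc[of f g h] assms by auto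
qed

lemma add_comm:
  assumes "f \<in> Arr C" "g \<in> Arr C" "Dom C f = Dom C g" "Cod C f = Cod C g"
  shows "f \<oplus> g = g \<oplus> f"
proof -
  interpret G: comm_group "hom_group C (Dom C g) (Cod C g)" using hom_comm_group assms by auto
  show ?thesis using G.m_comm[of f g] assms by auto
qed

lemma add_lcomm:
  assumes "f \<in> Arr C" "g \<in> Arr C" "h \<in> Arr C"
    "Dom C f = Dom C h" "Dom C g = Dom C h" "Cod C f = Cod C h" "Cod C g = Cod C h"
  shows "f \<oplus> (g \<oplus> h) = g \<oplus> (f \<oplus> h)"
proof -
  have "f \<oplus> g = g \<oplus> f" using assms by (intro add_comm) auto
  then have "(f \<oplus> g) \<oplus> h = (g \<oplus> f) \<oplus> h" by (rule arg_cong)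
  then show ?thesis using assms by simp
qed

lemma add_zero [simp]:
  assumes "f \<in> Arr C" "Dom C f = X" "Cod C f = Y"
  shows "f \<oplus> ZeroArr C X Y = f" "ZeroArr C X Y \<oplus> f = f"
proof -
  interpret G: comm_group "hom_group C X Y" using hom_comm_group assms by auto
  show "f \<oplus> ZeroArr C X Y = f" "ZeroArr C X Y \<oplus> f = f"
    using G.r_one[of f] G.l_one[of f] assms by auto
qed

lemma add_neg [simp]:
  assumes "f \<in> Arr C"
  shows "f \<oplus> Neg C f = ZeroArr C (Dom C f) (Cod C f)" "Neg C f \<oplus> f = ZeroArr C (Dom C f) (Cod C f)"
proof -
  interpret G: comm_group "hom_group C (Dom C f) (Cod C f)" using hom_comm_group assms by auto
  show "f \<oplus> Neg C f = ZeroArr C (Dom C f) (Cod C f)" "Neg C f \<oplus> f = ZeroArr C (Dom C f) (Cod C f)"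
    using G.r_inv[of f] G.l_inv[of f] assms by (auto simp: Neg_def)
qed

text \<open>Since \<open>add_assoc\<close> brackets sums to the right, opposite summands must also
  cancel at the head of a longer sum. With these rules simp cancels adjacent opposite summands
  without using commutativity.\<close>

lemma add_neg2 [simp]:
  assumes "f \<in> Arr C" "g \<in> Arr C" "Dom C f = Dom C g" "Cod C f = Cod C g"
  shows "f \<oplus> (Neg C f \<oplus> g) = g" "Neg C f \<oplus> (f \<oplus> g) = g"
proof -
  have "f \<oplus> (Neg C f \<oplus> g) = (f \<oplus> Neg C f) \<oplus> g" using assms by (intro add_assoc[symmetric]) simp_all
  then show "f \<oplus> (Neg C f \<oplus> g) = g" using assms by simp
  have "Neg C f \<oplus> (f \<oplus> g) = (Neg C f \<oplus> f) \<oplus> g" using assms by (intro add_assoc[symmetric]) simp_all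
  then show "Neg C f \<oplus> (f \<oplus> g) = g" using assms by simp
qed

lemma add_cancel:
  assumes "f \<in> Arr C" "g \<in> Arr C" "h \<in> Arr C"
    "Dom C f = Dom C h" "Dom C g = Dom C h" "Cod C f = Cod C h" "Cod C g = Cod C h"
  shows "f \<oplus> g = f \<oplus> h \<longleftrightarrow> g = h"
proof
  assume *: "f \<oplus> g = f \<oplus> h"
  have "g = Neg C f \<oplus> (f \<oplus> g)" using assms by simp
  also have "\<dots> = h" unfolding * using assms by simp
  finally show "g = h" .
qed simp

lemma neg_unique:
  assumes "f \<in> Arr C" "g \<in> Arr C" "Dom C f = Dom C g" "Cod C f = Cod C g"
    "f \<oplus> g = ZeroArr C (Dom C g) (Cod C g)"
  shows "g = Neg C f"
proof -
  have "f \<oplus> g = f \<oplus> Neg C f" using assms by simp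
  then show ?thesis by (rule iffD1[OF add_cancel, rotated -1]) (use assms in auto)
qed

lemma neg_neg [simp]: "f \<in> Arr C \<Longrightarrow> Neg C (Neg C f) = f"
proof -
  assume "f \<in> Arr C"
  then have "f = Neg C (Neg C f)" by (intro neg_unique) simp_all
  then show ?thesis by (rule sym)
qed

lemma neg_zero [simp]:
  assumes "X \<in> Obj C" "Y \<in> Obj C"
  shows "Neg C (ZeroArr C X Y) = ZeroArr C X Y"
proof -
  have "ZeroArr C X Y = Neg C (ZeroArr C X Y)" using assms by (intro neg_unique) simp_all
  then show ?thesis by (rule sym)
qed

lemma neg_add [simp]:
  assumes "f \<in> Arr C" "g \<in> Arr C" "Dom C f = Dom C g" "Cod C f = Cod C g"
  shows "Neg C (f \<oplus> g) = Neg C f \<oplus> Neg C g"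
proof -
  have "(f \<oplus> g) \<oplus> (Neg C f \<oplus> Neg C g) = (f \<oplus> Neg C f) \<oplus> (g \<oplus> Neg C g)"
    using assms arg_cong[OF add_lcomm[of g "Neg C f" "Neg C g"], of "\<lambda>x. f \<oplus> x"]
    by (simp del: add_neg add_neg2)
  also have "\<dots> = ZeroArr C (Dom C g) (Cod C g)"
    using assms by simp
  finally have "Neg C f \<oplus> Neg C g = Neg C (f \<oplus> g)" using assms by (intro neg_unique) simp_all
  then show ?thesis by (rule sym)
qed

lemma distrib_left [simp]:
  assumes "f \<in> Arr C" "g \<in> Arr C" "g' \<in> Arr C" "Cod C f = Dom C g" "Dom C g' = Dom C g" "Cod C g' = Cod C g"
  shows "(g \<oplus> g') \<bullet> f = (g \<bullet> f) \<oplus> (g' \<bullet> f)"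
proof -
  have "f \<in> Hom C (Dom C f) (Dom C g)" using assms by auto
  moreover have "g \<in> Hom C (Dom C g) (Cod C g)" using assms by auto
  moreover have "g' \<in> Hom C (Dom C g) (Cod C g)" using assms by auto
  ultimately show ?thesis by (rule comp_add_left)
qed

lemma distrib_right [simp]:
  assumes "f \<in> Arr C" "f' \<in> Arr C" "g \<in> Arr C" "Cod C f = Dom C g" "Dom C f' = Dom C f" "Cod C f' = Cod C f"
  shows "g \<bullet> (f \<oplus> f') = (g \<bullet> f) \<oplus> (g \<bullet> f')"
proof -
  have "f \<in> Hom C (Dom C f) (Dom C g)" using assms by auto
  moreover have "f' \<in> Hom C (Dom C f) (Dom C g)" using assms by auto
  moreover have "g \<in> Hom C (Dom C g) (Cod C g)" using assms by auto
  ultimately show ?thesis by (rule comp_add_right)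
qed

lemma add_idem_zero:
  assumes "f \<in> Arr C" "f \<oplus> f = f"
  shows "f = ZeroArr C (Dom C f) (Cod C f)"
proof -
  have "f \<oplus> f = f \<oplus> ZeroArr C (Dom C f) (Cod C f)" using assms by simp
  then show ?thesis using add_cancel[of f f "ZeroArr C (Dom C f) (Cod C f)"] assms(1)
    by (metis dom_obj cod_obj zero_arr)
qed

text \<open>Composition is assumed to respect sums only. Distributivity makes a composite with a
  zero arrow idempotent under addition, and in a group this forces it to be zero.\<close>

lemma comp_zero [simp]:
  "\<lbrakk>f \<in> Arr C; Cod C f = Y; Z \<in> Obj C\<rbrakk> \<Longrightarrow> ZeroArr C Y Z \<bullet> f = ZeroArr C (Dom C f) Z"
  "\<lbrakk>f \<in> Arr C; Dom C f = Y; X \<in> Obj C\<rbrakk> \<Longrightarrow> f \<bullet> ZeroArr C X Y = ZeroArr C X (Cod C f)"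
proof -
  assume a: "f \<in> Arr C" "Cod C f = Y" "Z \<in> Obj C"
  let ?z = "ZeroArr C Y Z"
  have Y: "Y \<in> Obj C" using a by auto
  have "(?z \<bullet> f) \<oplus> (?z \<bullet> f) = (?z \<oplus> ?z) \<bullet> f" using a Y by (intro distrib_left[symmetric]) auto
  also have "?z \<oplus> ?z = ?z" using a Y by simp
  finally have "?z \<bullet> f = ZeroArr C (Dom C (?z \<bullet> f)) (Cod C (?z \<bullet> f))"
    using a Y by (intro add_idem_zero) auto
  then show "?z \<bullet> f = ZeroArr C (Dom C f) Z" using a Y by simp
next
  assume a: "f \<in> Arr C" "Dom C f = Y" "X \<in> Obj C"
  let ?z = "ZeroArr C X Y"
  have Y: "Y \<in> Obj C" using a by auto
  have "(f \<bullet> ?z) \<oplus> (f \<bullet> ?z) = f \<bullet> (?z \<oplus> ?z)" using a Y by (intro distrib_right[symmetric]) auto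
  also have "?z \<oplus> ?z = ?z" using a Y by simp
  finally have "f \<bullet> ?z = ZeroArr C (Dom C (f \<bullet> ?z)) (Cod C (f \<bullet> ?z))"
    using a Y by (intro add_idem_zero) auto
  then show "f \<bullet> ?z = ZeroArr C X (Cod C f)" using a Y by simp
qed

lemma comp_neg [simp]:
  assumes "f \<in> Arr C" "g \<in> Arr C" "Cod C f = Dom C g"
  shows "Neg C g \<bullet> f = Neg C (g \<bullet> f)" "g \<bullet> Neg C f = Neg C (g \<bullet> f)"
proof -
  have "(g \<bullet> f) \<oplus> (Neg C g \<bullet> f) = (g \<oplus> Neg C g) \<bullet> f"
    using assms by (intro distrib_left[symmetric]) auto
  also have "\<dots> = ZeroArr C (Dom C f) (Cod C g)" using assms by simp
  finally show "Neg C g \<bullet> f = Neg C (g \<bullet> f)"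
    using assms by (intro neg_unique) simp_all
  have "(g \<bullet> f) \<oplus> (g \<bullet> Neg C f) = g \<bullet> (f \<oplus> Neg C f)"
    using assms by (intro distrib_right[symmetric]) auto
  also have "\<dots> = ZeroArr C (Dom C f) (Cod C g)" using assms by simp
  finally show "g \<bullet> Neg C f = Neg C (g \<bullet> f)"
    using assms by (intro neg_unique) simp_all
qed

lemmas add_ac = add_comm add_lcomm

lemma eq_neg_iff:
  assumes "f \<in> Arr C" "g \<in> Arr C" "Dom C f = Dom C g" "Cod C f = Cod C g"
  shows "f \<oplus> Neg C g = ZeroArr C (Dom C g) (Cod C g) \<longleftrightarrow> f = g"
    "f \<oplus> g = ZeroArr C (Dom C g) (Cod C g) \<longleftrightarrow> f = Neg C g"
proof -
  have *: "f \<oplus> h = ZeroArr C (Dom C h) (Cod C h) \<longleftrightarrow> f = Neg C h"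
    if "h \<in> Arr C" "Dom C f = Dom C h" "Cod C f = Cod C h" for h
    using neg_unique[of h f] add_comm[of h f] assms(1) that by (metis add_neg(2))
  show "f \<oplus> Neg C g = ZeroArr C (Dom C g) (Cod C g) \<longleftrightarrow> f = g"
    using *[of "Neg C g"] assms by simp
  show "f \<oplus> g = ZeroArr C (Dom C g) (Cod C g) \<longleftrightarrow> f = Neg C g"
    using *[of g] assms by simp
qed

lemma add_eq_iff:
  assumes "f \<in> Arr C" "g \<in> Arr C" "h \<in> Arr C"
    "Dom C f = Dom C h" "Dom C g = Dom C h" "Cod C f = Cod C h" "Cod C g = Cod C h"
  shows "f \<oplus> g = h \<longleftrightarrow> g = h \<oplus> Neg C f"
proof -
  have "f \<oplus> (h \<oplus> Neg C f) = h \<oplus> (f \<oplus> Neg C f)"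
    using assms by (intro add_lcomm) auto
  also have "\<dots> = h" using assms by simp
  finally have "f \<oplus> g = h \<longleftrightarrow> f \<oplus> g = f \<oplus> (h \<oplus> Neg C f)" by metis
  also have "\<dots> \<longleftrightarrow> g = h \<oplus> Neg C f" using assms by (intro add_cancel) auto
  finally show ?thesis .
qed

lemma neg_eq_zero [simp]:
  assumes "f \<in> Arr C" "X \<in> Obj C" "Y \<in> Obj C"
  shows "Neg C f = ZeroArr C X Y \<longleftrightarrow> f = ZeroArr C X Y"
proof
  assume "Neg C f = ZeroArr C X Y"
  then have "Neg C (Neg C f) = Neg C (ZeroArr C X Y)" by (rule arg_cong)
  then show "f = ZeroArr C X Y" using assms by simp
qed (use assms in simp)

end

section \<open>Generalized elements in abelian categories\<close>

context preadditive_category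
begin

abbreviation Zr where "Zr \<equiv> ZeroArr C"

text \<open>Composites are normalised to the right, so the left side of an equation
  \<open>a \<bullet> b = w\<close> no longer occurs literally in
  \<open>a \<bullet> (b \<bullet> c)\<close>. This form lets such an equation act there; it is the
  standard way to apply a commuting square to an element.\<close>

lemma assoc_eq:
  assumes "a \<bullet> b = w" "a \<in> Arr C" "b \<in> Arr C" "c \<in> Arr C" "Cod C b = Dom C a" "Cod C c = Dom C b"
  shows "a \<bullet> (b \<bullet> c) = w \<bullet> c"
  using assms(2-) unfolding assms(1)[symmetric] by simp

section \<open>Zero objects, epimorphisms, monomorphisms and isomorphisms\<close>

lemma is_zero_iff: "is_zero C X \<longleftrightarrow> X \<in> Obj C \<and> Ident C X = Zr X X"
proof
  assume "is_zero C X"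
  then show "X \<in> Obj C \<and> Ident C X = Zr X X"
    unfolding is_zero_def Hom_iff by (metis ident_arr zero_arr)
next
  assume a: "X \<in> Obj C \<and> Ident C X = Zr X X"
  have 1: "f = Zr Y X" if "f \<in> Arr C" "Dom C f = Y" "Cod C f = X" for f Y
  proof -
    have "f = Ident C X \<bullet> f" using that by simp
    also have "\<dots> = Zr X X \<bullet> f" using a by simp
    finally show ?thesis using that a by simp
  qed
  have 2: "f = Zr X Y" if "f \<in> Arr C" "Dom C f = X" "Cod C f = Y" for f Y
  proof -
    have "f = f \<bullet> Ident C X" using that by simp
    also have "\<dots> = f \<bullet> Zr X X" using a by simp
    finally show ?thesis using that a by simp
  qed
  show "is_zero C X"
    unfolding is_zero_def
  proof (intro conjI ballI)
    fix Y assume Y: "Y \<in> Obj C"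
    show "\<exists>!f. f \<in> Hom C Y X"
      by (rule ex1I[of _ "Zr Y X"]) (use a Y 1 in auto)
    show "\<exists>!f. f \<in> Hom C X Y"
      by (rule ex1I[of _ "Zr X Y"]) (use a Y 2 in auto)
  qed (use a in simp)
qed

lemma zero_obj_arr:
  assumes "is_zero C X" "f \<in> Arr C"
  shows "Dom C f = X \<Longrightarrow> f = Zr X (Cod C f)" "Cod C f = X \<Longrightarrow> f = Zr (Dom C f) X"
proof -
  have X: "X \<in> Obj C" "\<forall>Y\<in>Obj C. (\<exists>!f. f \<in> Hom C Y X) \<and> (\<exists>!f. f \<in> Hom C X Y)"
    using assms(1) unfolding is_zero_def by blast+
  { assume "Dom C f = X"
    then have "f \<in> Hom C X (Cod C f)" "Zr X (Cod C f) \<in> Hom C X (Cod C f)" using assms(2) X(1) by simp_all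
    then show "f = Zr X (Cod C f)" using X(2) cod_obj[OF assms(2)] by blast }
  { assume "Cod C f = X"
    then have "f \<in> Hom C (Dom C f) X" "Zr (Dom C f) X \<in> Hom C (Dom C f) X" using assms(2) X(1) by simp_all
    then show "f = Zr (Dom C f) X" using X(2) dom_obj[OF assms(2)] by blast }
qed

text \<open>With differences at hand, cancelling \<open>f\<close> means that \<open>f\<close>
  detects zero arrows: apply the condition to \<open>g \<oplus> Neg C h\<close>.\<close>

lemma epi_iff: "epi_arr C f \<longleftrightarrow> f \<in> Arr C \<and>
    (\<forall>g\<in>Arr C. Dom C g = Cod C f \<longrightarrow> g \<bullet> f = Zr (Dom C f) (Cod C g) \<longrightarrow> g = Zr (Cod C f) (Cod C g))"
proof
  assume e: "epi_arr C f"
  then have f: "f \<in> Arr C" by (simp add: epi_arr_def)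
  show "f \<in> Arr C \<and> (\<forall>g\<in>Arr C. Dom C g = Cod C f \<longrightarrow> g \<bullet> f = Zr (Dom C f) (Cod C g) \<longrightarrow> g = Zr (Cod C f) (Cod C g))"
  proof (intro conjI ballI impI f)
    fix g assume g: "g \<in> Arr C" "Dom C g = Cod C f" "g \<bullet> f = Zr (Dom C f) (Cod C g)"
    have "Zr (Cod C f) (Cod C g) \<bullet> f = Zr (Dom C f) (Cod C g)" using f g by simp
    then have "g \<bullet> f = Zr (Cod C f) (Cod C g) \<bullet> f" using g by simp
    then show "g = Zr (Cod C f) (Cod C g)" using e f g unfolding epi_arr_def Ball_def Hom_iff
      by (metis cod_obj zero_arr)
  qed
next
  assume a: "f \<in> Arr C \<and> (\<forall>g\<in>Arr C. Dom C g = Cod C f \<longrightarrow> g \<bullet> f = Zr (Dom C f) (Cod C g) \<longrightarrow> g = Zr (Cod C f) (Cod C g))"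
  show "epi_arr C f"
    unfolding epi_arr_def Ball_def Hom_iff
  proof (intro conjI allI impI)
    fix W g h assume W: "W \<in> Obj C" and g: "g \<in> Arr C \<and> Dom C g = Cod C f \<and> Cod C g = W"
      and h: "h \<in> Arr C \<and> Dom C h = Cod C f \<and> Cod C h = W" and gh: "g \<bullet> f = h \<bullet> f"
    have "(g \<oplus> Neg C h) \<bullet> f = (h \<bullet> f) \<oplus> Neg C (h \<bullet> f)" using a g h gh by simp
    also have "\<dots> = Zr (Dom C f) W" using a h by simp
    finally have "g \<oplus> Neg C h = Zr (Cod C f) W" using a g h by (auto dest!: bspec[of _ _ "g \<oplus> Neg C h"])
    then show "g = h" using eq_neg_iff(1)[of g h] g h by simp
  qed (use a in simp)
qed

lemma mono_iff: "mono_arr C f \<longleftrightarrow> f \<in> Arr C \<and>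
    (\<forall>g\<in>Arr C. Cod C g = Dom C f \<longrightarrow> f \<bullet> g = Zr (Dom C g) (Cod C f) \<longrightarrow> g = Zr (Dom C g) (Dom C f))"
proof
  assume e: "mono_arr C f"
  then have f: "f \<in> Arr C" by (simp add: mono_arr_def)
  show "f \<in> Arr C \<and> (\<forall>g\<in>Arr C. Cod C g = Dom C f \<longrightarrow> f \<bullet> g = Zr (Dom C g) (Cod C f) \<longrightarrow> g = Zr (Dom C g) (Dom C f))"
  proof (intro conjI ballI impI f)
    fix g assume g: "g \<in> Arr C" "Cod C g = Dom C f" "f \<bullet> g = Zr (Dom C g) (Cod C f)"
    have "f \<bullet> Zr (Dom C g) (Dom C f) = Zr (Dom C g) (Cod C f)" using f g by simp
    then have "f \<bullet> g = f \<bullet> Zr (Dom C g) (Dom C f)" using g by simp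
    then show "g = Zr (Dom C g) (Dom C f)" using e f g unfolding mono_arr_def Ball_def Hom_iff
      by (metis dom_obj zero_arr)
  qed
next
  assume a: "f \<in> Arr C \<and> (\<forall>g\<in>Arr C. Cod C g = Dom C f \<longrightarrow> f \<bullet> g = Zr (Dom C g) (Cod C f) \<longrightarrow> g = Zr (Dom C g) (Dom C f))"
  show "mono_arr C f"
    unfolding mono_arr_def Ball_def Hom_iff
  proof (intro conjI allI impI)
    fix W g h assume W: "W \<in> Obj C" and g: "g \<in> Arr C \<and> Dom C g = W \<and> Cod C g = Dom C f"
      and h: "h \<in> Arr C \<and> Dom C h = W \<and> Cod C h = Dom C f" and gh: "f \<bullet> g = f \<bullet> h"
    have "f \<bullet> (g \<oplus> Neg C h) = (f \<bullet> h) \<oplus> Neg C (f \<bullet> h)" using a g h gh by simp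
    also have "\<dots> = Zr W (Cod C f)" using a h by simp
    finally have "g \<oplus> Neg C h = Zr W (Dom C f)" using a g h by (auto dest!: bspec[of _ _ "g \<oplus> Neg C h"])
    then show "g = h" using eq_neg_iff(1)[of g h] g h by simp
  qed (use a in simp)
qed

lemma epi_zero:
  assumes "epi_arr C e" "a \<in> Arr C" "Dom C a = Cod C e" "a \<bullet> e = Zr (Dom C e) (Cod C a)"
  shows "a = Zr (Cod C e) (Cod C a)"
  using assms epi_iff by blast

lemma mono_zero:
  assumes "mono_arr C m" "a \<in> Arr C" "Cod C a = Dom C m" "m \<bullet> a = Zr (Dom C a) (Cod C m)"
  shows "a = Zr (Dom C a) (Dom C m)"
  using assms mono_iff by blast

lemma epi_cancel:
  assumes "epi_arr C e" "a \<in> Arr C" "b \<in> Arr C" "Dom C a = Cod C e" "Dom C b = Cod C e" "a \<bullet> e = b \<bullet> e"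
  shows "a = b"
proof -
  have "Cod C a = Cod C b" using assms by (metis comp_arr(3) epi_iff)
  then show ?thesis using assms unfolding epi_arr_def Ball_def Hom_iff by (metis cod_obj)
qed

lemma mono_cancel:
  assumes "mono_arr C m" "a \<in> Arr C" "b \<in> Arr C" "Cod C a = Dom C m" "Cod C b = Dom C m" "m \<bullet> a = m \<bullet> b"
  shows "a = b"
proof -
  have "Dom C a = Dom C b" using assms by (metis comp_arr(2) mono_iff)
  then show ?thesis using assms unfolding mono_arr_def Ball_def Hom_iff by (metis dom_obj)
qed

lemma epi_arr_arr [simp]: "epi_arr C e \<Longrightarrow> e \<in> Arr C"
  by (simp add: epi_arr_def)

lemma mono_arr_arr [simp]: "mono_arr C e \<Longrightarrow> e \<in> Arr C"
  by (simp add: mono_arr_def)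

lemma epi_comp:
  assumes "epi_arr C e" "epi_arr C f" "Cod C e = Dom C f"
  shows "epi_arr C (f \<bullet> e)"
  unfolding epi_iff
proof (intro conjI ballI impI)
  fix g assume g: "g \<in> Arr C" "Dom C g = Cod C (f \<bullet> e)" "g \<bullet> (f \<bullet> e) = Zr (Dom C (f \<bullet> e)) (Cod C g)"
  then have "(g \<bullet> f) \<bullet> e = Zr (Dom C e) (Cod C g)" using assms by simp
  then have "g \<bullet> f = Zr (Dom C f) (Cod C g)" using epi_zero[of e "g \<bullet> f"] assms g by simp
  then show "g = Zr (Cod C (f \<bullet> e)) (Cod C g)" using epi_zero[of f g] assms g by simp
qed (use assms in simp)

lemma mono_comp:
  assumes "mono_arr C e" "mono_arr C f" "Cod C e = Dom C f"
  shows "mono_arr C (f \<bullet> e)"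
  unfolding mono_iff
proof (intro conjI ballI impI)
  fix g assume g: "g \<in> Arr C" "Cod C g = Dom C (f \<bullet> e)" "(f \<bullet> e) \<bullet> g = Zr (Dom C g) (Cod C (f \<bullet> e))"
  then have "f \<bullet> (e \<bullet> g) = Zr (Dom C g) (Cod C f)" using assms by simp
  then have "e \<bullet> g = Zr (Dom C g) (Cod C e)" using mono_zero[of f "e \<bullet> g"] assms g by simp
  then show "g = Zr (Dom C g) (Dom C (f \<bullet> e))" using mono_zero[of e g] assms g by simp
qed (use assms in simp)

lemma epi_ident [simp]: "X \<in> Obj C \<Longrightarrow> epi_arr C (Ident C X)"
  unfolding epi_arr_def Ball_def Hom_iff by simp

lemma epi_right_factor:
  assumes "epi_arr C (f \<bullet> e)" "e \<in> Arr C" "f \<in> Arr C" "Cod C e = Dom C f"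
  shows "epi_arr C f"
  unfolding epi_iff
proof (intro conjI ballI impI)
  fix g assume g: "g \<in> Arr C" "Dom C g = Cod C f" "g \<bullet> f = Zr (Dom C f) (Cod C g)"
  then have "g \<bullet> (f \<bullet> e) = Zr (Dom C e) (Cod C g)" using assms by (simp add: assoc_eq)
  then show "g = Zr (Cod C f) (Cod C g)" using epi_zero[of "f \<bullet> e" g] assms g by simp
qed (use assms in simp)

lemma iso_arrI:
  assumes "f \<in> Arr C" "g \<in> Arr C" "Dom C g = Cod C f" "Cod C g = Dom C f"
    "g \<bullet> f = Ident C (Dom C f)" "f \<bullet> g = Ident C (Cod C f)"
  shows "iso_arr C f"
  using assms by (auto simp: iso_arr_def)

lemma iso_arrE:
  assumes "iso_arr C f"
  obtains g where "f \<in> Arr C" "g \<in> Arr C" "Dom C g = Cod C f" "Cod C g = Dom C f"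
    "g \<bullet> f = Ident C (Dom C f)" "f \<bullet> g = Ident C (Cod C f)" "iso_arr C g"
proof -
  obtain g where "f \<in> Arr C" "g \<in> Arr C" "Dom C g = Cod C f" "Cod C g = Dom C f"
    "g \<bullet> f = Ident C (Dom C f)" "f \<bullet> g = Ident C (Cod C f)"
    using assms unfolding iso_arr_def by auto
  then show thesis using that[of g] iso_arrI[of g f] by metis
qed

lemma iso_epi:
  assumes "iso_arr C f"
  shows "epi_arr C f"
proof -
  obtain g where g: "f \<in> Arr C" "g \<in> Arr C" "Dom C g = Cod C f" "Cod C g = Dom C f"
    "f \<bullet> g = Ident C (Cod C f)" using assms by (auto elim: iso_arrE)
  have "epi_arr C (f \<bullet> g)" unfolding g(5) using g(1) by simp
  then show ?thesis using g(1-4) by (intro epi_right_factor[of f g])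
qed

lemma iso_mono:
  assumes "iso_arr C f"
  shows "mono_arr C f"
proof -
  obtain g where g: "f \<in> Arr C" "g \<in> Arr C" "Dom C g = Cod C f" "Cod C g = Dom C f"
    "g \<bullet> f = Ident C (Dom C f)" using assms by (auto elim: iso_arrE)
  show ?thesis unfolding mono_iff
  proof (intro conjI ballI impI)
    fix a assume a: "a \<in> Arr C" "Cod C a = Dom C f" "f \<bullet> a = Zr (Dom C a) (Cod C f)"
    have "a = (g \<bullet> f) \<bullet> a" unfolding g(5) using a(1,2) by simp
    also have "\<dots> = g \<bullet> (f \<bullet> a)" using a(1,2) g(1-4) by simp
    finally show "a = Zr (Dom C a) (Dom C f)" unfolding a(3) using a(1) g(1-4) by simp
  qed (use g in simp)
qed

lemma isomorphic_iff: "isomorphic C X Y \<longleftrightarrow> (\<exists>f. iso_arr C f \<and> Dom C f = X \<and> Cod C f = Y)"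
  unfolding isomorphic_def Bex_def Hom_iff iso_arr_def by blast

lemma isomorphic_sym: "isomorphic C X Y \<Longrightarrow> isomorphic C Y X"
  unfolding isomorphic_iff by (metis iso_arrE)

lemma isomorphic_obj: "isomorphic C X Y \<Longrightarrow> X \<in> Obj C \<and> Y \<in> Obj C"
  unfolding isomorphic_iff by (auto simp: iso_arr_def)

lemma is_zero_isomorphic:
  assumes "is_zero C X" "isomorphic C X Y"
  shows "is_zero C Y"
proof -
  obtain f where f: "iso_arr C f" "Dom C f = X" "Cod C f = Y" using assms unfolding isomorphic_iff by auto
  then obtain g where g: "f \<in> Arr C" "g \<in> Arr C" "Dom C g = Y" "Cod C g = X" "f \<bullet> g = Ident C Y"
    by (metis iso_arrE)
  have "f = Zr X Y" using zero_obj_arr(1)[OF assms(1) g(1)] f by simp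
  then have "Ident C Y = Zr X Y \<bullet> g" using g(5) by metis
  also have "\<dots> = Zr Y Y" using g cod_obj[of f] f by simp
  finally show ?thesis using g cod_obj[of f] f by (simp add: is_zero_iff)
qed

section \<open>Kernels and cokernels through their universal properties\<close>

lemma is_kernelD:
  assumes "is_kernel C f k"
  shows "f \<in> Arr C" "k \<in> Arr C" "Cod C k = Dom C f" "f \<bullet> k = Zr (Dom C k) (Cod C f)" "mono_arr C k"
proof -
  show *: "f \<in> Arr C" "k \<in> Arr C" "Cod C k = Dom C f" "f \<bullet> k = Zr (Dom C k) (Cod C f)"
    using assms unfolding is_kernel_def by auto
  show "mono_arr C k" unfolding mono_iff
  proof (intro conjI ballI impI *(2))
    fix g assume g: "g \<in> Arr C" "Cod C g = Dom C k" "k \<bullet> g = Zr (Dom C g) (Cod C k)"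
    have "k \<bullet> Zr (Dom C g) (Dom C k) = Zr (Dom C g) (Cod C k)" using * g by simp
    moreover have "f \<bullet> Zr (Dom C g) (Cod C k) = Zr (Dom C g) (Cod C f)" using * g by simp
    ultimately show "g = Zr (Dom C g) (Dom C k)" using assms * g zero_arr
      unfolding is_kernel_def Ball_def Hom_iff by (metis dom_obj cod_obj)
  qed
qed

lemma kernel_lift:
  assumes "is_kernel C f k" "t \<in> Arr C" "Cod C t = Dom C f" "f \<bullet> t = Zr (Dom C t) (Cod C f)"
  obtains u where "u \<in> Arr C" "Dom C u = Dom C t" "Cod C u = Dom C k" "k \<bullet> u = t"
  using assms unfolding is_kernel_def Ball_def Hom_iff by (metis dom_obj)

text \<open>Uniqueness of lifts is traded for monicity of \<open>k\<close>, which is usually known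
  beforehand, so only the existence of a lift remains to be shown.\<close>

lemma is_kernelI:
  assumes "f \<in> Arr C" "mono_arr C k" "Cod C k = Dom C f" "f \<bullet> k = Zr (Dom C k) (Cod C f)"
    "\<And>t. t \<in> Arr C \<Longrightarrow> Cod C t = Dom C f \<Longrightarrow> f \<bullet> t = Zr (Dom C t) (Cod C f) \<Longrightarrow>
      \<exists>u. u \<in> Arr C \<and> Dom C u = Dom C t \<and> Cod C u = Dom C k \<and> k \<bullet> u = t"
  shows "is_kernel C f k"
  unfolding is_kernel_def Ball_def Hom_iff
proof (intro conjI allI impI)
  fix W t assume "W \<in> Obj C" "t \<in> Arr C \<and> Dom C t = W \<and> Cod C t = Dom C f" "f \<bullet> t = Zr W (Cod C f)"
  then obtain u where u: "u \<in> Arr C" "Dom C u = W" "Cod C u = Dom C k" "k \<bullet> u = t"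
    using assms(5)[of t] by auto
  show "\<exists>!u. (u \<in> Arr C \<and> Dom C u = W \<and> Cod C u = Dom C k) \<and> k \<bullet> u = t"
    using u mono_cancel[OF assms(2)] by (intro ex1I[of _ u]) auto
qed (use assms in auto)

lemma is_cokernelD:
  assumes "is_cokernel C f q"
  shows "f \<in> Arr C" "q \<in> Arr C" "Dom C q = Cod C f" "q \<bullet> f = Zr (Dom C f) (Cod C q)" "epi_arr C q"
proof -
  show *: "f \<in> Arr C" "q \<in> Arr C" "Dom C q = Cod C f" "q \<bullet> f = Zr (Dom C f) (Cod C q)"
    using assms unfolding is_cokernel_def by auto
  show "epi_arr C q" unfolding epi_iff
  proof (intro conjI ballI impI *(2))
    fix g assume g: "g \<in> Arr C" "Dom C g = Cod C q" "g \<bullet> q = Zr (Dom C q) (Cod C g)"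
    have "Zr (Cod C q) (Cod C g) \<bullet> q = Zr (Dom C q) (Cod C g)" using * g by simp
    moreover have "Zr (Dom C q) (Cod C g) \<bullet> f = Zr (Dom C f) (Cod C g)" using * g by simp
    ultimately show "g = Zr (Cod C q) (Cod C g)" using assms * g zero_arr
      unfolding is_cokernel_def Ball_def Hom_iff by (metis dom_obj cod_obj)
  qed
qed

lemma cokernel_desc:
  assumes "is_cokernel C f q" "t \<in> Arr C" "Dom C t = Cod C f" "t \<bullet> f = Zr (Dom C f) (Cod C t)"
  obtains u where "u \<in> Arr C" "Dom C u = Cod C q" "Cod C u = Cod C t" "u \<bullet> q = t"
  using assms unfolding is_cokernel_def Ball_def Hom_iff by (metis cod_obj)

lemma is_cokernelI:
  assumes "f \<in> Arr C" "epi_arr C q" "Dom C q = Cod C f" "q \<bullet> f = Zr (Dom C f) (Cod C q)"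
    "\<And>t. t \<in> Arr C \<Longrightarrow> Dom C t = Cod C f \<Longrightarrow> t \<bullet> f = Zr (Dom C f) (Cod C t) \<Longrightarrow>
      \<exists>u. u \<in> Arr C \<and> Dom C u = Cod C q \<and> Cod C u = Cod C t \<and> u \<bullet> q = t"
  shows "is_cokernel C f q"
  unfolding is_cokernel_def Ball_def Hom_iff
proof (intro conjI allI impI)
  fix W t assume "W \<in> Obj C" "t \<in> Arr C \<and> Dom C t = Cod C f \<and> Cod C t = W" "t \<bullet> f = Zr (Dom C f) W"
  then obtain u where u: "u \<in> Arr C" "Dom C u = Cod C q" "Cod C u = W" "u \<bullet> q = t"
    using assms(5)[of t] by auto
  show "\<exists>!u. (u \<in> Arr C \<and> Dom C u = Cod C q \<and> Cod C u = W) \<and> u \<bullet> q = t"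
    using u epi_cancel[OF assms(2)] by (intro ex1I[of _ u]) auto
qed (use assms in auto)

end

section \<open>Lifting and descending along epimorphisms in an abelian category\<close>

context abelian_category
begin

text \<open>The epimorphism is a cokernel of some \<open>g\<close>, and \<open>g\<close> factors
  through the kernel \<open>k\<close>. Whatever kills \<open>k\<close> therefore kills
  \<open>g\<close> and descends along \<open>p\<close>.\<close>

lemma epi_cokernel_of_kernel:
  assumes "epi_arr C p" "is_kernel C p k"
  shows "is_cokernel C k p"
proof -
  note k = is_kernelD[OF assms(2)]
  obtain g where g: "is_cokernel C g p" using epi_is_cokernel assms(1) by blast
  note gD = is_cokernelD[OF g]
  obtain g' where g': "g' \<in> Arr C" "Dom C g' = Dom C g" "Cod C g' = Dom C k" "k \<bullet> g' = g"
    using kernel_lift[OF assms(2), of g] gD by auto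
  show ?thesis
  proof (intro is_cokernelI assms(1))
    fix t assume t: "t \<in> Arr C" "Dom C t = Cod C k" "t \<bullet> k = Zr (Dom C k) (Cod C t)"
    have "t \<bullet> g = (t \<bullet> k) \<bullet> g'" using t(1,2) g' k by (simp del: k(4))
    also have "\<dots> = Zr (Dom C g) (Cod C t)" unfolding t(3) using t(1) g' k by simp
    finally show "\<exists>u. u \<in> Arr C \<and> Dom C u = Cod C p \<and> Cod C u = Cod C t \<and> u \<bullet> p = t"
      using cokernel_desc[OF g, of t] t(1,2) gD k by metis
  qed (use k in auto)
qed

text \<open>The monomorphism \<open>f\<close> is a kernel of some \<open>g\<close>. As
  \<open>f\<close> is also epi, \<open>g\<close> is zero, so the identity of the target lifts
  through \<open>f\<close>; monicity makes this right inverse two-sided.\<close>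

lemma iso_if_mono_epi:
  assumes "mono_arr C f" "epi_arr C f"
  shows "iso_arr C f"
proof -
  obtain g where g: "is_kernel C g f" using mono_is_kernel assms(1) by blast
  note gD = is_kernelD[OF g]
  have g0: "g = Zr (Cod C f) (Cod C g)" using epi_zero[OF assms(2), of g] gD by simp
  have "g \<bullet> Ident C (Dom C g) = Zr (Dom C g) (Cod C g)" using g0 gD by simp
  then obtain u where u: "u \<in> Arr C" "Dom C u = Cod C f" "Cod C u = Dom C f" "f \<bullet> u = Ident C (Cod C f)"
    using kernel_lift[OF g, of "Ident C (Dom C g)"] gD by auto
  have "f \<bullet> (u \<bullet> f) = (f \<bullet> u) \<bullet> f" using u(1-3) gD by simp
  also have "\<dots> = f \<bullet> Ident C (Dom C f)" unfolding u(4) using gD by simp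
  finally have "u \<bullet> f = Ident C (Dom C f)" using mono_cancel[OF assms(1), of "u \<bullet> f" "Ident C (Dom C f)"] u(1-3) gD by simp
  then show ?thesis using u gD by (intro iso_arrI[of f u])
qed

text \<open>Epimorphisms are stable under pullback. This is what licenses generalized elements: an
  element of the target of an epimorphism comes from an element of the source after refining its
  domain.\<close>

lemma epi_lift:
  assumes p: "epi_arr C p" and y: "y \<in> Arr C" "Cod C y = Cod C p"
  obtains e x where "epi_arr C e" "Cod C e = Dom C y" "x \<in> Arr C" "Dom C x = Dom C e"
    "Cod C x = Dom C p" "p \<bullet> x = y \<bullet> e"
proof -
  obtain S i1 i2 p1 p2 where "is_biproduct C (Dom C p) (Dom C y) S i1 i2 p1 p2"
    using biproduct_exists[of "Dom C p" "Dom C y"] p y by auto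
  then have [simp]: "i1 \<in> Arr C" "i2 \<in> Arr C" "p1 \<in> Arr C" "p2 \<in> Arr C"
    "Dom C i1 = Dom C p" "Cod C i1 = S" "Dom C i2 = Dom C y" "Cod C i2 = S"
    "Dom C p1 = S" "Cod C p1 = Dom C p" "Dom C p2 = S" "Cod C p2 = Dom C y"
    and b: "p1 \<bullet> i1 = Ident C (Dom C p)" "p2 \<bullet> i2 = Ident C (Dom C y)"
    "p2 \<bullet> i1 = Zr (Dom C p) (Dom C y)" "p1 \<bullet> i2 = Zr (Dom C y) (Dom C p)"
    unfolding is_biproduct_def Hom_iff by auto
  have [simp]: "p \<in> Arr C" "y \<in> Arr C" "Cod C y = Cod C p" using p y by auto
  \<comment> \<open>The kernel \<open>k\<close> of this difference is the pullback of
    \<open>p\<close> and \<open>y\<close>, with projections \<open>p1 \<bullet> k\<close> and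
    \<open>p2 \<bullet> k\<close>. The arrow \<phi> is epi because it restricts to \<open>p\<close>
    on the first summand, hence it is the cokernel of \<open>k\<close>; an arrow killing
    \<open>p2 \<bullet> k\<close> then descends along \<phi> and is zero by restriction to the two
    summands.\<close>
  define \<phi> where "\<phi> = (p \<bullet> p1) \<oplus> Neg C (y \<bullet> p2)"
  have [simp]: "\<phi> \<in> Arr C" "Dom C \<phi> = S" "Cod C \<phi> = Cod C p" by (simp_all add: \<phi>_def)
  have \<phi>1: "\<phi> \<bullet> i1 = p" by (simp add: \<phi>_def b)
  have \<phi>e: "epi_arr C \<phi>" using epi_right_factor[of \<phi> i1] p \<phi>1 by simp
  obtain k where k: "is_kernel C \<phi> k" using kernel_exists[of \<phi>] by auto
  note kD = is_kernelD[OF k]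
  have [simp]: "k \<in> Arr C" "Cod C k = S" using kD by auto
  have ck: "is_cokernel C k \<phi>" using epi_cokernel_of_kernel[OF \<phi>e k] .
  have "epi_arr C (p2 \<bullet> k)" unfolding epi_iff
  proof (intro conjI ballI impI)
    fix c assume c: "c \<in> Arr C" "Dom C c = Cod C (p2 \<bullet> k)" "c \<bullet> (p2 \<bullet> k) = Zr (Dom C (p2 \<bullet> k)) (Cod C c)"
    then have "(c \<bullet> p2) \<bullet> k = Zr (Dom C k) (Cod C c)" by simp
    then obtain c' where c': "c' \<in> Arr C" "Dom C c' = Cod C p" "Cod C c' = Cod C c" "c' \<bullet> \<phi> = c \<bullet> p2"
      using cokernel_desc[OF ck, of "c \<bullet> p2"] c by auto
    have "c' \<bullet> p = (c' \<bullet> \<phi>) \<bullet> i1" using c'(1-3) \<phi>1 by simp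
    also have "\<dots> = Zr (Dom C p) (Cod C c')" unfolding c'(4) using c(1,2) c'(3) by (simp add: b)
    finally have "c' = Zr (Cod C p) (Cod C c')" using epi_zero[OF p] c' by blast
    then have "c \<bullet> p2 = Zr S (Cod C c)" using c' c by (metis comp_zero(1) \<open>\<phi> \<in> Arr C\<close> \<open>Dom C \<phi> = S\<close> \<open>Cod C \<phi> = Cod C p\<close> cod_obj)
    then have "(c \<bullet> p2) \<bullet> i2 = Zr (Dom C y) (Cod C c)" using c(1) cod_obj[of c] by simp
    then show "c = Zr (Cod C (p2 \<bullet> k)) (Cod C c)" using c(1,2) by (simp add: b)
  qed simp
  moreover have "p \<bullet> (p1 \<bullet> k) = y \<bullet> (p2 \<bullet> k)"
  proof -
    have "(p \<bullet> (p1 \<bullet> k)) \<oplus> Neg C (y \<bullet> (p2 \<bullet> k)) = \<phi> \<bullet> k" by (simp add: \<phi>_def)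
    also have "\<dots> = Zr (Dom C k) (Cod C p)" using kD by simp
    finally show ?thesis using eq_neg_iff(1)[of "p \<bullet> (p1 \<bullet> k)" "y \<bullet> (p2 \<bullet> k)"] by simp
  qed
  ultimately show thesis by (intro that[of "p2 \<bullet> k" "p1 \<bullet> k"]) simp_all
qed

lemma epi_epi_lift:
  assumes "epi_arr C p" "epi_arr C y" "Cod C y = Cod C p"
  obtains e x where "epi_arr C e" "Cod C e = Dom C y" "x \<in> Arr C" "Dom C x = Dom C e"
    "Cod C x = Dom C p" "p \<bullet> x = y \<bullet> e" "epi_arr C (y \<bullet> e)"
  using epi_lift[OF assms(1), of y] assms epi_comp by (metis epi_arr_arr)

text \<open>Membership in a subobject may be tested on a cover: \<open>y\<close> kills the kernel of
  \<open>e\<close> because \<open>m\<close> is mono and \<open>m \<bullet> y\<close> factors through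
  \<open>e\<close>, so \<open>y\<close> itself descends.\<close>

lemma mono_descend:
  assumes m: "mono_arr C m" and e: "epi_arr C e" and t: "t \<in> Arr C" "Dom C t = Cod C e" "Cod C t = Cod C m"
    and y: "y \<in> Arr C" "Dom C y = Dom C e" "Cod C y = Dom C m" "m \<bullet> y = t \<bullet> e"
  obtains u where "u \<in> Arr C" "Dom C u = Dom C t" "Cod C u = Dom C m" "m \<bullet> u = t"
proof -
  obtain k where k: "is_kernel C e k" using kernel_exists[of e] e by auto
  note kD = is_kernelD[OF k]
  have me: "m \<in> Arr C" "e \<in> Arr C" using m e by auto
  have "m \<bullet> (y \<bullet> k) = (m \<bullet> y) \<bullet> k" using y(1-3) kD me by simp
  also have "\<dots> = t \<bullet> (e \<bullet> k)" unfolding y(4) using t kD me by (simp del: kD(4))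
  also have "\<dots> = Zr (Dom C k) (Cod C m)" unfolding kD(4) using t kD(1-3) by simp
  finally have "y \<bullet> k = Zr (Dom C k) (Cod C y)" using mono_zero[OF m, of "y \<bullet> k"] y(1-3) kD(1-3) by simp
  then obtain u where u: "u \<in> Arr C" "Dom C u = Cod C e" "Cod C u = Cod C y" "u \<bullet> e = y"
    using cokernel_desc[OF epi_cokernel_of_kernel[OF e k], of y] y kD(1-3) by auto
  have "(m \<bullet> u) \<bullet> e = t \<bullet> e" using u me y by simp
  then have "m \<bullet> u = t" using epi_cancel[OF e, of "m \<bullet> u" t] u me t y by simp
  then show thesis using that[of u] u t y by simp
qed

text \<open>An element with zero class in the cokernel comes from the source of \<open>l\<close>,
  after refinement. The kernel \<open>m\<close> of the cokernel is the image of \<open>l\<close>,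
  and the work lies in showing that \<open>l\<close> is epi onto it.\<close>

lemma cokernel_exact:
  assumes q: "is_cokernel C l q" and z: "z \<in> Arr C" "Cod C z = Cod C l" "q \<bullet> z = Zr (Dom C z) (Cod C q)"
  obtains e y where "epi_arr C e" "Cod C e = Dom C z" "y \<in> Arr C" "Dom C y = Dom C e"
    "Cod C y = Dom C l" "l \<bullet> y = z \<bullet> e"
proof -
  note qD = is_cokernelD[OF q]
  obtain m where m: "is_kernel C q m" using kernel_exists[of q] qD by auto
  note mD = is_kernelD[OF m]
  obtain l' where l': "l' \<in> Arr C" "Dom C l' = Dom C l" "Cod C l' = Dom C m" "m \<bullet> l' = l"
    using kernel_lift[OF m, of l] qD by metis
  have "epi_arr C l'" unfolding epi_iff
  proof (intro conjI ballI impI)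
    fix c assume c: "c \<in> Arr C" "Dom C c = Cod C l'" "c \<bullet> l' = Zr (Dom C l') (Cod C c)"
    obtain j where j: "is_kernel C c j" using kernel_exists[OF c(1)] by auto
    note jD = is_kernelD[OF j]
    obtain l'' where l'': "l'' \<in> Arr C" "Dom C l'' = Dom C l'" "Cod C l'' = Dom C j" "j \<bullet> l'' = l'"
      using kernel_lift[OF j, of l'] l' c by auto
    \<comment> \<open>If \<open>c\<close> kills \<open>l'\<close>, then \<open>l\<close> factors
      through the smaller subobject \<open>m \<bullet> j\<close>. That subobject is the kernel of
      some \<open>g\<close>; since \<open>g\<close> kills \<open>l\<close>, it factors through
      \<open>q\<close> and kills all of \<open>m\<close>. So \<open>m\<close> factors through
      \<open>m \<bullet> j\<close>, which splits \<open>j\<close> and makes \<open>c\<close>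
      zero.\<close>
    have mj: "mono_arr C (m \<bullet> j)" using mono_comp jD mD c l' by simp
    then obtain g where g: "is_kernel C g (m \<bullet> j)" using mono_is_kernel by blast
    note gD = is_kernelD[OF g]
    have *: "Dom C g = Cod C m" "Cod C j = Dom C m" using gD jD mD c l' by auto
    have lmj: "l = (m \<bullet> j) \<bullet> l''" using l' l'' mD jD c by simp
    have "g \<bullet> l = (g \<bullet> (m \<bullet> j)) \<bullet> l''" unfolding lmj using gD(1,2) l'' * mD(1,2) jD(1,2) by simp
    also have "\<dots> = Zr (Dom C l) (Cod C g)" unfolding gD(4) using gD(1) l'' l' * mD(1,2) jD(1,2) by simp
    finally obtain g' where g': "g' \<in> Arr C" "Dom C g' = Cod C q" "Cod C g' = Cod C g" "g' \<bullet> q = g"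
      using cokernel_desc[OF q, of g] gD(1) * mD(3) qD by auto
    have "g \<bullet> m = g' \<bullet> (q \<bullet> m)" using g' qD mD(2,3) comp_assoc'[of m q g'] by metis
    also have "\<dots> = Zr (Dom C m) (Cod C g)" unfolding mD(4) using g' mD(2) qD by simp
    finally obtain v where v: "v \<in> Arr C" "Dom C v = Dom C m" "Cod C v = Dom C (m \<bullet> j)" "(m \<bullet> j) \<bullet> v = m"
      using kernel_lift[OF g, of m] * mD(2) by auto
    have "m \<bullet> (j \<bullet> v) = m \<bullet> Ident C (Dom C m)" using v mD(1-3) jD(1-3) * by simp
    then have jv: "j \<bullet> v = Ident C (Dom C m)"
      using mono_cancel[OF mD(5), of "j \<bullet> v" "Ident C (Dom C m)"] v jD(1-3) * mD(1-3) by simp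
    have "c = c \<bullet> (j \<bullet> v)" unfolding jv using c l' by simp
    also have "\<dots> = (c \<bullet> j) \<bullet> v" using c v jD(2,3) mD(2) * by (simp del: jD(4))
    also have "\<dots> = Zr (Dom C m) (Cod C c)" unfolding jD(4) using v c jD(2) mD(2) * by simp
    finally show "c = Zr (Cod C l') (Cod C c)" using l' by simp
  qed (use l' in simp)
  moreover obtain z' where z': "z' \<in> Arr C" "Dom C z' = Dom C z" "Cod C z' = Dom C m" "m \<bullet> z' = z"
    using kernel_lift[OF m, of z] z qD by metis
  ultimately obtain e y where e: "epi_arr C e" "Cod C e = Dom C z'" "y \<in> Arr C" "Dom C y = Dom C e"
    "Cod C y = Dom C l'" "l' \<bullet> y = z' \<bullet> e" using epi_lift[of l' z'] l' by metis
  have "l \<bullet> y = m \<bullet> (l' \<bullet> y)" using l' e mD(2) comp_assoc'[of y l' m] by metis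
  also have "\<dots> = z \<bullet> e" unfolding e(6) using z' e mD(2) comp_assoc'[of e z' m] by (metis epi_arr_arr)
  finally show thesis using that[of e y] e z' l' by simp
qed

text \<open>Exactness in the middle only has to be checked locally, because the lifts descend along
  \<open>e\<close> by \<open>mono_descend\<close>.\<close>

lemma short_exactI:
  assumes "mono_arr C i" "epi_arr C p" "Cod C i = Dom C p" "p \<bullet> i = Zr (Dom C i) (Cod C p)"
    and ex: "\<And>z. z \<in> Arr C \<Longrightarrow> Cod C z = Dom C p \<Longrightarrow> p \<bullet> z = Zr (Dom C z) (Cod C p) \<Longrightarrow>
      \<exists>e y. epi_arr C e \<and> Cod C e = Dom C z \<and> y \<in> Arr C \<and> Dom C y = Dom C e \<and> Cod C y = Dom C i \<and> i \<bullet> y = z \<bullet> e"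
  shows "short_exact C i p"
proof -
  have k: "is_kernel C p i"
  proof (rule is_kernelI[OF epi_arr_arr[OF assms(2)] assms(1,3,4)])
    fix t assume t: "t \<in> Arr C" "Cod C t = Dom C p" "p \<bullet> t = Zr (Dom C t) (Cod C p)"
    obtain e y where e: "epi_arr C e" "Cod C e = Dom C t" "y \<in> Arr C" "Dom C y = Dom C e" "Cod C y = Dom C i" "i \<bullet> y = t \<bullet> e"
      using ex[OF t] by blast
    have "thesis" if "\<And>u. u \<in> Arr C \<Longrightarrow> Dom C u = Dom C t \<Longrightarrow> Cod C u = Dom C i \<Longrightarrow> i \<bullet> u = t \<Longrightarrow> thesis" for thesis
      by (rule mono_descend[OF assms(1) e(1) t(1) e(2)[symmetric] trans[OF t(2) assms(3)[symmetric]] e(3-6) that])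
    then show "\<exists>u. u \<in> Arr C \<and> Dom C u = Dom C t \<and> Cod C u = Dom C i \<and> i \<bullet> u = t"
      by blast
  qed
  show ?thesis unfolding short_exact_def by (intro conjI k epi_cokernel_of_kernel assms(2))
qed

end

section \<open>Cohomology of bounded complexes\<close>

context abelian_category
begin

lemma cplx_simps [simp]:
  assumes "bounded_complex C X"
  shows "ob X n \<in> Obj C" "df X n \<in> Arr C" "Dom C (df X n) = ob X n" "Cod C (df X n) = ob X (n + 1)"
  using assms unfolding bounded_complex_def Hom_iff by blast+

text \<open>The degree \<open>m\<close> is a separate variable with premise
  \<open>m = n + 1\<close>, so the rule also fires on neighbouring degrees written as
  \<open>n - 1\<close> and \<open>n\<close>, which do not unify with \<open>n\<close> and
  \<open>n + 1\<close>. The second form acts on elements. Later rules about chain maps follow the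
  same pattern.\<close>

lemma dd_zero [simp]:
  assumes "bounded_complex C X" "m = n + 1"
  shows "df X m \<bullet> df X n = Zr (ob X n) (ob X (m + 1))"
    "x \<in> Arr C \<Longrightarrow> Cod C x = ob X n \<Longrightarrow> df X m \<bullet> (df X n \<bullet> x) = Zr (Dom C x) (ob X (m + 1))"
proof -
  show *: "df X m \<bullet> df X n = Zr (ob X n) (ob X (m + 1))"
    using assms unfolding bounded_complex_def by blast
  show "x \<in> Arr C \<Longrightarrow> Cod C x = ob X n \<Longrightarrow> df X m \<bullet> (df X n \<bullet> x) = Zr (Dom C x) (ob X (m + 1))"
    by (rule trans[OF assoc_eq[OF *]]) (use assms in simp_all)
qed

lemma chain_mapD:
  assumes "chain_map C X Y f" "bounded_complex C X" "bounded_complex C Y"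
  shows "f n \<in> Arr C" "Dom C (f n) = ob X n" "Cod C (f n) = ob Y n"
    "m = n + 1 \<Longrightarrow> f m \<bullet> df X n = df Y n \<bullet> f n"
    "m = n + 1 \<Longrightarrow> x \<in> Arr C \<Longrightarrow> Cod C x = ob X n \<Longrightarrow> f m \<bullet> (df X n \<bullet> x) = df Y n \<bullet> (f n \<bullet> x)"
proof -
  show *: "f n \<in> Arr C" "Dom C (f n) = ob X n" "Cod C (f n) = ob Y n" for n
    using assms(1) unfolding chain_map_def Hom_iff by blast+
  show **: "f m \<bullet> df X n = df Y n \<bullet> f n" if "m = n + 1" for n m
    using assms(1) that unfolding chain_map_def by simp
  show "m = n + 1 \<Longrightarrow> x \<in> Arr C \<Longrightarrow> Cod C x = ob X n \<Longrightarrow> f m \<bullet> (df X n \<bullet> x) = df Y n \<bullet> (f n \<bullet> x)"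
    by (rule trans[OF assoc_eq[OF **]]) (use assms(2,3) * in simp_all)
qed

text \<open>A generalized element of \<open>X\<close> in degree \<open>n\<close> is an arrow into \<open>ob X n\<close>; statements about the
  existence of elements hold after precomposition with an epimorphism.\<close>

definition cyc :: "('a, 'b) cplx \<Rightarrow> int \<Rightarrow> 'b \<Rightarrow> bool" where
  "cyc X n z \<longleftrightarrow> z \<in> Arr C \<and> Cod C z = ob X n \<and> df X n \<bullet> z = Zr (Dom C z) (ob X (n + 1))"

definition bdry :: "('a, 'b) cplx \<Rightarrow> int \<Rightarrow> 'b \<Rightarrow> bool" where
  "bdry X n z \<longleftrightarrow> z \<in> Arr C \<and> Cod C z = ob X n \<and>
    (\<exists>e w. epi_arr C e \<and> Cod C e = Dom C z \<and> w \<in> Arr C \<and> Dom C w = Dom C e \<and>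
      Cod C w = ob X (n - 1) \<and> df X (n - 1) \<bullet> w = z \<bullet> e)"

definition acyc :: "('a, 'b) cplx \<Rightarrow> int \<Rightarrow> bool" where
  "acyc X n \<longleftrightarrow> (\<forall>z. cyc X n z \<longrightarrow> bdry X n z)"

definition hinj :: "('a, 'b) cplx \<Rightarrow> ('a, 'b) cplx \<Rightarrow> (int \<Rightarrow> 'b) \<Rightarrow> int \<Rightarrow> bool" where
  "hinj X Y f n \<longleftrightarrow> (\<forall>z. cyc X n z \<and> bdry Y n (f n \<bullet> z) \<longrightarrow> bdry X n z)"

definition hsurj :: "('a, 'b) cplx \<Rightarrow> ('a, 'b) cplx \<Rightarrow> (int \<Rightarrow> 'b) \<Rightarrow> int \<Rightarrow> bool" where
  "hsurj X Y f n \<longleftrightarrow> (\<forall>z. cyc Y n z \<longrightarrow> (\<exists>e x. epi_arr C e \<and> Cod C e = Dom C z \<and> cyc X n x \<and>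
    Dom C x = Dom C e \<and> bdry Y n (z \<bullet> e \<oplus> Neg C (f n \<bullet> x))))"

lemma cycD: "cyc X n z \<Longrightarrow> z \<in> Arr C" "cyc X n z \<Longrightarrow> Cod C z = ob X n"
    "cyc X n z \<Longrightarrow> df X n \<bullet> z = Zr (Dom C z) (ob X (n + 1))"
  by (simp_all add: cyc_def)

lemma bdryD: "bdry X n z \<Longrightarrow> z \<in> Arr C" "bdry X n z \<Longrightarrow> Cod C z = ob X n"
  by (simp_all add: bdry_def)

lemma bdryI:
  assumes "z \<in> Arr C" "Cod C z = ob X n" "epi_arr C e" "Cod C e = Dom C z" "w \<in> Arr C"
    "Dom C w = Dom C e" "Cod C w = ob X (n - 1)" "df X (n - 1) \<bullet> w = z \<bullet> e"
  shows "bdry X n z"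
  using assms unfolding bdry_def by blast

lemma bdryE:
  assumes "bdry X n z"
  obtains e w where "epi_arr C e" "Cod C e = Dom C z" "w \<in> Arr C" "Dom C w = Dom C e"
    "Cod C w = ob X (n - 1)" "df X (n - 1) \<bullet> w = z \<bullet> e"
  using assms unfolding bdry_def by blast

lemma bdry_d:
  assumes "bounded_complex C X" "w \<in> Arr C" "Cod C w = ob X (n - 1)"
  shows "bdry X n (df X (n - 1) \<bullet> w)"
  by (rule bdryI[of _ _ _ "Ident C (Dom C w)" w]) (use assms in simp_all)

lemma bdry_zero:
  assumes "bounded_complex C X" "T \<in> Obj C"
  shows "bdry X n (Zr T (ob X n))"
  using bdry_d[OF assms(1), of "Zr T (ob X (n - 1))" n] assms by simp

lemma bdry_neg:
  assumes "bounded_complex C X" "bdry X n z"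
  shows "bdry X n (Neg C z)"
proof -
  note z = bdryD[OF assms(2)]
  obtain e w where e: "epi_arr C e" "Cod C e = Dom C z" "w \<in> Arr C" "Dom C w = Dom C e"
    "Cod C w = ob X (n - 1)" "df X (n - 1) \<bullet> w = z \<bullet> e" using bdryE[OF assms(2)] .
  show ?thesis by (rule bdryI[of _ _ _ e "Neg C w"]) (use e z assms(1) in simp_all)
qed

lemma bdry_add:
  assumes "bounded_complex C X" "bdry X n y" "bdry X n z" "Dom C y = Dom C z"
  shows "bdry X n (y \<oplus> z)"
proof -
  note y = bdryD[OF assms(2)] note z = bdryD[OF assms(3)]
  obtain e w where e: "epi_arr C e" "Cod C e = Dom C y" "w \<in> Arr C" "Dom C w = Dom C e"
    "Cod C w = ob X (n - 1)" "df X (n - 1) \<bullet> w = y \<bullet> e" using bdryE[OF assms(2)] .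
  obtain e' w' where e': "epi_arr C e'" "Cod C e' = Dom C z" "w' \<in> Arr C" "Dom C w' = Dom C e'"
    "Cod C w' = ob X (n - 1)" "df X (n - 1) \<bullet> w' = z \<bullet> e'" using bdryE[OF assms(3)] .
  \<comment> \<open>The two primitives live over different covers of the same domain and are added
    over a common refinement of both.\<close>
  have "Cod C e' = Cod C e" using e(2) e'(2) assms(4) by simp
  then obtain a b where a: "epi_arr C a" "Cod C a = Dom C e'" "b \<in> Arr C" "Dom C b = Dom C a"
    "Cod C b = Dom C e" "e \<bullet> b = e' \<bullet> a" "epi_arr C (e' \<bullet> a)" using epi_epi_lift[OF e(1) e'(1)] by blast
  have "df X (n - 1) \<bullet> (w \<bullet> b \<oplus> w' \<bullet> a) = (y \<bullet> e) \<bullet> b \<oplus> (z \<bullet> e') \<bullet> a"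
    using e(1-5) e'(1-5) a(1-5) assms(1) by (simp add: assoc_eq[OF e(6)] assoc_eq[OF e'(6)] y z)
  also have "\<dots> = (y \<oplus> z) \<bullet> (e' \<bullet> a)"
    using e(1-2) e'(1-2) a(1-5) assms(1,4) y z by (simp add: a(6))
  finally show ?thesis
    using y z e e' a assms(1,4) by (intro bdryI[of _ _ _ "e' \<bullet> a" "w \<bullet> b \<oplus> w' \<bullet> a"]) simp_all
qed

lemma bdry_comp:
  assumes "bounded_complex C X" "bdry X n z" "a \<in> Arr C" "Cod C a = Dom C z"
  shows "bdry X n (z \<bullet> a)"
proof -
  note z = bdryD[OF assms(2)]
  obtain e w where e: "epi_arr C e" "Cod C e = Dom C z" "w \<in> Arr C" "Dom C w = Dom C e"
    "Cod C w = ob X (n - 1)" "df X (n - 1) \<bullet> w = z \<bullet> e" using bdryE[OF assms(2)] .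
  obtain e' b where e': "epi_arr C e'" "Cod C e' = Dom C a" "b \<in> Arr C" "Dom C b = Dom C e'"
    "Cod C b = Dom C e" "e \<bullet> b = a \<bullet> e'" using epi_lift[OF e(1) assms(3)] assms(4) e(2) by metis
  have "df X (n - 1) \<bullet> (w \<bullet> b) = z \<bullet> (e \<bullet> b)"
    using e(1-5) e'(1-5) z assms(1) by (simp add: assoc_eq[OF e(6)])
  also have "\<dots> = (z \<bullet> a) \<bullet> e'" unfolding e'(6) using z e' assms by simp
  finally show ?thesis
    using z e e' assms by (intro bdryI[of _ _ _ e' "w \<bullet> b"]) simp_all
qed

text \<open>Being a boundary is local: the cover in a witness for \<open>z \<bullet> e\<close> is
  composed with \<open>e\<close>.\<close>

lemma bdry_descend:
  assumes "bounded_complex C X" "bdry X n (z \<bullet> e)" "epi_arr C e" "z \<in> Arr C" "Cod C e = Dom C z"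
  shows "bdry X n z"
proof -
  note ze = bdryD[OF assms(2)]
  obtain e' w where e: "epi_arr C e'" "Cod C e' = Dom C (z \<bullet> e)" "w \<in> Arr C" "Dom C w = Dom C e'"
    "Cod C w = ob X (n - 1)" "df X (n - 1) \<bullet> w = (z \<bullet> e) \<bullet> e'" using bdryE[OF assms(2)] .
  show ?thesis
    by (rule bdryI[of _ _ _ "e \<bullet> e'" w]) (use e ze assms epi_comp[OF e(1) assms(3)] in simp_all)
qed

lemma cyc_add:
  "\<lbrakk>bounded_complex C X; cyc X n y; cyc X n z; Dom C y = Dom C z\<rbrakk> \<Longrightarrow> cyc X n (y \<oplus> z)"
  unfolding cyc_def by simp

lemma cyc_neg: "\<lbrakk>bounded_complex C X; cyc X n z\<rbrakk> \<Longrightarrow> cyc X n (Neg C z)"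
  unfolding cyc_def by simp

lemma cyc_comp: "\<lbrakk>bounded_complex C X; cyc X n z; a \<in> Arr C; Cod C a = Dom C z\<rbrakk> \<Longrightarrow> cyc X n (z \<bullet> a)"
  unfolding cyc_def by (simp add: assoc_eq)

lemma cyc_map:
  assumes "chain_map C X Y f" "bounded_complex C X" "bounded_complex C Y" "cyc X n z"
  shows "cyc Y n (f n \<bullet> z)"
proof -
  note [simp] = chain_mapD[OF assms(1-3)]
  note z = cycD[OF assms(4)]
  have "df Y n \<bullet> (f n \<bullet> z) = f (n + 1) \<bullet> (df X n \<bullet> z)" using assms(2,3) z(1,2) by simp
  also have "\<dots> = Zr (Dom C z) (ob Y (n + 1))" unfolding z(3) using assms(2,3) z(1) by simp
  finally show ?thesis using z assms(2,3) by (simp add: cyc_def)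
qed

lemma bdry_map:
  assumes "chain_map C X Y f" "bounded_complex C X" "bounded_complex C Y" "bdry X n z"
  shows "bdry Y n (f n \<bullet> z)"
proof -
  note [simp] = chain_mapD[OF assms(1-3)]
  note z = bdryD[OF assms(4)]
  obtain e w where e: "epi_arr C e" "Cod C e = Dom C z" "w \<in> Arr C" "Dom C w = Dom C e"
    "Cod C w = ob X (n - 1)" "df X (n - 1) \<bullet> w = z \<bullet> e" using bdryE[OF assms(4)] .
  have "df Y (n - 1) \<bullet> (f (n - 1) \<bullet> w) = f n \<bullet> (df X (n - 1) \<bullet> w)" using e(1-5) assms(2,3) by simp
  also have "\<dots> = (f n \<bullet> z) \<bullet> e" unfolding e(6) using e(1-5) z by simp
  finally show ?thesis
    by (intro bdryI[of _ _ _ e "f (n - 1) \<bullet> w"]) (use z e assms(2,3) in simp_all)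
qed

lemma bdry_eq:
  assumes "bounded_complex C X" "bdry X n (y \<oplus> Neg C z)" "bdry X n z" "y \<in> Arr C" "Dom C y = Dom C z" "Cod C y = Cod C z"
  shows "bdry X n y"
proof -
  have "(y \<oplus> Neg C z) \<oplus> z = y" using assms bdryD[OF assms(3)] by simp
  then show ?thesis using bdry_add[OF assms(1,2,3)] assms bdryD[OF assms(3)] by simp
qed

text \<open>The last clause is the dictionary between cohomology objects and elements: the class of
  a cycle vanishes exactly when the cycle is a boundary. All later chases on cohomology use only
  this clause and that \<open>q\<close> is epi.\<close>

lemma cohD:
  assumes "bounded_complex C X" "cohomology_at C X n k q"
  shows "is_kernel C (df X n) k" "epi_arr C q" "Dom C q = Dom C k" "k \<in> Arr C" "q \<in> Arr C"
    "Cod C k = ob X n" "cyc X n k"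
    "\<zeta> \<in> Arr C \<Longrightarrow> Cod C \<zeta> = Dom C k \<Longrightarrow> q \<bullet> \<zeta> = Zr (Dom C \<zeta>) (Cod C q) \<longleftrightarrow> bdry X n (k \<bullet> \<zeta>)"
proof -
  obtain l where k: "is_kernel C (df X n) k" and l: "l \<in> Arr C" "Dom C l = ob X (n - 1)" "Cod C l = Dom C k"
    "k \<bullet> l = df X (n - 1)" and q: "is_cokernel C l q"
    using assms(2) unfolding cohomology_at_def Bex_def Hom_iff by blast
  note kD = is_kernelD[OF k] note qD = is_cokernelD[OF q]
  show "is_kernel C (df X n) k" by fact
  show "epi_arr C q" "Dom C q = Dom C k" "k \<in> Arr C" "q \<in> Arr C" "Cod C k = ob X n" "cyc X n k"
    using kD qD l assms(1) by (simp_all add: cyc_def)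
  assume z: "\<zeta> \<in> Arr C" "Cod C \<zeta> = Dom C k"
  show "q \<bullet> \<zeta> = Zr (Dom C \<zeta>) (Cod C q) \<longleftrightarrow> bdry X n (k \<bullet> \<zeta>)"
  proof
    assume a: "q \<bullet> \<zeta> = Zr (Dom C \<zeta>) (Cod C q)"
    then obtain e y where e: "epi_arr C e" "Cod C e = Dom C \<zeta>" "y \<in> Arr C" "Dom C y = Dom C e"
      "Cod C y = Dom C l" "l \<bullet> y = \<zeta> \<bullet> e" using cokernel_exact[OF q, of \<zeta>] z l by metis
    have "df X (n - 1) \<bullet> y = k \<bullet> (l \<bullet> y)" using assoc_eq[OF l(4), of y] kD(2) l(1-3) e(1-5) by simp
    also have "\<dots> = (k \<bullet> \<zeta>) \<bullet> e" unfolding e(6) using e kD z by simp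
    finally show "bdry X n (k \<bullet> \<zeta>)"
      by (intro bdryI[of _ _ _ e y]) (use e z kD l assms(1) in simp_all)
  next
    assume "bdry X n (k \<bullet> \<zeta>)"
    then obtain e w where e: "epi_arr C e" "Cod C e = Dom C (k \<bullet> \<zeta>)" "w \<in> Arr C" "Dom C w = Dom C e"
      "Cod C w = ob X (n - 1)" "df X (n - 1) \<bullet> w = (k \<bullet> \<zeta>) \<bullet> e" by (rule bdryE)
    have e2: "Cod C e = Dom C \<zeta>" using e(2) kD z by simp
    have "k \<bullet> (l \<bullet> w) = df X (n - 1) \<bullet> w" using assoc_eq[OF l(4), of w] kD(2) l(1-3) e(1-5) by simp
    also have "\<dots> = k \<bullet> (\<zeta> \<bullet> e)" unfolding e(6) using e kD z e2 by simp
    finally have "l \<bullet> w = \<zeta> \<bullet> e" using mono_cancel[OF kD(5), of "l \<bullet> w" "\<zeta> \<bullet> e"] l z e e2 by simp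
    then have "(q \<bullet> \<zeta>) \<bullet> e = q \<bullet> (l \<bullet> w)" using qD z e e2 l by simp
    also have "\<dots> = Zr (Dom C e) (Cod C q)" using qD l e by (simp add: assoc_eq[OF qD(4)])
    finally show "q \<bullet> \<zeta> = Zr (Dom C \<zeta>) (Cod C q)"
      using epi_zero[OF e(1), of "q \<bullet> \<zeta>"] qD z l e2 by simp
  qed
qed

lemma cyc_factor:
  assumes "bounded_complex C X" "cohomology_at C X n k q" "cyc X n z"
  obtains \<zeta> where "\<zeta> \<in> Arr C" "Dom C \<zeta> = Dom C z" "Cod C \<zeta> = Dom C k" "k \<bullet> \<zeta> = z"
  using kernel_lift[OF cohD(1)[OF assms(1,2)], of z] cycD[OF assms(3)] assms(1)
  by (metis cplx_simps(3,4))

text \<open>The dictionary of \<open>cohD\<close> characterises cohomology. With \<open>j\<close>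
  the kernel of \<open>q\<close>, the cycle \<open>k \<bullet> j\<close> is a boundary, so
  \<open>j\<close> locally lifts through \<open>l\<close>; an arrow that kills \<open>l\<close>
  therefore kills \<open>j\<close> and descends along \<open>q\<close>.\<close>

lemma cohI:
  assumes X: "bounded_complex C X" and k: "is_kernel C (df X n) k" and q: "epi_arr C q" "Dom C q = Dom C k"
    and iff: "\<And>\<zeta>. \<zeta> \<in> Arr C \<Longrightarrow> Cod C \<zeta> = Dom C k \<Longrightarrow> q \<bullet> \<zeta> = Zr (Dom C \<zeta>) (Cod C q) \<longleftrightarrow> bdry X n (k \<bullet> \<zeta>)"
  shows "cohomology_at C X n k q"
proof -
  note kD = is_kernelD[OF k]
  obtain l where l: "l \<in> Arr C" "Dom C l = ob X (n - 1)" "Cod C l = Dom C k" "k \<bullet> l = df X (n - 1)"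
    using kernel_lift[OF k, of "df X (n - 1)"] X by auto
  have "is_cokernel C l q"
  proof (rule is_cokernelI[OF l(1) q(1)])
    show "Dom C q = Cod C l" using q l by simp
    have "bdry X n (k \<bullet> l)" unfolding l(4) using bdry_d[OF X, of "Ident C (ob X (n - 1))" n] X by simp
    then show "q \<bullet> l = Zr (Dom C l) (Cod C q)" using iff[of l] l by simp
    fix t assume t: "t \<in> Arr C" "Dom C t = Cod C l" "t \<bullet> l = Zr (Dom C l) (Cod C t)"
    obtain j where j: "is_kernel C q j" using kernel_exists[of q] q by auto
    note jD = is_kernelD[OF j]
    have jk: "Cod C j = Dom C k" using jD q by simp
    have "bdry X n (k \<bullet> j)" using iff[of j] jD q by simp
    then obtain e w where e: "epi_arr C e" "Cod C e = Dom C (k \<bullet> j)" "w \<in> Arr C" "Dom C w = Dom C e"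
      "Cod C w = ob X (n - 1)" "df X (n - 1) \<bullet> w = (k \<bullet> j) \<bullet> e" by (rule bdryE)
    have e2: "Cod C e = Dom C j" using e(2) kD jD q by simp
    have "k \<bullet> (l \<bullet> w) = df X (n - 1) \<bullet> w" using assoc_eq[OF l(4), of w] kD(2) l(1-3) e(1-5) by simp
    also have "\<dots> = k \<bullet> (j \<bullet> e)" unfolding e(6) using e(1) kD(1-3) jD(1,2) e2 jk by simp
    finally have lw: "l \<bullet> w = j \<bullet> e" using mono_cancel[OF kD(5), of "l \<bullet> w" "j \<bullet> e"] l jD(1,2) e(1,3,5) e2 jk by simp
    have "(t \<bullet> j) \<bullet> e = t \<bullet> (l \<bullet> w)" unfolding lw using t(1,2) jD(1,2) e(1) e2 l jk by simp
    also have "\<dots> = Zr (Dom C e) (Cod C t)" using t(1,2) l e(1-5) by (simp add: assoc_eq[OF t(3)])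
    finally have "t \<bullet> j = Zr (Dom C j) (Cod C t)"
      using epi_zero[OF e(1), of "t \<bullet> j"] t(1,2) jD(1,2) e2 jk l by simp
    then show "\<exists>u. u \<in> Arr C \<and> Dom C u = Cod C q \<and> Cod C u = Cod C t \<and> u \<bullet> q = t"
      using cokernel_desc[OF epi_cokernel_of_kernel[OF q(1) j], of t] t(1,2) jk l by metis
  qed
  then show ?thesis unfolding cohomology_at_def Bex_def Hom_iff using k l by blast
qed

lemma cohomology_exists:
  assumes "bounded_complex C X"
  obtains k q where "cohomology_at C X n k q"
proof -
  obtain k where k: "is_kernel C (df X n) k" using kernel_exists[of "df X n"] assms by auto
  obtain l where l: "l \<in> Arr C" "Dom C l = ob X (n - 1)" "Cod C l = Dom C k" "k \<bullet> l = df X (n - 1)"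
    using kernel_lift[OF k, of "df X (n - 1)"] assms by auto
  obtain q where "is_cokernel C l q" using cokernel_exists l by blast
  then show thesis using that k l unfolding cohomology_at_def Bex_def Hom_iff by blast
qed

text \<open>The condition inside \<open>quasi_iso\<close> on a map of cocycles and the induced map
  of cohomology, with the chosen representatives as parameters so that it can be analysed for each
  choice.\<close>

definition cohmap :: "(int \<Rightarrow> 'b) \<Rightarrow> int \<Rightarrow> 'b \<Rightarrow> 'b \<Rightarrow> 'b \<Rightarrow> 'b \<Rightarrow> 'b \<Rightarrow> 'b \<Rightarrow> bool" where
  "cohmap f n k q k' q' \<kappa> \<eta> \<longleftrightarrow> \<kappa> \<in> Hom C (Dom C k) (Dom C k') \<and> \<eta> \<in> Hom C (Cod C q) (Cod C q') \<and>
    k' \<bullet> \<kappa> = f n \<bullet> k \<and> \<eta> \<bullet> q = q' \<bullet> \<kappa>"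

context
  fixes X Y f n k q k' q'
  assumes X: "bounded_complex C X" and Y: "bounded_complex C Y" and f: "chain_map C X Y f"
    and k: "cohomology_at C X n k q" and k': "cohomology_at C Y n k' q'"
begin

lemma cohmap_exists: "\<exists>\<kappa> \<eta>. cohmap f n k q k' q' \<kappa> \<eta>"
proof -
  note [simp] = chain_mapD[OF f X Y]
  note c = cohD[OF X k] note c' = cohD[OF Y k']
  \<comment> \<open>The kernel \<open>k\<close> is itself the universal cycle; factoring its image
    gives \<kappa>.\<close>
  have "cyc Y n (f n \<bullet> k)" using cyc_map[OF f X Y c(7)] .
  then obtain \<kappa> where \<kappa>: "\<kappa> \<in> Arr C" "Dom C \<kappa> = Dom C k" "Cod C \<kappa> = Dom C k'" "k' \<bullet> \<kappa> = f n \<bullet> k"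
    using cyc_factor[OF Y k'] c by (metis \<open>\<And>n. f n \<in> Arr C\<close> \<open>\<And>n. Dom C (f n) = ob X n\<close> comp_arr(2))
  obtain l where l: "l \<in> Arr C" "Dom C l = ob X (n - 1)" "Cod C l = Dom C k"
    "k \<bullet> l = df X (n - 1)" and q: "is_cokernel C l q"
    using k unfolding cohomology_at_def Bex_def Hom_iff by blast
  have "q \<bullet> l = Zr (Dom C l) (Cod C q)" using is_cokernelD[OF q] by blast
  \<comment> \<open>\<open>k \<bullet> l\<close> is the incoming differential, the universal
    boundary. That \<open>f\<close> sends it to a boundary is what makes
    \<open>q' \<bullet> \<kappa>\<close> descend to \<eta>.\<close>
  then have "bdry X n (k \<bullet> l)" using c(8)[of l] l by simp
  then have "bdry Y n (f n \<bullet> (k \<bullet> l))" using bdry_map[OF f X Y] by blast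
  moreover have "f n \<bullet> (k \<bullet> l) = k' \<bullet> (\<kappa> \<bullet> l)" using \<kappa> c c' l(1-3) by (simp add: assoc_eq[OF \<kappa>(4)])
  ultimately have "q' \<bullet> (\<kappa> \<bullet> l) = Zr (Dom C l) (Cod C q')" using c'(8)[of "\<kappa> \<bullet> l"] \<kappa> l(1-3) by simp
  then have "(q' \<bullet> \<kappa>) \<bullet> l = Zr (Dom C l) (Cod C (q' \<bullet> \<kappa>))" using \<kappa> l c' by simp
  then obtain \<eta> where "\<eta> \<in> Arr C" "Dom C \<eta> = Cod C q" "Cod C \<eta> = Cod C q'" "\<eta> \<bullet> q = q' \<bullet> \<kappa>"
    using cokernel_desc[OF q, of "q' \<bullet> \<kappa>"] \<kappa> l c' by auto
  then show ?thesis unfolding cohmap_def Hom_iff using \<kappa> by blast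
qed

context
  fixes \<kappa> \<eta> assumes h: "cohmap f n k q k' q' \<kappa> \<eta>"
begin

lemma cohmap_zero:
  assumes "\<zeta> \<in> Arr C" "Cod C \<zeta> = Dom C k"
  shows "\<eta> \<bullet> (q \<bullet> \<zeta>) = Zr (Dom C \<zeta>) (Cod C q') \<longleftrightarrow> bdry Y n (f n \<bullet> (k \<bullet> \<zeta>))"
    "\<eta> \<bullet> (q \<bullet> \<zeta>) = q' \<bullet> (\<kappa> \<bullet> \<zeta>)" "f n \<bullet> (k \<bullet> \<zeta>) = k' \<bullet> (\<kappa> \<bullet> \<zeta>)"
proof -
  note [simp] = chain_mapD[OF f X Y]
  note c = cohD[OF X k] note c' = cohD[OF Y k']
  have h': "\<kappa> \<in> Arr C" "Dom C \<kappa> = Dom C k" "Cod C \<kappa> = Dom C k'" "\<eta> \<in> Arr C" "Dom C \<eta> = Cod C q"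
    "Cod C \<eta> = Cod C q'" "k' \<bullet> \<kappa> = f n \<bullet> k" "\<eta> \<bullet> q = q' \<bullet> \<kappa>" using h unfolding cohmap_def Hom_iff by auto
  show 1: "\<eta> \<bullet> (q \<bullet> \<zeta>) = q' \<bullet> (\<kappa> \<bullet> \<zeta>)" using assms h' c(1-7) c'(1-7) by (simp add: assoc_eq[OF h'(8)])
  show 2: "f n \<bullet> (k \<bullet> \<zeta>) = k' \<bullet> (\<kappa> \<bullet> \<zeta>)" using assms h' c(1-7) c'(1-7) by (simp add: assoc_eq[OF h'(7)])
  show "\<eta> \<bullet> (q \<bullet> \<zeta>) = Zr (Dom C \<zeta>) (Cod C q') \<longleftrightarrow> bdry Y n (f n \<bullet> (k \<bullet> \<zeta>))"
    unfolding 1 2 using c'(8)[of "\<kappa> \<bullet> \<zeta>"] assms h' by simp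
qed

lemma cohmap_mono: "mono_arr C \<eta> \<longleftrightarrow> hinj X Y f n"
proof
  note c = cohD[OF X k] note c' = cohD[OF Y k']
  have h': "\<eta> \<in> Arr C" "Dom C \<eta> = Cod C q" "Cod C \<eta> = Cod C q'"
    using h unfolding cohmap_def Hom_iff by auto
  {
    assume m: "mono_arr C \<eta>"
    show "hinj X Y f n" unfolding hinj_def
    proof (intro allI impI; elim conjE)
      fix z assume z: "cyc X n z" "bdry Y n (f n \<bullet> z)"
      obtain \<zeta> where \<zeta>: "\<zeta> \<in> Arr C" "Dom C \<zeta> = Dom C z" "Cod C \<zeta> = Dom C k" "k \<bullet> \<zeta> = z"
        using cyc_factor[OF X k z(1)] .
      have "\<eta> \<bullet> (q \<bullet> \<zeta>) = Zr (Dom C (q \<bullet> \<zeta>)) (Cod C \<eta>)"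
        using cohmap_zero(1)[OF \<zeta>(1,3)] z(2) \<zeta> h' c(2-5) by simp
      then have "q \<bullet> \<zeta> = Zr (Dom C (q \<bullet> \<zeta>)) (Dom C \<eta>)"
        using \<zeta>(1,3) h' c(2-5) by (intro mono_zero[OF m]) simp_all
      then show "bdry X n z" using c(8)[of \<zeta>] \<zeta> h' c(2-5) by simp
    qed
  next
    assume i: "hinj X Y f n"
    show "mono_arr C \<eta>" unfolding mono_iff
    proof (intro conjI ballI impI h'(1))
      fix a assume a: "a \<in> Arr C" "Cod C a = Dom C \<eta>" "\<eta> \<bullet> a = Zr (Dom C a) (Cod C \<eta>)"
      have "Cod C a = Cod C q" using a h' by simp
      \<comment> \<open>Because \<open>q\<close> is epi, an arrow into the cohomology is the class
        of a cycle after refinement.\<close>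
      then obtain e \<zeta> where e: "epi_arr C e" "Cod C e = Dom C a" "\<zeta> \<in> Arr C" "Dom C \<zeta> = Dom C e"
        "Cod C \<zeta> = Dom C q" "q \<bullet> \<zeta> = a \<bullet> e" using epi_lift[OF c(2) a(1)] by blast
      have \<zeta>: "Cod C \<zeta> = Dom C k" using e c by simp
      have "\<eta> \<bullet> (q \<bullet> \<zeta>) = Zr (Dom C \<zeta>) (Cod C q')" unfolding e(6) using a(1,2) e(1,2,4) h' c'(5) by (simp add: assoc_eq[OF a(3)])
      then have "bdry X n (k \<bullet> \<zeta>)" using cohmap_zero(1)[OF e(3) \<zeta>] i cyc_comp[OF X c(7) e(3) \<zeta>]
        unfolding hinj_def by blast
      then have "a \<bullet> e = Zr (Dom C e) (Cod C a)" using c(8)[OF e(3) \<zeta>] e(4,6) a(2) h' by simp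
      then show "a = Zr (Dom C a) (Dom C \<eta>)" using epi_zero[OF e(1) a(1)] e(2) a(2) by simp
    qed
  }
qed

lemma cohmap_epi: "epi_arr C \<eta> \<longleftrightarrow> hsurj X Y f n"
proof
  note [simp] = chain_mapD[OF f X Y]
  note c = cohD[OF X k] note c' = cohD[OF Y k']
  have h': "\<eta> \<in> Arr C" "Dom C \<eta> = Cod C q" "Cod C \<eta> = Cod C q'" "\<kappa> \<in> Arr C" "Dom C \<kappa> = Dom C k"
    "Cod C \<kappa> = Dom C k'"
    using h unfolding cohmap_def Hom_iff by auto
  {
    assume m: "epi_arr C \<eta>"
    show "hsurj X Y f n" unfolding hsurj_def
    proof (intro allI impI)
      fix z assume z: "cyc Y n z"
      obtain \<zeta> where \<zeta>: "\<zeta> \<in> Arr C" "Dom C \<zeta> = Dom C z" "Cod C \<zeta> = Dom C k'" "k' \<bullet> \<zeta> = z"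
        using cyc_factor[OF Y k' z] .
      \<comment> \<open>Lifting along \<open>\<eta> \<bullet> q\<close> produces a cycle of
        \<open>X\<close> directly, instead of a class that would have to be represented
        afterwards.\<close>
      have "epi_arr C (\<eta> \<bullet> q)" using epi_comp[OF c(2) m] h' by simp
      moreover have "Cod C (q' \<bullet> \<zeta>) = Cod C (\<eta> \<bullet> q)" "q' \<bullet> \<zeta> \<in> Arr C" "Dom C (q' \<bullet> \<zeta>) = Dom C z"
        using \<zeta> c(2-5) c'(2-5) h' by simp_all
      ultimately obtain e x where e: "epi_arr C e" "Cod C e = Dom C z" "x \<in> Arr C" "Dom C x = Dom C e"
        "Cod C x = Dom C (\<eta> \<bullet> q)" "(\<eta> \<bullet> q) \<bullet> x = (q' \<bullet> \<zeta>) \<bullet> e" using epi_lift[of "\<eta> \<bullet> q" "q' \<bullet> \<zeta>"] by metis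
      have x: "Cod C x = Dom C k" using e(5) h' c(2-5) by simp
      have "q' \<bullet> (\<kappa> \<bullet> x) = q' \<bullet> (\<zeta> \<bullet> e)"
        unfolding cohmap_zero(2)[OF e(3) x, symmetric] using e(6) e(1-4) x h' c(2-5) c'(2-5) \<zeta> by simp
      then have "q' \<bullet> (\<zeta> \<bullet> e \<oplus> Neg C (\<kappa> \<bullet> x)) = Zr (Dom C (\<zeta> \<bullet> e \<oplus> Neg C (\<kappa> \<bullet> x))) (Cod C q')"
        using e(1-4) x h' c(2-5) c'(2-5) \<zeta> by simp
      then have "bdry Y n (k' \<bullet> (\<zeta> \<bullet> e \<oplus> Neg C (\<kappa> \<bullet> x)))"
        using c'(8)[of "\<zeta> \<bullet> e \<oplus> Neg C (\<kappa> \<bullet> x)"] e(1-4) x h' c'(2-5) \<zeta> by simp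
      moreover have "k' \<bullet> (\<zeta> \<bullet> e \<oplus> Neg C (\<kappa> \<bullet> x)) = z \<bullet> e \<oplus> Neg C (f n \<bullet> (k \<bullet> x))"
        unfolding cohmap_zero(3)[OF e(3) x] using e(1-4) x h' c'(2-5) \<zeta> by (simp add: assoc_eq[OF \<zeta>(4)])
      ultimately have "bdry Y n (z \<bullet> e \<oplus> Neg C (f n \<bullet> (k \<bullet> x)))" by simp
      then show "\<exists>e x. epi_arr C e \<and> Cod C e = Dom C z \<and> cyc X n x \<and>
          Dom C x = Dom C e \<and> bdry Y n (z \<bullet> e \<oplus> Neg C (f n \<bullet> x))"
        using e(1-4) x c(4) cyc_comp[OF X c(7) e(3) x] by (intro exI[of _ e] exI[of _ "k \<bullet> x"]) simp
    qed
  next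
    assume i: "hsurj X Y f n"
    show "epi_arr C \<eta>" unfolding epi_iff
    proof (intro conjI ballI impI h'(1))
      fix b assume b: "b \<in> Arr C" "Dom C b = Cod C \<eta>" "b \<bullet> \<eta> = Zr (Dom C \<eta>) (Cod C b)"
      \<comment> \<open>Surjectivity is applied to the universal cycle \<open>k'\<close>: after
        refinement it comes from \<open>X\<close> up to a boundary, so an arrow killing \<eta> kills
        \<open>q'\<close>, which is epi.\<close>
      obtain e x where e: "epi_arr C e" "Cod C e = Dom C k'" "cyc X n x" "Dom C x = Dom C e"
        "bdry Y n (k' \<bullet> e \<oplus> Neg C (f n \<bullet> x))" using i c'(7) unfolding hsurj_def by blast
      obtain \<zeta> where \<zeta>: "\<zeta> \<in> Arr C" "Dom C \<zeta> = Dom C x" "Cod C \<zeta> = Dom C k" "k \<bullet> \<zeta> = x"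
        using cyc_factor[OF X k e(3)] .
      have "k' \<bullet> (e \<oplus> Neg C (\<kappa> \<bullet> \<zeta>)) = k' \<bullet> e \<oplus> Neg C (f n \<bullet> x)"
        unfolding \<zeta>(4)[symmetric] cohmap_zero(3)[OF \<zeta>(1,3)] using e(1,2,4) \<zeta>(1-3) h' c'(4) by simp
      then have "bdry Y n (k' \<bullet> (e \<oplus> Neg C (\<kappa> \<bullet> \<zeta>)))" using e(5) by simp
      then have "q' \<bullet> (e \<oplus> Neg C (\<kappa> \<bullet> \<zeta>)) = Zr (Dom C e) (Cod C q')"
        using c'(8)[of "e \<oplus> Neg C (\<kappa> \<bullet> \<zeta>)"] e(1,2,4) \<zeta>(1-3) h' by simp
      then have "(q' \<bullet> e) \<oplus> Neg C (q' \<bullet> (\<kappa> \<bullet> \<zeta>)) = Zr (Dom C e) (Cod C q')"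
        using e(1,2,4) \<zeta>(1-3) h' c'(2-5) by simp
      then have *: "q' \<bullet> e = \<eta> \<bullet> (q \<bullet> \<zeta>)"
        unfolding cohmap_zero(2)[OF \<zeta>(1,3)] using e(1,2,4) \<zeta>(1-3) h' c'(2-5)
          eq_neg_iff(1)[of "q' \<bullet> e" "q' \<bullet> (\<kappa> \<bullet> \<zeta>)"] by simp
      have "(b \<bullet> q') \<bullet> e = b \<bullet> (\<eta> \<bullet> (q \<bullet> \<zeta>))" unfolding *[symmetric] using b(1,2) e(1,2,4) h' c'(2-5) by simp
      also have "\<dots> = Zr (Dom C e) (Cod C b)"
        using b(1,2) e(4) \<zeta>(1-3) h' c(2-5) by (simp add: assoc_eq[OF b(3)])
      finally have "b \<bullet> q' = Zr (Dom C q') (Cod C b)"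
        using epi_zero[OF e(1), of "b \<bullet> q'"] e(2) b(1,2) h' c'(2-5) by simp
      then show "b = Zr (Cod C \<eta>) (Cod C b)" using epi_zero[OF c'(2) b(1)] b(2) h' by simp
    qed
  }
qed

end
end

text \<open>The definition allows some choice of cohomology objects in each degree. By the two
  preceding lemmas the induced map is mono or epi according to conditions that mention no choice,
  and in an abelian category mono and epi together give an isomorphism.\<close>

lemma quasi_iso_iff:
  assumes X: "bounded_complex C X" and Y: "bounded_complex C Y"
  shows "quasi_iso C X Y f \<longleftrightarrow> chain_map C X Y f \<and> (\<forall>n. hinj X Y f n \<and> hsurj X Y f n)"
proof
  assume "quasi_iso C X Y f"
  then have f: "chain_map C X Y f" and q: "\<exists>k q k' q'. cohomology_at C X n k q \<and> cohomology_at C Y n k' q' \<and>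
      (\<exists>\<kappa> \<eta>. cohmap f n k q k' q' \<kappa> \<eta> \<and> iso_arr C \<eta>)" for n
    unfolding quasi_iso_def cohmap_def Bex_def by blast+
  have "hinj X Y f n \<and> hsurj X Y f n" for n
  proof -
    obtain k q k' q' \<kappa> \<eta> where a: "cohomology_at C X n k q" "cohomology_at C Y n k' q'"
      "cohmap f n k q k' q' \<kappa> \<eta>" "iso_arr C \<eta>" using q by blast
    show ?thesis using cohmap_mono[OF X Y f a(1-3)] cohmap_epi[OF X Y f a(1-3)] iso_mono[OF a(4)] iso_epi[OF a(4)] by blast
  qed
  then show "chain_map C X Y f \<and> (\<forall>n. hinj X Y f n \<and> hsurj X Y f n)" using f by blast
next
  assume a: "chain_map C X Y f \<and> (\<forall>n. hinj X Y f n \<and> hsurj X Y f n)"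
  then have f: "chain_map C X Y f" by blast
  have "\<exists>k q k' q'. cohomology_at C X n k q \<and> cohomology_at C Y n k' q' \<and>
      (\<exists>\<kappa> \<eta>. cohmap f n k q k' q' \<kappa> \<eta> \<and> iso_arr C \<eta>)" for n
  proof -
    obtain k q where k: "cohomology_at C X n k q" using cohomology_exists[OF X] .
    obtain k' q' where k': "cohomology_at C Y n k' q'" using cohomology_exists[OF Y] .
    obtain \<kappa> \<eta> where h: "cohmap f n k q k' q' \<kappa> \<eta>" using cohmap_exists[OF X Y f k k'] by blast
    have "iso_arr C \<eta>" using cohmap_mono[OF X Y f k k' h] cohmap_epi[OF X Y f k k' h] a
      by (intro iso_if_mono_epi) blast+
    then show ?thesis using k k' h by blast
  qed
  then show "quasi_iso C X Y f" using f unfolding quasi_iso_def cohmap_def Bex_def by blast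
qed

text \<open>A relation rather than a function; it holds for every object of the isomorphism class,
  as \<open>coh_iso\<close> and \<open>coh_unique\<close> show.\<close>

definition coh :: "('a, 'b) cplx \<Rightarrow> int \<Rightarrow> 'a \<Rightarrow> bool" where
  "coh X n A \<longleftrightarrow> (\<exists>k q. cohomology_at C X n k q \<and> Cod C q = A)"

lemma coh_obtain:
  assumes "bounded_complex C X" obtains A where "coh X n A"
  using cohomology_exists[OF assms] unfolding coh_def by metis

lemma coh_obj: "bounded_complex C X \<Longrightarrow> coh X n A \<Longrightarrow> A \<in> Obj C"
  unfolding coh_def using cohD(5) cod_obj by blast

lemma coh_isomorphic:
  assumes X: "bounded_complex C X" and Y: "bounded_complex C Y" and f: "chain_map C X Y f"
    and "hinj X Y f n" "hsurj X Y f n" "coh X n A" "coh Y n B"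
  shows "isomorphic C A B"
proof -
  obtain k q k' q' where k: "cohomology_at C X n k q" "Cod C q = A" and k': "cohomology_at C Y n k' q'" "Cod C q' = B"
    using assms(6,7) unfolding coh_def by blast
  obtain \<kappa> \<eta> where h: "cohmap f n k q k' q' \<kappa> \<eta>" using cohmap_exists[OF X Y f k(1) k'(1)] by blast
  have "iso_arr C \<eta>" using cohmap_mono[OF X Y f k(1) k'(1) h] cohmap_epi[OF X Y f k(1) k'(1) h] assms(4,5)
    by (intro iso_if_mono_epi) blast+
  then show ?thesis unfolding isomorphic_iff using h k(2) k'(2) unfolding cohmap_def Hom_iff by blast
qed

lemma coh_iso:
  assumes X: "bounded_complex C X" and "coh X n A" "isomorphic C A B"
  shows "coh X n B"
proof -
  obtain k q where k: "cohomology_at C X n k q" "Cod C q = A" using assms(2) unfolding coh_def by blast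
  obtain \<phi> where \<phi>: "iso_arr C \<phi>" "Dom C \<phi> = A" "Cod C \<phi> = B" using assms(3) unfolding isomorphic_iff by blast
  note c = cohD[OF X k(1)]
  have \<phi>A: "\<phi> \<in> Arr C" using \<phi> by (simp add: iso_arr_def)
  have "cohomology_at C X n k (\<phi> \<bullet> q)"
  proof (rule cohI[OF X c(1)])
    show "epi_arr C (\<phi> \<bullet> q)" using epi_comp[OF c(2) iso_epi[OF \<phi>(1)]] \<phi> k by simp
    show "Dom C (\<phi> \<bullet> q) = Dom C k" using c(2-5) \<phi> \<phi>A k by simp
    fix \<zeta> assume \<zeta>: "\<zeta> \<in> Arr C" "Cod C \<zeta> = Dom C k"
    have *: "(\<phi> \<bullet> q) \<bullet> \<zeta> = \<phi> \<bullet> (q \<bullet> \<zeta>)" "Cod C (\<phi> \<bullet> q) = Cod C \<phi>" "q \<bullet> \<zeta> \<in> Arr C" "Cod C (q \<bullet> \<zeta>) = Dom C \<phi>" "Dom C (q \<bullet> \<zeta>) = Dom C \<zeta>"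
      using \<zeta> c(2-5) \<phi> \<phi>A k by simp_all
    have "\<phi> \<bullet> (q \<bullet> \<zeta>) = Zr (Dom C \<zeta>) (Cod C \<phi>) \<longleftrightarrow> q \<bullet> \<zeta> = Zr (Dom C \<zeta>) (Cod C q)"
    proof
      assume "\<phi> \<bullet> (q \<bullet> \<zeta>) = Zr (Dom C \<zeta>) (Cod C \<phi>)"
      then show "q \<bullet> \<zeta> = Zr (Dom C \<zeta>) (Cod C q)"
        using mono_zero[OF iso_mono[OF \<phi>(1)] *(3,4)] *(5) \<phi>(2) k(2) by simp
    next
      assume "q \<bullet> \<zeta> = Zr (Dom C \<zeta>) (Cod C q)"
      then show "\<phi> \<bullet> (q \<bullet> \<zeta>) = Zr (Dom C \<zeta>) (Cod C \<phi>)" using \<phi> \<phi>A k \<zeta>(1) by simp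
    qed
    then show "(\<phi> \<bullet> q) \<bullet> \<zeta> = Zr (Dom C \<zeta>) (Cod C (\<phi> \<bullet> q)) \<longleftrightarrow> bdry X n (k \<bullet> \<zeta>)"
      unfolding *(1,2) using c(8)[OF \<zeta>] by simp
  qed
  moreover have "Cod C (\<phi> \<bullet> q) = B" using c(2-5) \<phi> \<phi>A k by simp
  ultimately show ?thesis unfolding coh_def by blast
qed

text \<open>If the universal cycle \<open>k\<close> is a boundary then \<open>q\<close> is zero;
  being epi as well, it forces the identity of \<open>A\<close> to be zero.\<close>

lemma acyc_coh:
  assumes X: "bounded_complex C X" and "coh X n A"
  shows "acyc X n \<longleftrightarrow> is_zero C A"
proof -
  obtain k q where k: "cohomology_at C X n k q" "Cod C q = A" using assms(2) unfolding coh_def by blast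
  note c = cohD[OF X k(1)]
  have kD: "Dom C k \<in> Obj C" using c by simp
  show ?thesis
  proof
    assume "acyc X n"
    then have "bdry X n (k \<bullet> Ident C (Dom C k))" using c(4,7) unfolding acyc_def by simp
    then have "q = Zr (Dom C k) (Cod C q)" using c(8)[of "Ident C (Dom C k)"] kD c(3,5) by simp
    moreover have A: "A \<in> Obj C" using k(2) c by auto
    ultimately have "Ident C A \<bullet> q = Zr (Dom C q) (Cod C (Ident C A))" using c(3,5) k(2) by simp
    then have "Ident C A = Zr (Cod C q) (Cod C (Ident C A))" using epi_zero[OF c(2), of "Ident C A"] A k(2) by simp
    then show "is_zero C A" unfolding is_zero_iff using A k(2) by simp
  next
    assume z: "is_zero C A"
    show "acyc X n" unfolding acyc_def
    proof (intro allI impI)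
      fix z assume "cyc X n z"
      then obtain \<zeta> where \<zeta>: "\<zeta> \<in> Arr C" "Dom C \<zeta> = Dom C z" "Cod C \<zeta> = Dom C k" "k \<bullet> \<zeta> = z"
        by (rule cyc_factor[OF X k(1)])
      have "Dom C (q \<bullet> \<zeta>) = Dom C \<zeta>" "q \<bullet> \<zeta> \<in> Arr C" "Cod C (q \<bullet> \<zeta>) = A" using \<zeta> c(3,5) k(2) by simp_all
      then have "q \<bullet> \<zeta> = Zr (Dom C \<zeta>) A" using zero_obj_arr(2)[OF z, of "q \<bullet> \<zeta>"] by metis
      then show "bdry X n z" using c(8)[of \<zeta>] \<zeta> c(3,5) k(2) by simp
    qed
  qed
qed

end

section \<open>Homotopies and quasi-isomorphisms\<close>

context abelian_category
begin

abbreviation chcomp (infixr "\<odot>" 71) where "g \<odot> f \<equiv> ch_comp C g f"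

text \<open>Boundedness of both complexes is bundled into this and the next two predicates, so that
  one hypothesis supplies all typing facts of a diagram.\<close>

definition cmap :: "('a, 'b) cplx \<Rightarrow> ('a, 'b) cplx \<Rightarrow> (int \<Rightarrow> 'b) \<Rightarrow> bool" where
  "cmap X Y f \<longleftrightarrow> bounded_complex C X \<and> bounded_complex C Y \<and> chain_map C X Y f"

definition hty :: "('a, 'b) cplx \<Rightarrow> ('a, 'b) cplx \<Rightarrow> (int \<Rightarrow> 'b) \<Rightarrow> (int \<Rightarrow> 'b) \<Rightarrow> bool" where
  "hty X Y f g \<longleftrightarrow> cmap X Y f \<and> cmap X Y g \<and> homotopic C X Y f g"

definition qis :: "('a, 'b) cplx \<Rightarrow> ('a, 'b) cplx \<Rightarrow> (int \<Rightarrow> 'b) \<Rightarrow> bool" where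
  "qis X Y f \<longleftrightarrow> cmap X Y f \<and> (\<forall>n. hinj X Y f n \<and> hsurj X Y f n)"

lemma qis_iff: "qis X Y f \<longleftrightarrow> bounded_complex C X \<and> bounded_complex C Y \<and> quasi_iso C X Y f"
  unfolding qis_def cmap_def using quasi_iso_iff by blast

lemma cmapD:
  assumes "cmap X Y f"
  shows "bounded_complex C X" "bounded_complex C Y" "f n \<in> Arr C" "Dom C (f n) = ob X n" "Cod C (f n) = ob Y n"
    "m = n + 1 \<Longrightarrow> f m \<bullet> df X n = df Y n \<bullet> f n"
    "m = n + 1 \<Longrightarrow> x \<in> Arr C \<Longrightarrow> Cod C x = ob X n \<Longrightarrow> f m \<bullet> (df X n \<bullet> x) = df Y n \<bullet> (f n \<bullet> x)"
  using assms chain_mapD[of X Y f] unfolding cmap_def by blast+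

lemma cmapI:
  assumes "bounded_complex C X" "bounded_complex C Y"
    "\<And>n. f n \<in> Arr C \<and> Dom C (f n) = ob X n \<and> Cod C (f n) = ob Y n"
    "\<And>n. df Y n \<bullet> f n = f (n + 1) \<bullet> df X n"
  shows "cmap X Y f"
  using assms unfolding cmap_def chain_map_def Hom_iff by blast

lemma cmap_comp:
  assumes "cmap X Y f" "cmap Y Z g"
  shows "cmap X Z (g \<odot> f)"
proof -
  note [simp] = cmapD[OF assms(1)] cmapD[OF assms(2)]
  show ?thesis by (rule cmapI) (simp_all add: ch_comp_def)
qed

lemma cmap_id: "bounded_complex C X \<Longrightarrow> cmap X X (ch_id C X)"
  by (rule cmapI) (simp_all add: ch_id_def)

lemma cmap_zero: "bounded_complex C X \<Longrightarrow> bounded_complex C Y \<Longrightarrow> cmap X Y (ch_zero C X Y)"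
  by (rule cmapI) (simp_all add: ch_zero_def)

lemma chcomp_assoc:
  assumes "cmap W X f" "cmap X Y g" "cmap Y Z h"
  shows "(h \<odot> g) \<odot> f = h \<odot> g \<odot> f"
proof
  note [simp] = cmapD[OF assms(1)] cmapD[OF assms(2)] cmapD[OF assms(3)]
  show "((h \<odot> g) \<odot> f) n = (h \<odot> g \<odot> f) n" for n by (simp add: ch_comp_def)
qed

lemma chcomp_id:
  assumes "cmap X Y f"
  shows "f \<odot> ch_id C X = f" "ch_id C Y \<odot> f = f"
proof -
  note [simp] = cmapD[OF assms]
  show "f \<odot> ch_id C X = f" "ch_id C Y \<odot> f = f" by (simp_all add: ch_comp_def ch_id_def)
qed

lemma chcomp_zero:
  assumes "cmap X Y f" "bounded_complex C Z"
  shows "f \<odot> ch_zero C Z X = ch_zero C Z Y" "ch_zero C Y Z \<odot> f = ch_zero C X Z"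
proof -
  note [simp] = cmapD[OF assms(1)] assms(2)
  show "f \<odot> ch_zero C Z X = ch_zero C Z Y" "ch_zero C Y Z \<odot> f = ch_zero C X Z"
    by (simp_all add: ch_comp_def ch_zero_def)
qed

lemma htyD: "hty X Y f g \<Longrightarrow> cmap X Y f" "hty X Y f g \<Longrightarrow> cmap X Y g"
  by (simp_all add: hty_def)

lemma htyE:
  assumes "hty X Y f g"
  obtains h where "\<And>n. h n \<in> Arr C" "\<And>n. Dom C (h n) = ob X n" "\<And>n. Cod C (h n) = ob Y (n - 1)"
    "\<And>n. f n = g n \<oplus> (df Y (n - 1) \<bullet> h n \<oplus> h (n + 1) \<bullet> df X n)"
  using assms unfolding hty_def homotopic_def Hom_iff by blast

lemma htyI:
  assumes "cmap X Y f" "cmap X Y g"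
    "\<And>n. h n \<in> Arr C \<and> Dom C (h n) = ob X n \<and> Cod C (h n) = ob Y (n - 1)"
    "\<And>n. f n = g n \<oplus> (df Y (n - 1) \<bullet> h n \<oplus> h (n + 1) \<bullet> df X n)"
  shows "hty X Y f g"
  using assms unfolding hty_def homotopic_def Hom_iff by blast

lemma hty_refl:
  assumes "cmap X Y f"
  shows "hty X Y f f"
proof -
  note [simp] = cmapD[OF assms]
  show ?thesis by (rule htyI[OF assms assms, of "\<lambda>n. Zr (ob X n) (ob Y (n - 1))"]) simp_all
qed

lemma hty_sym:
  assumes "hty X Y f g"
  shows "hty X Y g f"
proof -
  note [simp] = cmapD[OF htyD(1)[OF assms]] cmapD[OF htyD(2)[OF assms]]
  obtain h where [simp]: "\<And>n. h n \<in> Arr C" "\<And>n. Dom C (h n) = ob X n" "\<And>n. Cod C (h n) = ob Y (n - 1)"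
    and h: "\<And>n. f n = g n \<oplus> (df Y (n - 1) \<bullet> h n \<oplus> h (n + 1) \<bullet> df X n)" using htyE[OF assms] by blast
  show ?thesis
  proof (rule htyI[OF htyD(2,1)[OF assms], of "\<lambda>n. Neg C (h n)"])
    fix n
    have "f n \<oplus> (df Y (n - 1) \<bullet> Neg C (h n) \<oplus> Neg C (h (n + 1)) \<bullet> df X n)
      = g n \<oplus> ((df Y (n - 1) \<bullet> h n \<oplus> h (n + 1) \<bullet> df X n) \<oplus> Neg C (df Y (n - 1) \<bullet> h n \<oplus> h (n + 1) \<bullet> df X n))"
      unfolding h by (simp del: add_neg add_neg2)
    also have "\<dots> = g n" by (simp del: neg_add add_assoc)
    finally show "g n = f n \<oplus> (df Y (n - 1) \<bullet> Neg C (h n) \<oplus> Neg C (h (n + 1)) \<bullet> df X n)" by simp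
  qed simp
qed

lemma hty_trans:
  assumes "hty X Y f g" "hty X Y g k"
  shows "hty X Y f k"
proof -
  note [simp] = cmapD[OF htyD(1)[OF assms(1)]] cmapD[OF htyD(2)[OF assms(1)]] cmapD[OF htyD(2)[OF assms(2)]]
  obtain h where [simp]: "\<And>n. h n \<in> Arr C" "\<And>n. Dom C (h n) = ob X n" "\<And>n. Cod C (h n) = ob Y (n - 1)"
    and h: "\<And>n. f n = g n \<oplus> (df Y (n - 1) \<bullet> h n \<oplus> h (n + 1) \<bullet> df X n)" using htyE[OF assms(1)] by blast
  obtain h' where [simp]: "\<And>n. h' n \<in> Arr C" "\<And>n. Dom C (h' n) = ob X n" "\<And>n. Cod C (h' n) = ob Y (n - 1)"
    and h': "\<And>n. g n = k n \<oplus> (df Y (n - 1) \<bullet> h' n \<oplus> h' (n + 1) \<bullet> df X n)" using htyE[OF assms(2)] by blast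
  show ?thesis
    by (rule htyI[OF htyD(1)[OF assms(1)] htyD(2)[OF assms(2)], of "\<lambda>n. h n \<oplus> h' n"]) (simp_all add: h h' add_ac)
qed

lemma hty_comp_left:
  assumes "hty X Y f f'" "cmap Y Z g"
  shows "hty X Z (g \<odot> f) (g \<odot> f')"
proof -
  note [simp] = cmapD[OF htyD(1)[OF assms(1)]] cmapD[OF htyD(2)[OF assms(1)]] cmapD[OF assms(2)]
  obtain h where [simp]: "\<And>n. h n \<in> Arr C" "\<And>n. Dom C (h n) = ob X n" "\<And>n. Cod C (h n) = ob Y (n - 1)"
    and h: "\<And>n. f n = f' n \<oplus> (df Y (n - 1) \<bullet> h n \<oplus> h (n + 1) \<bullet> df X n)" using htyE[OF assms(1)] by blast
  show ?thesis
    by (rule htyI[OF cmap_comp[OF htyD(1)[OF assms(1)] assms(2)] cmap_comp[OF htyD(2)[OF assms(1)] assms(2)],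
          of "\<lambda>n. g (n - 1) \<bullet> h n"]) (simp_all add: ch_comp_def h)
qed

lemma hty_comp_right:
  assumes "hty X Y f f'" "cmap W X p"
  shows "hty W Y (f \<odot> p) (f' \<odot> p)"
proof -
  note [simp] = cmapD[OF htyD(1)[OF assms(1)]] cmapD[OF htyD(2)[OF assms(1)]] cmapD[OF assms(2)]
  obtain h where [simp]: "\<And>n. h n \<in> Arr C" "\<And>n. Dom C (h n) = ob X n" "\<And>n. Cod C (h n) = ob Y (n - 1)"
    and h: "\<And>n. f n = f' n \<oplus> (df Y (n - 1) \<bullet> h n \<oplus> h (n + 1) \<bullet> df X n)" using htyE[OF assms(1)] by blast
  show ?thesis
    by (rule htyI[OF cmap_comp[OF assms(2) htyD(1)[OF assms(1)]] cmap_comp[OF assms(2) htyD(2)[OF assms(1)]],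
          of "\<lambda>n. h n \<bullet> p n"]) (simp_all add: ch_comp_def h)
qed

text \<open>On a cycle the summand of the homotopy formula that starts with the differential
  vanishes, and the other one is visibly a boundary.\<close>

lemma hty_bdry:
  assumes "hty X Y f g" "cyc X n z"
  shows "bdry Y n (f n \<bullet> z \<oplus> Neg C (g n \<bullet> z))"
proof -
  note [simp] = cmapD[OF htyD(1)[OF assms(1)]] cmapD[OF htyD(2)[OF assms(1)]] cycD[OF assms(2)]
  obtain h where [simp]: "\<And>n. h n \<in> Arr C" "\<And>n. Dom C (h n) = ob X n" "\<And>n. Cod C (h n) = ob Y (n - 1)"
    and h: "\<And>n. f n = g n \<oplus> (df Y (n - 1) \<bullet> h n \<oplus> h (n + 1) \<bullet> df X n)" using htyE[OF assms(1)] by blast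
  have "f n \<bullet> z = g n \<bullet> z \<oplus> df Y (n - 1) \<bullet> (h n \<bullet> z)" unfolding h by simp
  also have "\<dots> = df Y (n - 1) \<bullet> (h n \<bullet> z) \<oplus> g n \<bullet> z" by (rule add_comm) simp_all
  finally have "f n \<bullet> z \<oplus> Neg C (g n \<bullet> z) = df Y (n - 1) \<bullet> (h n \<bullet> z)" by simp
  then show ?thesis using bdry_d[of Y "h n \<bullet> z" n] by simp
qed

section \<open>Injectivity and surjectivity on cohomology under homotopy and composition\<close>

lemma cmap_cyc: "cmap X Y f \<Longrightarrow> cyc X n z \<Longrightarrow> cyc Y n (f n \<bullet> z)"
  unfolding cmap_def using cyc_map by blast

lemma cmap_bdry: "cmap X Y f \<Longrightarrow> bdry X n z \<Longrightarrow> bdry Y n (f n \<bullet> z)"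
  unfolding cmap_def using bdry_map by blast

lemma bdry_eq':
  assumes "bounded_complex C X" "bdry X n (y \<oplus> Neg C z)" "bdry X n y" "z \<in> Arr C" "Dom C y = Dom C z" "Cod C y = Cod C z"
  shows "bdry X n z"
proof -
  note y = bdryD[OF assms(3)]
  have "bdry X n (Neg C (y \<oplus> Neg C z))" by (rule bdry_neg[OF assms(1,2)])
  moreover have "Neg C (y \<oplus> Neg C z) = z \<oplus> Neg C y" using y assms(4-6) by (simp add: add_comm)
  ultimately show ?thesis using bdry_eq[OF assms(1) _ assms(3), of z] assms(4-6) by simp
qed

lemma hinj_hty:
  assumes "hty X Y f g" "hinj X Y f n"
  shows "hinj X Y g n"
  unfolding hinj_def
proof (intro allI impI; elim conjE)
  note [simp] = cmapD[OF htyD(1)[OF assms(1)]] cmapD[OF htyD(2)[OF assms(1)]]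
  fix z assume z: "cyc X n z" "bdry Y n (g n \<bullet> z)"
  have "bdry Y n (f n \<bullet> z)"
    using bdry_eq[OF _ hty_bdry[OF assms(1) z(1)] z(2)] cycD[OF z(1)] by simp
  then show "bdry X n z" using assms(2) z(1) unfolding hinj_def by blast
qed

lemma hsurj_hty:
  assumes "hty X Y f g" "hsurj X Y f n"
  shows "hsurj X Y g n"
  unfolding hsurj_def
proof (intro allI impI)
  note [simp] = cmapD[OF htyD(1)[OF assms(1)]] cmapD[OF htyD(2)[OF assms(1)]]
  fix z assume z: "cyc Y n z"
  then obtain e x where e: "epi_arr C e" "Cod C e = Dom C z" "cyc X n x" "Dom C x = Dom C e"
    "bdry Y n (z \<bullet> e \<oplus> Neg C (f n \<bullet> x))" using assms(2) unfolding hsurj_def by blast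
  have "bdry Y n ((z \<bullet> e \<oplus> Neg C (f n \<bullet> x)) \<oplus> (f n \<bullet> x \<oplus> Neg C (g n \<bullet> x)))"
    using bdry_add[OF _ e(5) hty_bdry[OF assms(1) e(3)]] cycD[OF e(3)] cycD[OF z] e(1,2,4) by simp
  moreover have "(z \<bullet> e \<oplus> Neg C (f n \<bullet> x)) \<oplus> (f n \<bullet> x \<oplus> Neg C (g n \<bullet> x)) = z \<bullet> e \<oplus> Neg C (g n \<bullet> x)"
    using cycD[OF e(3)] cycD[OF z] e(1,2,4) by simp
  ultimately have "bdry Y n (z \<bullet> e \<oplus> Neg C (g n \<bullet> x))" by metis
  then show "\<exists>e x. epi_arr C e \<and> Cod C e = Dom C z \<and> cyc X n x \<and> Dom C x = Dom C e \<and>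
      bdry Y n (z \<bullet> e \<oplus> Neg C (g n \<bullet> x))" using e(1-4) by blast
qed

lemma hinj_comp:
  assumes "cmap X Y f" "cmap Y Z g" "hinj X Y f n" "hinj Y Z g n"
  shows "hinj X Z (g \<odot> f) n"
  unfolding hinj_def
proof (intro allI impI; elim conjE)
  note [simp] = cmapD[OF assms(1)] cmapD[OF assms(2)]
  fix z assume z: "cyc X n z" "bdry Z n ((g \<odot> f) n \<bullet> z)"
  then have "bdry Z n (g n \<bullet> (f n \<bullet> z))" using cycD[OF z(1)] by (simp add: ch_comp_def)
  then show "bdry X n z" using assms(3,4) z(1) cmap_cyc[OF assms(1) z(1)] unfolding hinj_def by blast
qed

lemma hinj_of_comp:
  assumes "cmap X Y f" "cmap Y Z g" "hinj X Z (g \<odot> f) n"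
  shows "hinj X Y f n"
  unfolding hinj_def
proof (intro allI impI; elim conjE)
  note [simp] = cmapD[OF assms(1)] cmapD[OF assms(2)]
  fix z assume z: "cyc X n z" "bdry Y n (f n \<bullet> z)"
  have "(g \<odot> f) n \<bullet> z = g n \<bullet> (f n \<bullet> z)" using cycD[OF z(1)] by (simp add: ch_comp_def)
  then show "bdry X n z" using assms(3) z(1) cmap_bdry[OF assms(2) z(2)] unfolding hinj_def by metis
qed

lemma hsurj_comp:
  assumes "cmap X Y f" "cmap Y Z g" "hsurj X Y f n" "hsurj Y Z g n"
  shows "hsurj X Z (g \<odot> f) n"
  unfolding hsurj_def
proof (intro allI impI)
  note [simp] = cmapD[OF assms(1)] cmapD[OF assms(2)]
  fix z assume z: "cyc Z n z"
  obtain e y where e: "epi_arr C e" "Cod C e = Dom C z" "cyc Y n y" "Dom C y = Dom C e"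
    "bdry Z n (z \<bullet> e \<oplus> Neg C (g n \<bullet> y))" using z assms(4) unfolding hsurj_def by blast
  obtain e' x where e': "epi_arr C e'" "Cod C e' = Dom C y" "cyc X n x" "Dom C x = Dom C e'"
    "bdry Y n (y \<bullet> e' \<oplus> Neg C (f n \<bullet> x))" using e(3) assms(3) unfolding hsurj_def by blast
  note [simp] = e(1,2,4) e'(1,2,4) cycD[OF z] cycD[OF e(3)] cycD[OF e'(3)]
  have "bdry Z n ((z \<bullet> e \<oplus> Neg C (g n \<bullet> y)) \<bullet> e' \<oplus> g n \<bullet> (y \<bullet> e' \<oplus> Neg C (f n \<bullet> x)))"
    by (rule bdry_add[OF _ bdry_comp[OF _ e(5)] cmap_bdry[OF assms(2) e'(5)]]) simp_all
  moreover have "(z \<bullet> e \<oplus> Neg C (g n \<bullet> y)) \<bullet> e' \<oplus> g n \<bullet> (y \<bullet> e' \<oplus> Neg C (f n \<bullet> x))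
      = z \<bullet> (e \<bullet> e') \<oplus> Neg C ((g \<odot> f) n \<bullet> x)" by (simp add: ch_comp_def)
  ultimately have "bdry Z n (z \<bullet> (e \<bullet> e') \<oplus> Neg C ((g \<odot> f) n \<bullet> x))" by metis
  then show "\<exists>e x. epi_arr C e \<and> Cod C e = Dom C z \<and> cyc X n x \<and> Dom C x = Dom C e \<and>
      bdry Z n (z \<bullet> e \<oplus> Neg C ((g \<odot> f) n \<bullet> x))"
    using epi_comp[OF e'(1) e(1)] e'(3) by (intro exI[of _ "e \<bullet> e'"] exI[of _ x]) simp
qed

lemma hsurj_of_comp:
  assumes "cmap X Y f" "cmap Y Z g" "hsurj X Z (g \<odot> f) n"
  shows "hsurj Y Z g n"
  unfolding hsurj_def
proof (intro allI impI)
  note [simp] = cmapD[OF assms(1)] cmapD[OF assms(2)]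
  fix z assume z: "cyc Z n z"
  obtain e x where e: "epi_arr C e" "Cod C e = Dom C z" "cyc X n x" "Dom C x = Dom C e"
    "bdry Z n (z \<bullet> e \<oplus> Neg C ((g \<odot> f) n \<bullet> x))" using z assms(3) unfolding hsurj_def by blast
  have "(g \<odot> f) n \<bullet> x = g n \<bullet> (f n \<bullet> x)" "Dom C (f n \<bullet> x) = Dom C e"
    using e(4) cycD[OF e(3)] by (simp_all add: ch_comp_def)
  then show "\<exists>e y. epi_arr C e \<and> Cod C e = Dom C z \<and> cyc Y n y \<and> Dom C y = Dom C e \<and>
      bdry Z n (z \<bullet> e \<oplus> Neg C (g n \<bullet> y))" using e(1,2,5) cmap_cyc[OF assms(1) e(3)] by metis
qed

text \<open>Lift the class of \<open>g n \<bullet> y\<close> to a cycle \<open>x\<close> of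
  \<open>X\<close>. The difference of \<open>y\<close> and the image of \<open>x\<close> is a cycle
  that becomes a boundary in \<open>Z\<close>, hence is a boundary already in
  \<open>Y\<close>.\<close>

lemma hsurj_of_comp2:
  assumes "cmap X Y f" "cmap Y Z g" "hsurj X Z (g \<odot> f) n" "hinj Y Z g n"
  shows "hsurj X Y f n"
  unfolding hsurj_def
proof (intro allI impI)
  note [simp] = cmapD[OF assms(1)] cmapD[OF assms(2)]
  fix y assume y: "cyc Y n y"
  obtain e x where e: "epi_arr C e" "Cod C e = Dom C (g n \<bullet> y)" "cyc X n x" "Dom C x = Dom C e"
    "bdry Z n ((g n \<bullet> y) \<bullet> e \<oplus> Neg C ((g \<odot> f) n \<bullet> x))"
    using cmap_cyc[OF assms(2) y] assms(3) unfolding hsurj_def by blast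
  note [simp] = e(1,4) cycD[OF y] cycD[OF e(3)]
  have ey [simp]: "Cod C e = Dom C y" using e(2) by simp
  have "cyc Y n (y \<bullet> e \<oplus> Neg C (f n \<bullet> x))"
    by (intro cyc_add cyc_neg cyc_comp y cmap_cyc[OF assms(1) e(3)]) simp_all
  moreover have "(g n \<bullet> y) \<bullet> e \<oplus> Neg C ((g \<odot> f) n \<bullet> x) = g n \<bullet> (y \<bullet> e \<oplus> Neg C (f n \<bullet> x))"
    by (simp add: ch_comp_def)
  ultimately have "bdry Y n (y \<bullet> e \<oplus> Neg C (f n \<bullet> x))" using assms(4) e(5) unfolding hinj_def by metis
  then show "\<exists>e x. epi_arr C e \<and> Cod C e = Dom C y \<and> cyc X n x \<and> Dom C x = Dom C e \<and>
      bdry Y n (y \<bullet> e \<oplus> Neg C (f n \<bullet> x))" using e(1,3,4) ey by blast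
qed

lemma qisD: "qis X Y f \<Longrightarrow> cmap X Y f" "qis X Y f \<Longrightarrow> hinj X Y f n" "qis X Y f \<Longrightarrow> hsurj X Y f n"
  by (simp_all add: qis_def)

lemma qis_hty: "hty X Y f g \<Longrightarrow> qis X Y f \<longleftrightarrow> qis X Y g"
  unfolding qis_def using hinj_hty hsurj_hty hty_sym htyD by blast

lemma qis_comp: "qis X Y f \<Longrightarrow> qis Y Z g \<Longrightarrow> qis X Z (g \<odot> f)"
  unfolding qis_def by (blast intro: hinj_comp hsurj_comp cmap_comp)

text \<open>The part of two-out-of-three behind the calculus of roofs: in a homotopy commutative
  square with three quasi-isomorphisms the remaining arrow into the corner is one too.\<close>

lemma qis_of_comp: "cmap X Y f \<Longrightarrow> qis Y Z g \<Longrightarrow> qis X Z (g \<odot> f) \<Longrightarrow> qis X Y f"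
  unfolding qis_def by (blast intro: hinj_of_comp hsurj_of_comp2)

lemma qis_id:
  assumes "bounded_complex C X"
  shows "qis X X (ch_id C X)"
  unfolding qis_def
proof (intro conjI allI cmap_id assms)
  fix n
  have id: "ch_id C X n \<bullet> z = z" if "cyc X n z" for z using cycD[OF that] by (simp add: ch_id_def)
  show "hinj X X (ch_id C X) n" unfolding hinj_def using id by auto
  show "hsurj X X (ch_id C X) n" unfolding hsurj_def
  proof (intro allI impI)
    fix z assume z: "cyc X n z"
    have "bdry X n (z \<bullet> Ident C (Dom C z) \<oplus> Neg C (ch_id C X n \<bullet> z))"
      using id[OF z] cycD[OF z] bdry_zero[OF assms, of "Dom C z" n] by simp
    then show "\<exists>e x. epi_arr C e \<and> Cod C e = Dom C z \<and> cyc X n x \<and> Dom C x = Dom C e \<and>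
      bdry X n (z \<bullet> e \<oplus> Neg C (ch_id C X n \<bullet> x))"
      using z cycD[OF z] by (intro exI[of _ "Ident C (Dom C z)"] exI[of _ z]) simp
  qed
qed

lemma qis_coh:
  assumes "qis X Y f"
  shows "coh X n A \<longleftrightarrow> coh Y n A"
proof -
  note f = qisD[OF assms]
  have X: "bounded_complex C X" and Y: "bounded_complex C Y" and c: "chain_map C X Y f"
    using f(1) unfolding cmap_def by auto
  obtain A' B where A: "coh X n A'" and B: "coh Y n B" using coh_obtain[OF X] coh_obtain[OF Y] by metis
  show ?thesis
    using coh_isomorphic[OF X Y c f(2,3) A] coh_isomorphic[OF X Y c f(2,3) _ B]
      coh_iso[OF X A] coh_iso[OF Y B] isomorphic_sym by blast
qed

lemma coh_unique:
  assumes "bounded_complex C X" "coh X n A" "coh X n B"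
  shows "isomorphic C A B"
  using coh_isomorphic[OF assms(1,1) _ _ _ assms(2,3)] qisD[OF qis_id[OF assms(1)]] unfolding cmap_def by blast

lemma qis_acyc:
  assumes "qis X Y f"
  shows "acyc X n \<longleftrightarrow> acyc Y n"
proof -
  have X: "bounded_complex C X" and Y: "bounded_complex C Y" using qisD(1)[OF assms] unfolding cmap_def by auto
  obtain A where A: "coh X n A" using coh_obtain[OF X] .
  then show ?thesis using qis_coh[OF assms] acyc_coh[OF X A] acyc_coh[OF Y] by blast
qed

subsection \<open>Shifts\<close>

lemma sh_simps [simp]:
  "ob (sh_cplx C k X) n = ob X (n + k)"
  "df (sh_cplx C k X) n = (if even k then df X (n + k) else Neg C (df X (n + k)))"
  by (simp_all add: sh_cplx_def)

lemma sh_bounded [simp]: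
  assumes "bounded_complex C X"
  shows "bounded_complex C (sh_cplx C k X)"
proof -
  have *: "n + 1 + k = n + k + 1" for n by simp
  obtain N where N: "\<And>n. \<bar>n\<bar> > N \<Longrightarrow> is_zero C (ob X n)" using assms unfolding bounded_complex_def by blast
  have "\<forall>n. \<bar>n\<bar> > N + \<bar>k\<bar> \<longrightarrow> is_zero C (ob X (n + k))" by (intro allI impI N) arith
  then have "\<exists>N. \<forall>n. \<bar>n\<bar> > N \<longrightarrow> is_zero C (ob (sh_cplx C k X) n)" by auto
  then show ?thesis unfolding bounded_complex_def Hom_iff
    using assms by (simp add: *) (simp add: algebra_simps)
qed

lemma sh_cyc [simp]:
  assumes "bounded_complex C X"
  shows "cyc (sh_cplx C k X) n z \<longleftrightarrow> cyc X (n + k) z"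
proof -
  have *: "n + 1 + k = n + k + 1" by simp
  show ?thesis unfolding cyc_def using assms by (auto simp: *)
qed

lemma sh_bdry [simp]:
  assumes "bounded_complex C X"
  shows "bdry (sh_cplx C k X) n z \<longleftrightarrow> bdry X (n + k) z"
proof -
  have *: "n - 1 + k = n + k - 1" by simp
  show ?thesis
  proof (cases "even k")
    case True
    then show ?thesis unfolding bdry_def by (simp add: *)
  next
    case False
    have "bdry (sh_cplx C k X) n z" if b: "bdry X (n + k) z"
    proof -
      obtain e w where e: "epi_arr C e" "Cod C e = Dom C z" "w \<in> Arr C" "Dom C w = Dom C e"
        "Cod C w = ob X (n + k - 1)" "df X (n + k - 1) \<bullet> w = z \<bullet> e" using bdryE[OF b] .
      \<comment> \<open>The sign of an odd shift is absorbed by negating the primitive.\<close>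
      show ?thesis by (rule bdryI[of _ _ _ e "Neg C w"]) (use e False bdryD[OF b] assms in \<open>simp_all add: *\<close>)
    qed
    moreover have "bdry X (n + k) z" if b: "bdry (sh_cplx C k X) n z"
    proof -
      obtain e w where e: "epi_arr C e" "Cod C e = Dom C z" "w \<in> Arr C" "Dom C w = Dom C e"
        "Cod C w = ob (sh_cplx C k X) (n - 1)" "df (sh_cplx C k X) (n - 1) \<bullet> w = z \<bullet> e" using bdryE[OF b] .
      show ?thesis by (rule bdryI[of _ _ _ e "Neg C w"]) (use e False bdryD[OF b] assms in \<open>simp_all add: *\<close>)
    qed
    ultimately show ?thesis by blast
  qed
qed

lemma sh_acyc [simp]: "bounded_complex C X \<Longrightarrow> acyc (sh_cplx C k X) n \<longleftrightarrow> acyc X (n + k)"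
  unfolding acyc_def by simp

text \<open>Changing the sign of a differential changes neither its kernel nor the boundaries, and
  by \<open>cohD\<close> and \<open>cohI\<close> these determine cohomology.\<close>

lemma sh_coh:
  assumes "bounded_complex C X"
  shows "coh (sh_cplx C k X) n A \<longleftrightarrow> coh X (n + k) A"
proof -
  have *: "is_kernel C (Neg C d) m" if "is_kernel C d m" for d m
  proof -
    note D = is_kernelD[OF that]
    show ?thesis
    proof (rule is_kernelI)
      fix t assume t: "t \<in> Arr C" "Cod C t = Dom C (Neg C d)" "Neg C d \<bullet> t = Zr (Dom C t) (Cod C (Neg C d))"
      then have "d \<bullet> t = Zr (Dom C t) (Cod C d)" using D by simp
      then show "\<exists>u. u \<in> Arr C \<and> Dom C u = Dom C t \<and> Cod C u = Dom C m \<and> m \<bullet> u = t"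
        using kernel_lift[OF that, of t] t(1,2) D by (metis neg_arr(2))
    qed (use D in simp_all)
  qed
  have "is_kernel C (Neg C d) m \<longleftrightarrow> is_kernel C d m" if "d \<in> Arr C" for d m
    using *[of d m] *[of "Neg C d" m] that by auto
  then have k: "is_kernel C (df (sh_cplx C k X) n) m \<longleftrightarrow> is_kernel C (df X (n + k)) m" for m
    using assms by simp
  have "cohomology_at C (sh_cplx C k X) n m q \<longleftrightarrow> cohomology_at C X (n + k) m q" for m q
    using cohD[of X "n + k" m q] cohD[of "sh_cplx C k X" n m q] cohI[of X "n + k" m q] cohI[of "sh_cplx C k X" n m q]
      assms k by (metis sh_bdry sh_bounded)
  then show ?thesis unfolding coh_def by simp
qed

lemma cmap_sh:
  assumes "cmap X Y f"
  shows "cmap (sh_cplx C k X) (sh_cplx C k Y) (sh_map k f)"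
proof -
  have *: "n + 1 + k = n + k + 1" for n by simp
  note [simp] = cmapD[OF assms]
  show ?thesis by (rule cmapI) (simp_all add: sh_map_def *)
qed

lemma qis_sh:
  assumes "qis X Y f"
  shows "qis (sh_cplx C k X) (sh_cplx C k Y) (sh_map k f)"
proof -
  note [simp] = cmapD[OF qisD(1)[OF assms]]
  have "hinj (sh_cplx C k X) (sh_cplx C k Y) (sh_map k f) n" for n
    using qisD(2)[OF assms, of "n + k"] unfolding hinj_def by (simp add: sh_map_def)
  moreover have "hsurj (sh_cplx C k X) (sh_cplx C k Y) (sh_map k f) n" for n
    using qisD(3)[OF assms, of "n + k"] unfolding hsurj_def by (simp add: sh_map_def)
  ultimately show ?thesis using cmap_sh[OF qisD(1)[OF assms]] unfolding qis_def by blast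
qed

lemma hty_sh:
  assumes "hty X Y f g"
  shows "hty (sh_cplx C k X) (sh_cplx C k Y) (sh_map k f) (sh_map k g)"
proof -
  have *: "n + 1 + k = n + k + 1" "n - 1 + k = n + k - 1" for n by simp_all
  note [simp] = cmapD[OF htyD(1)[OF assms]] cmapD[OF htyD(2)[OF assms]]
  obtain h where [simp]: "\<And>n. h n \<in> Arr C" "\<And>n. Dom C (h n) = ob X n" "\<And>n. Cod C (h n) = ob Y (n - 1)"
    and h: "\<And>n. f n = g n \<oplus> (df Y (n - 1) \<bullet> h n \<oplus> h (n + 1) \<bullet> df X n)" using htyE[OF assms] by blast
  \<comment> \<open>An odd shift negates both differentials, so the homotopy is negated as well and
    its two terms keep their signs.\<close>
  show ?thesis
    by (rule htyI[OF cmap_sh[OF htyD(1)[OF assms]] cmap_sh[OF htyD(2)[OF assms]],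
          of "\<lambda>n. if even k then h (n + k) else Neg C (h (n + k))"])
       (simp_all add: sh_map_def * h)
qed

lemma sh_sh:
  assumes "bounded_complex C X"
  shows "sh_cplx C j (sh_cplx C k X) = sh_cplx C (j + k) X" "sh_cplx C 0 X = X"
  using assms by (auto simp: sh_cplx_def fun_eq_iff algebra_simps)

end

section \<open>Mapping cones\<close>

lemma (in preadditive_category) add_cancel_middle:
  assumes "f \<in> Arr C" "g \<in> Arr C" "Dom C f = Dom C g" "Cod C f = Cod C g"
  shows "f \<oplus> (g \<oplus> Neg C f) = g"
  by (subst add_lcomm) (use assms in simp_all)

locale cone = abelian_category C for C :: "('o, 'm, 'z) precat_scheme" (structure) +
  fixes X Y K :: "('o, 'm) cplx" and f i1 i2 p1 p2 :: "int \<Rightarrow> 'm"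
  assumes cm: "cmap X Y f" and mc: "mapping_cone C X Y f K i1 i2 p1 p2"
begin

lemmas f_simps [simp] = cmapD[OF cm]

lemma K_bounded [simp]: "bounded_complex C K"
  using mc by (simp add: mapping_cone_def)

lemma bip: "is_biproduct C (ob X (n + 1)) (ob Y n) (ob K n) (i1 n) (i2 n) (p1 n) (p2 n)"
  using mc by (simp add: mapping_cone_def)

lemma ip_arr [simp]:
  "i1 n \<in> Arr C" "Dom C (i1 n) = ob X (n + 1)" "Cod C (i1 n) = ob K n"
  "i2 n \<in> Arr C" "Dom C (i2 n) = ob Y n" "Cod C (i2 n) = ob K n"
  "p1 n \<in> Arr C" "Cod C (p1 n) = ob X (n + 1)" "Dom C (p1 n) = ob K n"
  "p2 n \<in> Arr C" "Cod C (p2 n) = ob Y n" "Dom C (p2 n) = ob K n"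
  using bip[of n] unfolding is_biproduct_def Hom_iff by blast+

lemma pi_simps:
  "p1 n \<bullet> i1 n = Ident C (ob X (n + 1))" "p2 n \<bullet> i2 n = Ident C (ob Y n)"
  "p2 n \<bullet> i1 n = Zr (ob X (n + 1)) (ob Y n)" "p1 n \<bullet> i2 n = Zr (ob Y n) (ob X (n + 1))"
  "i1 n \<bullet> p1 n \<oplus> i2 n \<bullet> p2 n = Ident C (ob K n)"
  using bip[of n] unfolding is_biproduct_def Hom_iff by blast+

lemma pi_comp [simp]:
  assumes "a \<in> Arr C"
  shows "Cod C a = ob X (n + 1) \<Longrightarrow> p1 n \<bullet> (i1 n \<bullet> a) = a" "Cod C a = ob Y n \<Longrightarrow> p2 n \<bullet> (i2 n \<bullet> a) = a"
    "Cod C a = ob X (n + 1) \<Longrightarrow> p2 n \<bullet> (i1 n \<bullet> a) = Zr (Dom C a) (ob Y n)"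
    "Cod C a = ob Y n \<Longrightarrow> p1 n \<bullet> (i2 n \<bullet> a) = Zr (Dom C a) (ob X (n + 1))"
  using assms assoc_eq[OF pi_simps(1)[of n], of a] assoc_eq[OF pi_simps(2)[of n], of a]
    assoc_eq[OF pi_simps(3)[of n], of a] assoc_eq[OF pi_simps(4)[of n], of a] by simp_all

text \<open>Equality of arrows into the cone is checked on coordinates. Together with
  \<open>dK_comp\<close> as rewrite rules this keeps computations with the differential in terms of
  pairs.\<close>

lemma K_eqI:
  assumes "a \<in> Arr C" "Cod C a = ob K n" "b \<in> Arr C" "Cod C b = ob K n"
    "p1 n \<bullet> a = p1 n \<bullet> b" "p2 n \<bullet> a = p2 n \<bullet> b"
  shows "a = b"
proof -
  have *: "c = i1 n \<bullet> (p1 n \<bullet> c) \<oplus> i2 n \<bullet> (p2 n \<bullet> c)" if "c \<in> Arr C" "Cod C c = ob K n" for c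
  proof -
    have "c = (i1 n \<bullet> p1 n \<oplus> i2 n \<bullet> p2 n) \<bullet> c" unfolding pi_simps(5) using that by simp
    also have "\<dots> = i1 n \<bullet> (p1 n \<bullet> c) \<oplus> i2 n \<bullet> (p2 n \<bullet> c)" using that by simp
    finally show ?thesis .
  qed
  show ?thesis using *[of a] *[of b] assms by metis
qed

lemma dK: "df K n = i1 (n + 1) \<bullet> (Neg C (df X (n + 1)) \<bullet> p1 n) \<oplus> i2 (n + 1) \<bullet> (f (n + 1) \<bullet> p1 n \<oplus> df Y n \<bullet> p2 n)"
  using mc unfolding mapping_cone_def by blast

lemma dK_comp [simp]:
  assumes "m = n + 1"
  shows "p1 m \<bullet> df K n = Neg C (df X m \<bullet> p1 n)" "p2 m \<bullet> df K n = f m \<bullet> p1 n \<oplus> df Y n \<bullet> p2 n"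
    "a \<in> Arr C \<Longrightarrow> Cod C a = ob K n \<Longrightarrow> p1 m \<bullet> (df K n \<bullet> a) = Neg C (df X m \<bullet> (p1 n \<bullet> a))"
    "a \<in> Arr C \<Longrightarrow> Cod C a = ob K n \<Longrightarrow> p2 m \<bullet> (df K n \<bullet> a) = f m \<bullet> (p1 n \<bullet> a) \<oplus> df Y n \<bullet> (p2 n \<bullet> a)"
  unfolding dK assms by simp_all

lemma dK_i2 [simp]:
  assumes "b \<in> Arr C" "Cod C b = ob Y n" "m = n + 1"
  shows "df K n \<bullet> (i2 n \<bullet> b) = i2 m \<bullet> (df Y n \<bullet> b)"
  unfolding assms(3) by (rule K_eqI[of _ "n + 1"]) (use assms(1,2) in simp_all)

lemma K_cyc:
  "cyc K n z \<longleftrightarrow> z \<in> Arr C \<and> Cod C z = ob K n \<and> cyc X (n + 1) (p1 n \<bullet> z) \<and>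
    f (n + 1) \<bullet> (p1 n \<bullet> z) \<oplus> df Y n \<bullet> (p2 n \<bullet> z) = Zr (Dom C z) (ob Y (n + 1))"
  (is "_ \<longleftrightarrow> ?r")
proof
  assume z: "cyc K n z"
  note [simp] = cycD(1,2)[OF z]
  have "p1 (n + 1) \<bullet> (df K n \<bullet> z) = Zr (Dom C z) (ob X (n + 1 + 1))"
    "p2 (n + 1) \<bullet> (df K n \<bullet> z) = Zr (Dom C z) (ob Y (n + 1))"
    unfolding cycD(3)[OF z] by simp_all
  then show ?r by (simp add: cyc_def)
next
  assume ?r
  then show "cyc K n z" unfolding cyc_def
    by (intro conjI K_eqI[of "df K n \<bullet> z" "n + 1"]) simp_all
qed

lemma K_bdryI:
  assumes "z \<in> Arr C" "Cod C z = ob K n" "epi_arr C e" "Cod C e = Dom C z"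
    "a \<in> Arr C" "Dom C a = Dom C e" "Cod C a = ob X n" "b \<in> Arr C" "Dom C b = Dom C e" "Cod C b = ob Y (n - 1)"
    "Neg C (df X n \<bullet> a) = p1 n \<bullet> (z \<bullet> e)" "f n \<bullet> a \<oplus> df Y (n - 1) \<bullet> b = p2 n \<bullet> (z \<bullet> e)"
  shows "bdry K n z"
proof (rule bdryI[OF assms(1-4)])
  note [simp] = assms(1-10)
  show "df K (n - 1) \<bullet> (i1 (n - 1) \<bullet> a \<oplus> i2 (n - 1) \<bullet> b) = z \<bullet> e"
    by (rule K_eqI[of _ n]) (simp_all add: assms(11,12)[symmetric])
qed (use assms in simp_all)

lemma K_bdryE:
  assumes "bdry K n z"
  obtains e a b where "epi_arr C e" "Cod C e = Dom C z"
    "a \<in> Arr C" "Dom C a = Dom C e" "Cod C a = ob X n" "b \<in> Arr C" "Dom C b = Dom C e" "Cod C b = ob Y (n - 1)"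
    "Neg C (df X n \<bullet> a) = p1 n \<bullet> (z \<bullet> e)" "f n \<bullet> a \<oplus> df Y (n - 1) \<bullet> b = p2 n \<bullet> (z \<bullet> e)"
proof -
  obtain e w where e: "epi_arr C e" "Cod C e = Dom C z" "w \<in> Arr C" "Dom C w = Dom C e"
    "Cod C w = ob K (n - 1)" "df K (n - 1) \<bullet> w = z \<bullet> e" using bdryE[OF assms] .
  show thesis
    by (rule that[of e "p1 (n - 1) \<bullet> w" "p2 (n - 1) \<bullet> w"]) (use e(1-5) in \<open>simp_all add: e(6)[symmetric]\<close>)
qed

text \<open>For a cycle \<open>(x, y)\<close> of the cone with \<open>x = d w\<close>, subtracting
  the boundary of \<open>(- w, 0)\<close> leaves \<open>(0, y + f w)\<close>. So the cycle is a
  boundary of the cone as soon as \<open>y + f w\<close> is, up to a boundary, the image of a cycle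
  of \<open>X\<close>.\<close>

lemma K_bdry:
  assumes z: "cyc K n z" and e: "epi_arr C e" "Cod C e = Dom C z"
    and w: "w \<in> Arr C" "Dom C w = Dom C e" "Cod C w = ob X n" "df X n \<bullet> w = p1 n \<bullet> (z \<bullet> e)"
  shows "cyc Y n (p2 n \<bullet> (z \<bullet> e) \<oplus> f n \<bullet> w)"
    "\<lbrakk>epi_arr C e'; Cod C e' = Dom C e; cyc X n x; Dom C x = Dom C e';
      bdry Y n ((p2 n \<bullet> (z \<bullet> e) \<oplus> f n \<bullet> w) \<bullet> e' \<oplus> Neg C (f n \<bullet> x))\<rbrakk> \<Longrightarrow> bdry K n z"
proof -
  have z': "z \<in> Arr C" "Cod C z = ob K n"
    and zz: "f (n + 1) \<bullet> (p1 n \<bullet> z) \<oplus> df Y n \<bullet> (p2 n \<bullet> z) = Zr (Dom C z) (ob Y (n + 1))"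
    using z unfolding K_cyc by blast+
  note [simp] = z' e w(1-3)
  let ?y = "p2 n \<bullet> (z \<bullet> e) \<oplus> f n \<bullet> w"
  have "df Y n \<bullet> ?y = df Y n \<bullet> (p2 n \<bullet> (z \<bullet> e)) \<oplus> f (n + 1) \<bullet> (df X n \<bullet> w)" by simp
  also have "\<dots> = (f (n + 1) \<bullet> (p1 n \<bullet> z) \<oplus> df Y n \<bullet> (p2 n \<bullet> z)) \<bullet> e"
    unfolding w(4) by (simp add: add_comm)
  also have "\<dots> = Zr (Dom C e) (ob Y (n + 1))" unfolding zz by simp
  finally show y: "cyc Y n ?y" unfolding cyc_def by simp
  assume e': "epi_arr C e'" "Cod C e' = Dom C e" and x: "cyc X n x" "Dom C x = Dom C e'"
    and b: "bdry Y n (?y \<bullet> e' \<oplus> Neg C (f n \<bullet> x))"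
  note [simp] = e' x(2) cycD[OF x(1)]
  obtain e'' c where e'': "epi_arr C e''" "Cod C e'' = Dom C (?y \<bullet> e' \<oplus> Neg C (f n \<bullet> x))" "c \<in> Arr C" "Dom C c = Dom C e''"
    "Cod C c = ob Y (n - 1)" "df Y (n - 1) \<bullet> c = (?y \<bullet> e' \<oplus> Neg C (f n \<bullet> x)) \<bullet> e''" using bdryE[OF b] .
  have [simp]: "Cod C e'' = Dom C e'" using e''(2) by simp
  note [simp] = e''(1,3,4,5)
  \<comment> \<open>The primitive is the pair of the cycle \<open>x\<close> minus \<open>w\<close>
    and the primitive \<open>c\<close> in \<open>Y\<close>, all pulled back to the last
    refinement.\<close>
  show "bdry K n z"
  proof (rule K_bdryI[of z n "e \<bullet> (e' \<bullet> e'')" "Neg C (w \<bullet> (e' \<bullet> e'')) \<oplus> x \<bullet> e''" c])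
    show "epi_arr C (e \<bullet> (e' \<bullet> e''))" by (intro epi_comp) simp_all
    have "df X n \<bullet> (w \<bullet> (e' \<bullet> e'')) = p1 n \<bullet> (z \<bullet> (e \<bullet> (e' \<bullet> e'')))" by (simp add: assoc_eq[OF w(4)])
    then show "Neg C (df X n \<bullet> (Neg C (w \<bullet> (e' \<bullet> e'')) \<oplus> x \<bullet> e'')) = p1 n \<bullet> (z \<bullet> (e \<bullet> (e' \<bullet> e'')))"
      by (simp add: assoc_eq[OF cycD(3)[OF x(1)]])
    show "f n \<bullet> (Neg C (w \<bullet> (e' \<bullet> e'')) \<oplus> x \<bullet> e'') \<oplus> df Y (n - 1) \<bullet> c = p2 n \<bullet> (z \<bullet> (e \<bullet> (e' \<bullet> e'')))"
      unfolding e''(6) by (simp add: add_ac)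
  qed simp_all
qed

text \<open>A cycle \<open>(x, y)\<close> satisfies \<open>f x = - d y\<close>, so injectivity in
  degree \<open>n + 1\<close> provides the primitive of \<open>x\<close>, and surjectivity in degree
  \<open>n\<close> the correction by a cycle that \<open>K_bdry\<close> asks for.\<close>

lemma K_acyc:
  assumes "hinj X Y f (n + 1)" "hsurj X Y f n"
  shows "acyc K n"
  unfolding acyc_def
proof (intro allI impI)
  fix z assume z: "cyc K n z"
  have z': "z \<in> Arr C" "Cod C z = ob K n" "cyc X (n + 1) (p1 n \<bullet> z)"
    and zz: "f (n + 1) \<bullet> (p1 n \<bullet> z) \<oplus> df Y n \<bullet> (p2 n \<bullet> z) = Zr (Dom C z) (ob Y (n + 1))"
    using z unfolding K_cyc by blast+
  note [simp] = z'(1,2)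
  have "f (n + 1) \<bullet> (p1 n \<bullet> z) = Neg C (df Y n \<bullet> (p2 n \<bullet> z))"
    using zz eq_neg_iff(2)[of "f (n + 1) \<bullet> (p1 n \<bullet> z)" "df Y n \<bullet> (p2 n \<bullet> z)"] by simp
  also have "\<dots> = df Y (n + 1 - 1) \<bullet> Neg C (p2 n \<bullet> z)" by simp
  finally have "bdry Y (n + 1) (f (n + 1) \<bullet> (p1 n \<bullet> z))"
    using bdry_d[of Y "Neg C (p2 n \<bullet> z)" "n + 1"] by simp
  then have "bdry X (n + 1) (p1 n \<bullet> z)" using assms(1) z'(3) unfolding hinj_def by blast
  then obtain e w where e: "epi_arr C e" "Cod C e = Dom C (p1 n \<bullet> z)" "w \<in> Arr C" "Dom C w = Dom C e"
    "Cod C w = ob X (n + 1 - 1)" "df X (n + 1 - 1) \<bullet> w = (p1 n \<bullet> z) \<bullet> e" by (rule bdryE)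
  have e2: "Cod C e = Dom C z" "Cod C w = ob X n" "df X n \<bullet> w = p1 n \<bullet> (z \<bullet> e)" using e by simp_all
  let ?y = "p2 n \<bullet> (z \<bullet> e) \<oplus> f n \<bullet> w"
  have y: "cyc Y n ?y" "Dom C ?y = Dom C e" using K_bdry(1)[OF z e(1) e2(1) e(3,4) e2(2,3)] e e2 by simp_all
  obtain e' x where e': "epi_arr C e'" "Cod C e' = Dom C ?y" "cyc X n x" "Dom C x = Dom C e'"
    "bdry Y n (?y \<bullet> e' \<oplus> Neg C (f n \<bullet> x))" using assms(2) y(1) unfolding hsurj_def by blast
  show "bdry K n z" using K_bdry(2)[OF z e(1) e2(1) e(3,4) e2(2,3) e'(1) _ e'(3,4,5)] e'(2) y(2) by simp
qed

lemma i2_cmap: "cmap Y K i2"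
proof (rule cmapI)
  show "df K n \<bullet> i2 n = i2 (n + 1) \<bullet> df Y n" for n
    using dK_i2[of "Ident C (ob Y n)" n "n + 1"] by simp
qed simp_all

section \<open>The homotopy fibre of \<open>f\<close>, realised as the cone shifted by -1\<close>

definition "Fib = sh_cplx C (- 1) K"
definition "fibp n = p1 (n - 1)"

lemma Fib_simps [simp]: "ob Fib n = ob K (n - 1)" "df Fib n = Neg C (df K (n - 1))"
  by (simp_all add: Fib_def)

lemma Fib_bounded [simp]: "bounded_complex C Fib"
  by (simp add: Fib_def)

lemma fibp_cmap: "cmap Fib X fibp"
  by (rule cmapI) (simp_all add: fibp_def)

text \<open>The negated second coordinate is a null homotopy: in the differential of the fibre the
  term containing \<open>f\<close> survives, and the two terms with the differential of
  \<open>Y\<close> cancel.\<close>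

lemma fibp_null: "hty Fib Y (f \<odot> fibp) (ch_zero C Fib Y)"
proof (rule htyI[of _ _ _ _ "\<lambda>n. Neg C (p2 (n - 1))"])
  show "cmap Fib Y (f \<odot> fibp)" by (rule cmap_comp[OF fibp_cmap cm])
  show "cmap Fib Y (ch_zero C Fib Y)" by (rule cmap_zero) simp_all
  fix n
  show "(f \<odot> fibp) n = ch_zero C Fib Y n \<oplus> (df Y (n - 1) \<bullet> Neg C (p2 (n - 1)) \<oplus> Neg C (p2 (n + 1 - 1)) \<bullet> df Fib n)"
    by (simp add: ch_comp_def ch_zero_def fibp_def add_lcomm[of "Neg C _" "f _ \<bullet> _"])
qed simp

lemma fibp_qis:
  assumes "\<And>n. acyc Y n"
  shows "qis Fib X fibp"
  unfolding qis_def
proof (intro conjI allI fibp_cmap)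
  fix n
  show "hinj Fib X fibp n" unfolding hinj_def
  proof (intro allI impI; elim conjE)
    fix z assume "cyc Fib n z" "bdry X n (fibp n \<bullet> z)"
    then have z: "cyc K (n - 1) z" and b: "bdry X n (p1 (n - 1) \<bullet> z)" by (simp_all add: Fib_def fibp_def)
    note [simp] = cycD(1,2)[OF z]
    obtain e w where e: "epi_arr C e" "Cod C e = Dom C (p1 (n - 1) \<bullet> z)" "w \<in> Arr C" "Dom C w = Dom C e"
      "Cod C w = ob X (n - 1)" "df X (n - 1) \<bullet> w = (p1 (n - 1) \<bullet> z) \<bullet> e" using bdryE[OF b] .
    have e2: "Cod C e = Dom C z" "df X (n - 1) \<bullet> w = p1 (n - 1) \<bullet> (z \<bullet> e)" using e by simp_all
    let ?y = "p2 (n - 1) \<bullet> (z \<bullet> e) \<oplus> f (n - 1) \<bullet> w"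
    have "cyc Y (n - 1) ?y" by (rule K_bdry(1)[OF z e(1) e2(1) e(3-5) e2(2)])
    then have y: "bdry Y (n - 1) ?y" using assms unfolding acyc_def by blast
    have D: "Dom C ?y = Dom C e" "?y \<in> Arr C" "Cod C ?y = ob Y (n - 1)" using e(1,3-5) e2(1) by simp_all
    \<comment> \<open>Since \<open>Y\<close> is acyclic, \<open>?y\<close> is already a boundary;
      \<open>K_bdry\<close> is applied with the trivial cover and the zero correction.\<close>
    let ?i = "Ident C (Dom C e)" and ?x = "Zr (Dom C e) (ob X (n - 1))"
    have "bdry K (n - 1) z"
    proof (rule K_bdry(2)[OF z e(1) e2(1) e(3-5) e2(2), of ?i ?x])
      have "?y \<bullet> ?i \<oplus> Neg C (f (n - 1) \<bullet> ?x) = ?y" using D e(1) by (simp del: distrib_left)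
      then show "bdry Y (n - 1) (?y \<bullet> ?i \<oplus> Neg C (f (n - 1) \<bullet> ?x))" using y by metis
    qed (use e(1) in \<open>simp_all add: cyc_def\<close>)
    then show "bdry Fib n z" by (simp add: Fib_def)
  qed
  show "hsurj Fib X fibp n" unfolding hsurj_def
  proof (intro allI impI)
    fix v assume v: "cyc X n v"
    have "bdry Y n (f n \<bullet> v)" using cmap_cyc[OF cm v] assms unfolding acyc_def by blast
    note [simp] = cycD[OF v]
    obtain e c where e: "epi_arr C e" "Cod C e = Dom C (f n \<bullet> v)" "c \<in> Arr C" "Dom C c = Dom C e"
      "Cod C c = ob Y (n - 1)" "df Y (n - 1) \<bullet> c = (f n \<bullet> v) \<bullet> e" using bdryE[OF \<open>bdry Y n (f n \<bullet> v)\<close>] .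
    note [simp] = e(1,3-5)
    have [simp]: "Cod C e = Dom C v" using e(2) by simp
    \<comment> \<open>A primitive of the image of \<open>v\<close>, taken with a minus sign,
      completes \<open>v\<close> to a cycle of the cone.\<close>
    let ?z = "i1 (n - 1) \<bullet> (v \<bullet> e) \<oplus> Neg C (i2 (n - 1) \<bullet> c)"
    have "cyc K (n - 1) ?z" unfolding K_cyc
      by (simp add: cyc_comp[OF _ v] e(6))
    moreover have "v \<bullet> e \<oplus> Neg C (p1 (n - 1) \<bullet> ?z) = Zr (Dom C e) (ob X n)" by simp
    ultimately show "\<exists>e x. epi_arr C e \<and> Cod C e = Dom C v \<and> cyc Fib n x \<and> Dom C x = Dom C e \<and>
        bdry X n (v \<bullet> e \<oplus> Neg C (fibp n \<bullet> x))"
      using bdry_zero[of X "Dom C e" n]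
      by (intro exI[of _ e] exI[of _ ?z]) (simp add: Fib_def fibp_def)
  qed
qed

text \<open>A null homotopy into the cone has two coordinates. The one in \<open>X\<close> is a
  chain map \<open>g\<close>, the one in \<open>Y\<close> is a homotopy from \<phi> to
  \<open>f \<odot> g\<close>.\<close>

lemma cone_factor:
  assumes \<phi>: "cmap W Y \<phi>" and h: "hty W K (i2 \<odot> \<phi>) (ch_zero C W K)"
  obtains g where "cmap W X g" "hty W Y \<phi> (f \<odot> g)"
proof -
  note [simp] = cmapD[OF \<phi>]
  obtain h where [simp]: "\<And>n. h n \<in> Arr C" "\<And>n. Dom C (h n) = ob W n" "\<And>n. Cod C (h n) = ob K (n - 1)"
    and h: "\<And>n. (i2 \<odot> \<phi>) n = ch_zero C W K n \<oplus> (df K (n - 1) \<bullet> h n \<oplus> h (n + 1) \<bullet> df W n)" using htyE[OF h] by blast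
  have hh: "i2 n \<bullet> \<phi> n = df K (n - 1) \<bullet> h n \<oplus> h (n + 1) \<bullet> df W n" for n
    using h[of n] by (simp add: ch_comp_def ch_zero_def)
  define g where "g n = p1 (n - 1) \<bullet> h n" for n
  have [simp]: "g n \<in> Arr C" "Dom C (g n) = ob W n" "Cod C (g n) = ob X n" for n by (simp_all add: g_def)
  have "cmap W X g"
  proof (rule cmapI)
    fix n
    have "Zr (ob W n) (ob X (n + 1)) = p1 n \<bullet> (i2 n \<bullet> \<phi> n)" by simp
    also have "\<dots> = Neg C (df X n \<bullet> g n) \<oplus> g (n + 1) \<bullet> df W n" unfolding hh by (simp add: g_def)
    finally have "Neg C (df X n \<bullet> g n) \<oplus> g (n + 1) \<bullet> df W n = Zr (ob W n) (ob X (n + 1))" by (rule sym)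
    then show "df X n \<bullet> g n = g (n + 1) \<bullet> df W n"
      using neg_unique[of "Neg C (df X n \<bullet> g n)" "g (n + 1) \<bullet> df W n"] by simp
  qed simp_all
  moreover have "hty W Y \<phi> (f \<odot> g)"
  proof (rule htyI[OF \<phi> cmap_comp[OF \<open>cmap W X g\<close> cm], of "\<lambda>n. p2 (n - 1) \<bullet> h n"])
    fix n
    have "\<phi> n = p2 n \<bullet> (i2 n \<bullet> \<phi> n)" by simp
    also have "\<dots> = (f \<odot> g) n \<oplus> (df Y (n - 1) \<bullet> (p2 (n - 1) \<bullet> h n) \<oplus> (p2 (n + 1 - 1) \<bullet> h (n + 1)) \<bullet> df W n)"
      unfolding hh by (simp add: g_def ch_comp_def)
    finally show "\<phi> n = (f \<odot> g) n \<oplus> (df Y (n - 1) \<bullet> (p2 (n - 1) \<bullet> h n) \<oplus> (p2 (n + 1 - 1) \<bullet> h (n + 1)) \<bullet> df W n)" .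
  qed simp
  ultimately show thesis by (rule that)
qed

text \<open>Dual to \<open>cone_factor\<close>: the difference of the two maps, paired with minus
  the given homotopy, is a chain map into the fibre.\<close>

lemma Fib_lift:
  assumes x: "cmap W X x" and y: "cmap W X y" and h: "hty W Y (f \<odot> x) (f \<odot> y)"
  obtains \<psi> where "cmap W Fib \<psi>" "fibp \<odot> \<psi> = (\<lambda>n. x n \<oplus> Neg C (y n))"
proof -
  note [simp] = cmapD[OF x] cmapD[OF y]
  obtain h where [simp]: "\<And>n. h n \<in> Arr C" "\<And>n. Dom C (h n) = ob W n" "\<And>n. Cod C (h n) = ob Y (n - 1)"
    and h: "\<And>n. (f \<odot> x) n = (f \<odot> y) n \<oplus> (df Y (n - 1) \<bullet> h n \<oplus> h (n + 1) \<bullet> df W n)" using htyE[OF h] by blast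
  have hh: "f n \<bullet> x n = f n \<bullet> y n \<oplus> (df Y (n - 1) \<bullet> h n \<oplus> h (n + 1) \<bullet> df W n)" for n
    using h[of n] by (simp add: ch_comp_def)
  define \<psi> where "\<psi> n = i1 (n - 1) \<bullet> (x n \<oplus> Neg C (y n)) \<oplus> Neg C (i2 (n - 1) \<bullet> h n)" for n
  have "cmap W Fib \<psi>"
  proof (rule cmapI)
    fix n
    show "df Fib n \<bullet> \<psi> n = \<psi> (n + 1) \<bullet> df W n"
      by (rule K_eqI[of _ n]) (simp_all add: \<psi>_def hh add_ac add_cancel_middle)
  qed (simp_all add: \<psi>_def)
  moreover have "fibp \<odot> \<psi> = (\<lambda>n. x n \<oplus> Neg C (y n))"
    by (simp add: fun_eq_iff ch_comp_def fibp_def \<psi>_def)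
  ultimately show thesis by (rule that)
qed

end

context abelian_category
begin

lemma is_zero_biproduct:
  assumes "is_biproduct C A B S i1 i2 p1 p2" "is_zero C A" "is_zero C B"
  shows "is_zero C S"
proof -
  have [simp]: "i1 \<in> Arr C" "i2 \<in> Arr C" "p1 \<in> Arr C" "p2 \<in> Arr C" "Cod C p1 = A" "Cod C p2 = B"
    "Dom C p1 = S" "Dom C p2 = S" "Cod C i1 = S" "Cod C i2 = S" "Dom C i1 = A" "Dom C i2 = B"
    using assms unfolding is_biproduct_def Hom_iff by blast+
  have A: "A \<in> Obj C" "B \<in> Obj C" "S \<in> Obj C" using dom_obj[of i1] dom_obj[of i2] cod_obj[of i1] by simp_all
  have "Ident C S = i1 \<bullet> p1 \<oplus> i2 \<bullet> p2" using assms(1) unfolding is_biproduct_def by simp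
  also have "\<dots> = i1 \<bullet> Zr S A \<oplus> i2 \<bullet> Zr S B"
    using zero_obj_arr(2)[OF assms(2), of p1] zero_obj_arr(2)[OF assms(3), of p2] by simp
  also have "\<dots> = Zr S S" using A by simp
  finally show ?thesis using A by (simp add: is_zero_iff)
qed

lemma cone_exists:
  assumes "cmap X Y f"
  obtains K i1 i2 p1 p2 where "cone C X Y K f i1 i2 p1 p2"
proof -
  note [simp] = cmapD[OF assms]
  have "\<exists>S i1 i2 p1 p2. is_biproduct C (ob X (n + 1)) (ob Y n) S i1 i2 p1 p2" for n
    by (rule biproduct_exists) simp_all
  then obtain S i1 i2 p1 p2 where b: "\<And>n. is_biproduct C (ob X (n + 1)) (ob Y n) (S n) (i1 n) (i2 n) (p1 n) (p2 n)"
    by metis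
  then have [simp]:
    "i1 n \<in> Arr C" "Dom C (i1 n) = ob X (n + 1)" "Cod C (i1 n) = S n"
    "i2 n \<in> Arr C" "Dom C (i2 n) = ob Y n" "Cod C (i2 n) = S n"
    "p1 n \<in> Arr C" "Cod C (p1 n) = ob X (n + 1)" "Dom C (p1 n) = S n"
    "p2 n \<in> Arr C" "Cod C (p2 n) = ob Y n" "Dom C (p2 n) = S n" for n
    unfolding is_biproduct_def Hom_iff by blast+
  have S [simp]: "S n \<in> Obj C" for n using cod_obj[of "i1 n"] by simp
  have pi: "p1 n \<bullet> i1 n = Ident C (ob X (n + 1))" "p2 n \<bullet> i2 n = Ident C (ob Y n)"
    "p2 n \<bullet> i1 n = Zr (ob X (n + 1)) (ob Y n)" "p1 n \<bullet> i2 n = Zr (ob Y n) (ob X (n + 1))" for n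
    using b[of n] unfolding is_biproduct_def Hom_iff by blast+
  note pi_comp = assoc_eq[OF pi(1)] assoc_eq[OF pi(2)] assoc_eq[OF pi(3)] assoc_eq[OF pi(4)]
  define d where "d n = i1 (n + 1) \<bullet> (Neg C (df X (n + 1)) \<bullet> p1 n) \<oplus> i2 (n + 1) \<bullet> (f (n + 1) \<bullet> p1 n \<oplus> df Y n \<bullet> p2 n)" for n
  have [simp]: "d n \<in> Arr C" "Dom C (d n) = S n" "Cod C (d n) = S (n + 1)" for n by (simp_all add: d_def)
  define K where "K = \<lparr>ob = S, df = d\<rparr>"
  have "d (n + 1) \<bullet> d n = Zr (S n) (S (n + 1 + 1))" for n
  proof -
    have [simp]: "p1 (n + 1) \<bullet> d n = Neg C (df X (n + 1) \<bullet> p1 n)" "p2 (n + 1) \<bullet> d n = f (n + 1) \<bullet> p1 n \<oplus> df Y n \<bullet> p2 n"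
      unfolding d_def by (simp_all add: pi_comp)
    show ?thesis by (subst d_def) simp
  qed
  moreover have "\<exists>N. \<forall>n. \<bar>n\<bar> > N \<longrightarrow> is_zero C (S n)"
  proof -
    obtain N where N: "\<And>n. \<bar>n\<bar> > N \<Longrightarrow> is_zero C (ob X n)" using cmapD(1)[OF assms] unfolding bounded_complex_def by blast
    obtain M where M: "\<And>n. \<bar>n\<bar> > M \<Longrightarrow> is_zero C (ob Y n)" using cmapD(2)[OF assms] unfolding bounded_complex_def by blast
    \<comment> \<open>The cone involves \<open>X\<close> in degree \<open>n + 1\<close>, which
      accounts for the extra 1 in the bound.\<close>
    have "is_zero C (S n)" if "\<bar>n\<bar> > \<bar>N\<bar> + \<bar>M\<bar> + 1" for n
      by (rule is_zero_biproduct[OF b]) (rule N M, use that in arith)+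
    then show ?thesis by blast
  qed
  ultimately have "bounded_complex C K" unfolding bounded_complex_def Hom_iff by (simp add: K_def)
  then have "mapping_cone C X Y f K i1 i2 p1 p2" unfolding mapping_cone_def using b by (simp add: K_def d_def)
  then have "cone C X Y K f i1 i2 p1 p2" using assms by unfold_locales
  then show thesis by (rule that)
qed

text \<open>\<open>W\<close> is the homotopy fibre of \<phi>: its projection to \<open>V\<close> is
  a quasi-isomorphism because \<open>E\<close> is acyclic, and the composite to \<open>E\<close> is
  null by construction.\<close>

lemma kill_acyclic:
  assumes "cmap V E \<phi>" "\<And>n. acyc E n"
  obtains W t where "qis W V t" "hty W E (\<phi> \<odot> t) (ch_zero C W E)"
proof -
  obtain K i1 i2 p1 p2 where "cone C V E K \<phi> i1 i2 p1 p2" using cone_exists[OF assms(1)] .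
  then interpret cone C V E K \<phi> i1 i2 p1 p2 .
  show thesis using that fibp_qis[OF assms(2)] fibp_null by blast
qed

text \<open>The cone of \<open>u\<close> is acyclic, so the map from \<open>V\<close> into it can be
  killed by a quasi-isomorphism \<open>t\<close>; the null homotopy then factors
  \<open>f \<odot> t\<close> through \<open>u\<close>.\<close>

lemma ore:
  assumes f: "cmap V Y f" and u: "qis V' Y u"
  obtains W t h where "qis W V t" "cmap W V' h" "hty W Y (f \<odot> t) (u \<odot> h)"
proof -
  obtain K i1 i2 p1 p2 where "cone C V' Y K u i1 i2 p1 p2" using cone_exists[OF qisD(1)[OF u]] .
  then interpret cone C V' Y K u i1 i2 p1 p2 .
  have "acyc K n" for n using K_acyc qisD(2,3)[OF u] by blast
  then obtain W t where t: "qis W V t" "hty W K ((i2 \<odot> f) \<odot> t) (ch_zero C W K)"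
    using kill_acyclic[OF cmap_comp[OF f i2_cmap]] by blast
  have ft: "cmap W Y (f \<odot> t)" using cmap_comp[OF qisD(1)[OF t(1)] f] .
  have "hty W K (i2 \<odot> f \<odot> t) (ch_zero C W K)"
    using t(2) chcomp_assoc[OF qisD(1)[OF t(1)] f i2_cmap] by simp
  then obtain h where "cmap W V' h" "hty W Y (f \<odot> t) (u \<odot> h)" using cone_factor[OF ft] by blast
  then show thesis using that t(1) by blast
qed

text \<open>The difference of \<open>x\<close> and \<open>y\<close> lifts to the fibre of
  \<open>u\<close>, which is acyclic. Killing this lift kills the difference, up to
  homotopy.\<close>

lemma qis_cancel:
  assumes u: "qis X Y u" and x: "cmap W X x" and y: "cmap W X y" and h: "hty W Y (u \<odot> x) (u \<odot> y)"
  obtains U c where "qis U W c" "hty U X (x \<odot> c) (y \<odot> c)"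
proof -
  obtain K i1 i2 p1 p2 where "cone C X Y K u i1 i2 p1 p2" using cone_exists[OF qisD(1)[OF u]] .
  then interpret cone C X Y K u i1 i2 p1 p2 .
  have "acyc K n" for n using K_acyc qisD(2,3)[OF u] by blast
  then have F: "acyc Fib n" for n by (simp add: Fib_def)
  obtain \<psi> where \<psi>: "cmap W Fib \<psi>" "fibp \<odot> \<psi> = (\<lambda>n. x n \<oplus> Neg C (y n))" using Fib_lift[OF x y h] .
  obtain U c where c: "qis U W c" "hty U Fib (\<psi> \<odot> c) (ch_zero C U Fib)" using kill_acyclic[OF \<psi>(1) F] .
  note c' = qisD(1)[OF c(1)]
  note [simp] = cmapD[OF x] cmapD[OF y] cmapD[OF c']
  have "hty U X (fibp \<odot> (\<psi> \<odot> c)) (fibp \<odot> ch_zero C U Fib)" by (rule hty_comp_left[OF c(2) fibp_cmap])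
  then have "hty U X ((fibp \<odot> \<psi>) \<odot> c) (ch_zero C U X)"
    using chcomp_assoc[OF c' \<psi>(1) fibp_cmap] chcomp_zero(1)[OF fibp_cmap, of U] by simp
  then obtain s where [simp]: "\<And>n. s n \<in> Arr C" "\<And>n. Dom C (s n) = ob U n" "\<And>n. Cod C (s n) = ob X (n - 1)"
    and s: "\<And>n. ((fibp \<odot> \<psi>) \<odot> c) n = ch_zero C U X n \<oplus> (df X (n - 1) \<bullet> s n \<oplus> s (n + 1) \<bullet> df U n)" using htyE by blast
  have "hty U X (x \<odot> c) (y \<odot> c)"
  proof (rule htyI[OF cmap_comp[OF c' x] cmap_comp[OF c' y], of s])
    fix n
    have "x n \<bullet> c n \<oplus> Neg C (y n \<bullet> c n) = df X (n - 1) \<bullet> s n \<oplus> s (n + 1) \<bullet> df U n"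
      using s[of n] unfolding \<psi>(2) by (simp add: ch_comp_def ch_zero_def)
    then have "y n \<bullet> c n \<oplus> (df X (n - 1) \<bullet> s n \<oplus> s (n + 1) \<bullet> df U n) = y n \<bullet> c n \<oplus> (x n \<bullet> c n \<oplus> Neg C (y n \<bullet> c n))" by simp
    also have "\<dots> = x n \<bullet> c n" by (simp add: add_cancel_middle)
    finally show "(x \<odot> c) n = (y \<odot> c) n \<oplus> (df X (n - 1) \<bullet> s n \<oplus> s (n + 1) \<bullet> df U n)" by (simp add: ch_comp_def)
  qed simp
  then show thesis using that c(1) by blast
qed

end

section \<open>The derived category\<close>

lemma Db_cat_simps [simp]:
  "Obj (Db_cat C) = {X. bounded_complex C X}" "Dom (Db_cat C) = fst" "Cod (Db_cat C) = fst \<circ> snd"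
  "Arr (Db_cat C) = {(X, Y, P). bounded_complex C X \<and> bounded_complex C Y \<and> P \<in> roofs C X Y // roof_rel C X Y}"
  "Ident (Db_cat C) X = loc C X X (ch_id C X)" "Comp (Db_cat C) = darr_comp C"
  "ZeroArr (Db_cat C) X Y = loc C X Y (ch_zero C X Y)"
  by (simp_all add: Db_cat_def)

lemma Db_simps [simp]:
  "Obj (Db C) = Obj (Db_cat C)" "Dom (Db C) = Dom (Db_cat C)" "Cod (Db C) = Cod (Db_cat C)"
  "Arr (Db C) = Arr (Db_cat C)" "Ident (Db C) = Ident (Db_cat C)" "Comp (Db C) = Comp (Db_cat C)"
  "ZeroArr (Db C) = ZeroArr (Db_cat C)" "Shift (Db C) = sh_cplx C" "Dist (Db C) = Db_dist C"
  by (simp_all add: Db_def precat.defs tri_cat.defs)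

lemma Db_defs [simp]:
  "Hom (Db C) X Y = Hom (Db_cat C) X Y" "iso_arr (Db C) a \<longleftrightarrow> iso_arr (Db_cat C) a"
  "isomorphic (Db C) X Y \<longleftrightarrow> isomorphic (Db_cat C) X Y" "is_zero (Db C) X \<longleftrightarrow> is_zero (Db_cat C) X"
  unfolding Hom_def iso_arr_def isomorphic_def is_zero_def Db_simps by simp_all

context abelian_category
begin

section \<open>Roofs and the equivalence relation between them\<close>

lemma hty_pre:
  assumes "hty W X (s \<odot> p) (s' \<odot> p')" "cmap W Z p" "cmap Z X s" "cmap W Z' p'" "cmap Z' X s'" "cmap U W t"
  shows "hty U X (s \<odot> p \<odot> t) (s' \<odot> p' \<odot> t)"
  using hty_comp_right[OF assms(1,6)] chcomp_assoc[OF assms(6,2,3)] chcomp_assoc[OF assms(6,4,5)] by simp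

definition roof :: "('a, 'b) cplx \<Rightarrow> ('a, 'b) cplx \<Rightarrow> ('a, 'b) cplx \<Rightarrow> (int \<Rightarrow> 'b) \<Rightarrow> (int \<Rightarrow> 'b) \<Rightarrow> bool" where
  "roof X Y Z s f \<longleftrightarrow> qis Z X s \<and> cmap Z Y f"

definition darr_of :: "('a, 'b) cplx \<Rightarrow> ('a, 'b) cplx \<Rightarrow> ('a, 'b) cplx \<Rightarrow> (int \<Rightarrow> 'b) \<Rightarrow> (int \<Rightarrow> 'b) \<Rightarrow> ('a, 'b) darr" where
  "darr_of X Y Z s f = (X, Y, roof_rel C X Y `` {(Z, s, f)})"

lemma roofD: "roof X Y Z s f \<Longrightarrow> qis Z X s" "roof X Y Z s f \<Longrightarrow> cmap Z Y f" "roof X Y Z s f \<Longrightarrow> cmap Z X s"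
  unfolding roof_def using qisD(1) by blast+

lemma roofs_iff:
  assumes "bounded_complex C X" "bounded_complex C Y"
  shows "(Z, s, f) \<in> roofs C X Y \<longleftrightarrow> roof X Y Z s f"
  using assms unfolding roofs_def roof_def qis_iff cmap_def by auto

text \<open>The definition requires only one composite into \<open>X\<close> to be a
  quasi-isomorphism. Two-out-of-three upgrades both \<open>p\<close> and \<open>p'\<close>, which
  gives a form symmetric in the two roofs.\<close>

lemma roof_rel_iff:
  assumes X: "bounded_complex C X" and Y: "bounded_complex C Y"
  shows "((Z, s, f), (Z', s', f')) \<in> roof_rel C X Y \<longleftrightarrow> roof X Y Z s f \<and> roof X Y Z' s' f' \<and>
    (\<exists>W p p'. qis W Z p \<and> qis W Z' p' \<and> hty W X (s \<odot> p) (s' \<odot> p') \<and> hty W Y (f \<odot> p) (f' \<odot> p'))"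
proof -
  have "(\<exists>W p p'. bounded_complex C W \<and> chain_map C W Z p \<and> chain_map C W Z' p' \<and>
      quasi_iso C W X (ch_comp C s p) \<and> homotopic C W X (ch_comp C s p) (ch_comp C s' p') \<and>
      homotopic C W Y (ch_comp C f p) (ch_comp C f' p')) \<longleftrightarrow>
    (\<exists>W p p'. qis W Z p \<and> qis W Z' p' \<and> hty W X (s \<odot> p) (s' \<odot> p') \<and> hty W Y (f \<odot> p) (f' \<odot> p'))"
    if r: "roof X Y Z s f" "roof X Y Z' s' f'"
  proof -
    note r = roofD[OF r(1)] roofD[OF r(2)]
    have Z: "bounded_complex C Z" "bounded_complex C Z'" using r(2,5) unfolding cmap_def by auto
    have "bounded_complex C W \<and> chain_map C W Z p \<and> chain_map C W Z' p' \<and>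
      quasi_iso C W X (ch_comp C s p) \<and> homotopic C W X (ch_comp C s p) (ch_comp C s' p') \<and>
      homotopic C W Y (ch_comp C f p) (ch_comp C f' p') \<longleftrightarrow>
      qis W Z p \<and> qis W Z' p' \<and> hty W X (s \<odot> p) (s' \<odot> p') \<and> hty W Y (f \<odot> p) (f' \<odot> p')" (is "?l \<longleftrightarrow> ?r") for W p p'
    proof
      assume l: ?l
      then have p: "cmap W Z p" "cmap W Z' p'" and sp: "qis W X (s \<odot> p)"
        using Z X unfolding cmap_def qis_iff by auto
      have h: "hty W X (s \<odot> p) (s' \<odot> p')" "hty W Y (f \<odot> p) (f' \<odot> p')"
        unfolding hty_def using l cmap_comp p r by blast+
      have "qis W Z p" by (rule qis_of_comp[OF p(1) r(1) sp])
      moreover have "qis W Z' p'" using qis_of_comp[OF p(2) r(4)] sp qis_hty[OF h(1)] by blast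
      ultimately show ?r using h by blast
    next
      assume ?r
      then show ?l using qis_comp[OF _ r(1)] unfolding qis_iff hty_def cmap_def quasi_iso_def by blast
    qed
    then show ?thesis by blast
  qed
  then show ?thesis unfolding roof_rel_def using roofs_iff[OF X Y] by auto
qed

lemma equiv_roof_rel:
  assumes X: "bounded_complex C X" and Y: "bounded_complex C Y"
  shows "equiv (roofs C X Y) (roof_rel C X Y)"
proof (rule equivI)
  show "roof_rel C X Y \<subseteq> roofs C X Y \<times> roofs C X Y" unfolding roof_rel_def by auto
  show "refl_on (roofs C X Y) (roof_rel C X Y)"
  proof (rule refl_onI)
    fix x assume "x \<in> roofs C X Y"
    then obtain Z s f where x: "x = (Z, s, f)" "roof X Y Z s f" using roofs_iff[OF X Y] by (cases x) auto
    note r = roofD[OF x(2)]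
    have "qis Z Z (ch_id C Z)" using qis_id r(2) unfolding cmap_def by blast
    then show "(x, x) \<in> roof_rel C X Y" unfolding x(1) roof_rel_iff[OF X Y]
      using x(2) hty_refl[OF cmap_comp[OF qisD(1) r(2)]] hty_refl[OF cmap_comp[OF qisD(1) r(3)]] by blast
  qed
  show "sym (roof_rel C X Y)"
  proof (rule symI)
    fix x y assume "(x, y) \<in> roof_rel C X Y"
    then show "(y, x) \<in> roof_rel C X Y"
      by (cases x; cases y) (auto simp: roof_rel_iff[OF X Y] intro: hty_sym)
  qed
  show "trans (roof_rel C X Y)"
  proof (rule transI)
    fix x y z assume xyz: "(x, y) \<in> roof_rel C X Y" "(y, z) \<in> roof_rel C X Y"
    obtain Z1 s1 f1 where x: "x = (Z1, s1, f1)" by (cases x)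
    obtain Z2 s2 f2 where y: "y = (Z2, s2, f2)" by (cases y)
    obtain Z3 s3 f3 where z: "z = (Z3, s3, f3)" by (cases z)
    obtain W p1 p2 where r: "roof X Y Z1 s1 f1" "roof X Y Z2 s2 f2"
      and p: "qis W Z1 p1" "qis W Z2 p2" "hty W X (s1 \<odot> p1) (s2 \<odot> p2)" "hty W Y (f1 \<odot> p1) (f2 \<odot> p2)"
      using xyz(1) unfolding x y roof_rel_iff[OF X Y] by blast
    obtain V q2 q3 where r3: "roof X Y Z3 s3 f3"
      and q: "qis V Z2 q2" "qis V Z3 q3" "hty V X (s2 \<odot> q2) (s3 \<odot> q3)" "hty V Y (f2 \<odot> q2) (f3 \<odot> q3)"
      using xyz(2) unfolding y z roof_rel_iff[OF X Y] by blast
    note c = qisD(1)[OF p(1)] qisD(1)[OF p(2)] qisD(1)[OF q(1)] qisD(1)[OF q(2)]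
    \<comment> \<open>The two comparisons share the middle roof, so an Ore square over its apex
      \<open>Z2\<close> joins them.\<close>
    obtain U t h where t: "qis U W t" "cmap U V h" "hty U Z2 (p2 \<odot> t) (q2 \<odot> h)" using ore[OF c(2) q(1)] .
    note tc = qisD(1)[OF t(1)]
    have h: "qis U V h" using qis_of_comp[OF t(2) q(1)] qis_comp[OF t(1) p(2)] qis_hty[OF t(3)] by blast
    have *: "hty U B (g1 \<odot> p1 \<odot> t) (g3 \<odot> q3 \<odot> h)"
      if g: "cmap Z1 B g1" "cmap Z2 B g2" "cmap Z3 B g3" "hty W B (g1 \<odot> p1) (g2 \<odot> p2)" "hty V B (g2 \<odot> q2) (g3 \<odot> q3)"
      for B g1 g2 g3
    proof -
      have "hty U B (g1 \<odot> p1 \<odot> t) (g2 \<odot> p2 \<odot> t)" by (rule hty_pre[OF g(4) c(1) g(1) c(2) g(2) tc])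
      moreover have "hty U B (g2 \<odot> p2 \<odot> t) (g2 \<odot> q2 \<odot> h)" by (rule hty_comp_left[OF t(3) g(2)])
      moreover have "hty U B (g2 \<odot> q2 \<odot> h) (g3 \<odot> q3 \<odot> h)" by (rule hty_pre[OF g(5) c(3) g(2) c(4) g(3) t(2)])
      ultimately show ?thesis using hty_trans by blast
    qed
    show "(x, z) \<in> roof_rel C X Y" unfolding x z roof_rel_iff[OF X Y]
      using r(1) r3 qis_comp[OF t(1) p(1)] qis_comp[OF h q(2)]
        *[OF roofD(3)[OF r(1)] roofD(3)[OF r(2)] roofD(3)[OF r3] p(3) q(3)]
        *[OF roofD(2)[OF r(1)] roofD(2)[OF r(2)] roofD(2)[OF r3] p(4) q(4)] by blast
  qed
qed

lemma darr_of_eq_iff: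
  assumes "roof X Y Z s f" "roof X Y Z' s' f'"
  shows "darr_of X Y Z s f = darr_of X Y Z' s' f' \<longleftrightarrow>
    (\<exists>W p p'. qis W Z p \<and> qis W Z' p' \<and> hty W X (s \<odot> p) (s' \<odot> p') \<and> hty W Y (f \<odot> p) (f' \<odot> p'))"
proof -
  have XY: "bounded_complex C X" "bounded_complex C Y" using roofD[OF assms(1)] unfolding cmap_def by auto
  show ?thesis unfolding darr_of_def
    using eq_equiv_class_iff[OF equiv_roof_rel[OF XY], of "(Z, s, f)" "(Z', s', f')"]
      roofs_iff[OF XY] roof_rel_iff[OF XY] assms by auto
qed

lemma darr_of_hom:
  assumes "roof X Y Z s f"
  shows "darr_of X Y Z s f \<in> Hom (Db_cat C) X Y"
proof -
  have XY: "bounded_complex C X" "bounded_complex C Y" using roofD[OF assms] unfolding cmap_def by auto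
  show ?thesis unfolding Hom_def using XY assms roofs_iff[OF XY] by (simp add: darr_of_def quotientI)
qed

lemma hom_darr_of:
  assumes "u \<in> Hom (Db_cat C) X Y"
  obtains Z s f where "roof X Y Z s f" "u = darr_of X Y Z s f"
proof -
  obtain P where u: "u = (X, Y, P)" and XY: "bounded_complex C X" "bounded_complex C Y"
    and P: "P \<in> roofs C X Y // roof_rel C X Y" using assms unfolding Hom_def by auto
  obtain x where x: "x \<in> roofs C X Y" "P = roof_rel C X Y `` {x}" using P by (rule quotientE)
  obtain Z s f where "x = (Z, s, f)" by (cases x)
  then show thesis using that x roofs_iff[OF XY] u by (simp add: darr_of_def)
qed

lemma mem_darr_of:
  assumes "darr_of X Y Z s f = (X', Y', P)" "(Z', s', f') \<in> P" "roof X Y Z s f"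
  shows "roof X Y Z' s' f'" "darr_of X Y Z' s' f' = darr_of X Y Z s f"
proof -
  have XY: "bounded_complex C X" "bounded_complex C Y" using roofD[OF assms(3)] unfolding cmap_def by auto
  have r: "((Z, s, f), (Z', s', f')) \<in> roof_rel C X Y" using assms unfolding darr_of_def by auto
  then show "roof X Y Z' s' f'" unfolding roof_rel_iff[OF XY] by blast
  show "darr_of X Y Z' s' f' = darr_of X Y Z s f"
    using equiv_class_eq[OF equiv_roof_rel[OF XY] r] unfolding darr_of_def by simp
qed

lemma self_mem:
  assumes "roof X Y Z s f"
  shows "(Z, s, f) \<in> roof_rel C X Y `` {(Z, s, f)}"
proof -
  have XY: "bounded_complex C X" "bounded_complex C Y" using roofD[OF assms] unfolding cmap_def by auto
  show ?thesis using equiv_class_self[OF equiv_roof_rel[OF XY]] roofs_iff[OF XY] assms by blast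
qed

lemma loc_darr_of: "loc C X Y f = darr_of X Y X (ch_id C X) f"
  by (simp add: loc_def darr_of_def)

lemma roof_loc: "cmap X Y f \<Longrightarrow> roof X Y X (ch_id C X) f"
  unfolding roof_def using qis_id unfolding cmap_def by blast

section \<open>Composition of roofs\<close>

lemma roof_comp:
  assumes "roof X Y V s f" "roof Y Z V' u g" "qis W V t" "cmap W V' h"
  shows "roof X Z W (s \<odot> t) (g \<odot> h)"
  unfolding roof_def using qis_comp[OF assms(3) roofD(1)[OF assms(1)]] cmap_comp[OF assms(4) roofD(2)[OF assms(2)]] by blast

text \<open>Both completed squares are brought to one apex above \<open>W\<close> and
  \<open>W1\<close>. The left legs agree there through \<open>M\<close>, which compares the first
  factors. The right legs agree through \<open>N\<close>, but only after the denominator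
  \<open>u1\<close> has been cancelled.\<close>

lemma comp_well_defined:
  assumes r: "roof X Y V s f" "roof Y Z V' u g" "roof X Y V1 s1 f1" "roof Y Z V1' u1 g1"
    and eq: "darr_of X Y V s f = darr_of X Y V1 s1 f1" "darr_of Y Z V' u g = darr_of Y Z V1' u1 g1"
    and W: "qis W V t" "cmap W V' h" "hty W Y (f \<odot> t) (u \<odot> h)"
    and W1: "qis W1 V1 t1" "cmap W1 V1' h1" "hty W1 Y (f1 \<odot> t1) (u1 \<odot> h1)"
  shows "darr_of X Z W (s \<odot> t) (g \<odot> h) = darr_of X Z W1 (s1 \<odot> t1) (g1 \<odot> h1)"
proof -
  obtain M m m1 where M: "qis M V m" "qis M V1 m1" "hty M X (s \<odot> m) (s1 \<odot> m1)" "hty M Y (f \<odot> m) (f1 \<odot> m1)"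
    using eq(1) unfolding darr_of_eq_iff[OF r(1,3)] by blast
  obtain N n n1 where N: "qis N V' n" "qis N V1' n1" "hty N Y (u \<odot> n) (u1 \<odot> n1)" "hty N Z (g \<odot> n) (g1 \<odot> n1)"
    using eq(2) unfolding darr_of_eq_iff[OF r(2,4)] by blast
  note rc = roofD(2,3)[OF r(1)] roofD(2,3)[OF r(2)] roofD(2,3)[OF r(3)] roofD(2,3)[OF r(4)]
  note cM = qisD(1)[OF M(1)] qisD(1)[OF M(2)] note cN = qisD(1)[OF N(1)] qisD(1)[OF N(2)]
  note ct = qisD(1)[OF W(1)] qisD(1)[OF W1(1)]
  \<comment> \<open>Two Ore squares place \<open>U2\<close> above \<open>W\<close>, \<open>M\<close>
    and \<open>W1\<close> simultaneously. Over it the two composites into \<open>X\<close>, and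
    likewise those into \<open>Y\<close>, are homotopic.\<close>
  obtain U1 \<alpha> \<beta> where U1: "qis U1 W \<alpha>" "cmap U1 M \<beta>" "hty U1 V (t \<odot> \<alpha>) (m \<odot> \<beta>)" using ore[OF ct(1) M(1)] .
  note c\<alpha> = qisD(1)[OF U1(1)]
  have \<beta>: "qis U1 M \<beta>" using qis_of_comp[OF U1(2) M(1)] qis_comp[OF U1(1) W(1)] qis_hty[OF U1(3)] by blast
  obtain U2 \<gamma> \<delta> where U2: "qis U2 W1 \<gamma>" "cmap U2 U1 \<delta>" "hty U2 V1 (t1 \<odot> \<gamma>) ((m1 \<odot> \<beta>) \<odot> \<delta>)"
    using ore[OF ct(2) qis_comp[OF \<beta> M(2)]] .
  note c\<gamma> = qisD(1)[OF U2(1)]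
  have U2': "hty U2 V1 (t1 \<odot> \<gamma>) (m1 \<odot> \<beta> \<odot> \<delta>)" using U2(3) chcomp_assoc[OF U2(2) U1(2) cM(2)] by simp
  have \<delta>: "qis U2 U1 \<delta>"
    using qis_of_comp[OF U2(2) qis_comp[OF \<beta> M(2)]] qis_comp[OF U2(1) W1(1)] qis_hty[OF U2(3)] by blast
  define a where "a = \<alpha> \<odot> \<delta>"
  define b where "b = \<beta> \<odot> \<delta>"
  have a: "qis U2 W a" "cmap U2 W a" unfolding a_def using qis_comp[OF \<delta> U1(1)] qisD(1) by blast+
  have b: "cmap U2 M b" unfolding b_def using cmap_comp[OF U2(2) U1(2)] .
  have tab: "hty U2 V (t \<odot> a) (m \<odot> b)" unfolding a_def b_def
    by (rule hty_pre[OF U1(3) c\<alpha> ct(1) U1(2) cM(1) U2(2)])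
  have t\<gamma>: "hty U2 V1 (m1 \<odot> b) (t1 \<odot> \<gamma>)" unfolding b_def by (rule hty_sym[OF U2'])
  have st: "hty U2 X (s \<odot> t \<odot> a) (s1 \<odot> t1 \<odot> \<gamma>)"
    using hty_comp_left[OF tab rc(2)] hty_pre[OF M(3) cM(1) rc(2) cM(2) rc(6) b] hty_comp_left[OF t\<gamma> rc(6)]
    by (blast intro: hty_trans)
  have "hty U2 Y (f \<odot> t \<odot> a) (f1 \<odot> t1 \<odot> \<gamma>)"
    using hty_comp_left[OF tab rc(1)] hty_pre[OF M(4) cM(1) rc(1) cM(2) rc(5) b] hty_comp_left[OF t\<gamma> rc(5)]
    by (blast intro: hty_trans)
  then have uh: "hty U2 Y (u \<odot> h \<odot> a) (u1 \<odot> h1 \<odot> \<gamma>)"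
    using hty_sym[OF hty_pre[OF W(3) ct(1) rc(1) W(2) rc(4) a(2)]] hty_pre[OF W1(3) ct(2) rc(5) W1(2) rc(8) c\<gamma>]
    by (blast intro: hty_trans)
  have cha: "cmap U2 V' (h \<odot> a)" by (rule cmap_comp[OF a(2) W(2)])
  have ch\<gamma>: "cmap U2 V1' (h1 \<odot> \<gamma>)" by (rule cmap_comp[OF c\<gamma> W1(2)])
  \<comment> \<open>The map into \<open>V'\<close> is pulled back to \<open>N\<close>, where the
    second factors can be compared.\<close>
  obtain U3 \<epsilon> \<zeta> where U3: "qis U3 U2 \<epsilon>" "cmap U3 N \<zeta>" "hty U3 V' ((h \<odot> a) \<odot> \<epsilon>) (n \<odot> \<zeta>)" using ore[OF cha N(1)] .
  note c\<epsilon> = qisD(1)[OF U3(1)]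
  have U3': "hty U3 V' (h \<odot> a \<odot> \<epsilon>) (n \<odot> \<zeta>)" using U3(3) chcomp_assoc[OF c\<epsilon> a(2) W(2)] by simp
  have "hty U3 Y (u1 \<odot> n1 \<odot> \<zeta>) (u \<odot> n \<odot> \<zeta>)" by (rule hty_sym[OF hty_pre[OF N(3) cN(1) rc(4) cN(2) rc(8) U3(2)]])
  moreover have "hty U3 Y (u \<odot> n \<odot> \<zeta>) (u \<odot> h \<odot> a \<odot> \<epsilon>)" by (rule hty_comp_left[OF hty_sym[OF U3'] rc(4)])
  moreover have "hty U3 Y (u \<odot> h \<odot> a \<odot> \<epsilon>) (u1 \<odot> h1 \<odot> \<gamma> \<odot> \<epsilon>)"
    using hty_pre[OF uh cha rc(4) ch\<gamma> rc(8) c\<epsilon>] chcomp_assoc[OF c\<epsilon> a(2) W(2)] chcomp_assoc[OF c\<epsilon> c\<gamma> W1(2)] by simp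
  ultimately have "hty U3 Y (u1 \<odot> n1 \<odot> \<zeta>) (u1 \<odot> h1 \<odot> \<gamma> \<odot> \<epsilon>)" by (blast intro: hty_trans)
  \<comment> \<open>So far the two maps into \<open>V1'\<close> agree only after composition with
    \<open>u1\<close>. As \<open>u1\<close> is a quasi-isomorphism, they agree after one more
    refinement.\<close>
  then obtain U4 \<theta> where U4: "qis U4 U3 \<theta>" "hty U4 V1' ((n1 \<odot> \<zeta>) \<odot> \<theta>) ((h1 \<odot> \<gamma> \<odot> \<epsilon>) \<odot> \<theta>)"
    using qis_cancel[OF roofD(1)[OF r(4)] cmap_comp[OF U3(2) cN(2)] cmap_comp[OF cmap_comp[OF c\<epsilon> c\<gamma>] W1(2)]] by blast
  note c\<theta> = qisD(1)[OF U4(1)]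
  define \<omega> where "\<omega> = \<epsilon> \<odot> \<theta>"
  have \<omega>: "qis U4 U2 \<omega>" "cmap U4 U2 \<omega>" unfolding \<omega>_def using qis_comp[OF U4(1) U3(1)] qisD(1) by blast+
  have 1: "hty U4 V1' (n1 \<odot> \<zeta> \<odot> \<theta>) (h1 \<odot> \<gamma> \<odot> \<omega>)"
    using U4(2) chcomp_assoc[OF c\<theta> U3(2) cN(2)] chcomp_assoc[OF c\<theta> cmap_comp[OF c\<epsilon> c\<gamma>] W1(2)]
      chcomp_assoc[OF c\<theta> c\<epsilon> c\<gamma>] unfolding \<omega>_def by simp
  have 2: "hty U4 V' (h \<odot> a \<odot> \<omega>) (n \<odot> \<zeta> \<odot> \<theta>)"
    using hty_pre[OF U3' cmap_comp[OF c\<epsilon> a(2)] W(2) U3(2) cN(1) c\<theta>] chcomp_assoc[OF c\<theta> c\<epsilon> a(2)] unfolding \<omega>_def by simp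
  have gh: "hty U4 Z (g \<odot> h \<odot> a \<odot> \<omega>) (g1 \<odot> h1 \<odot> \<gamma> \<odot> \<omega>)"
    using hty_comp_left[OF 2 rc(3)] hty_pre[OF N(4) cN(1) rc(3) cN(2) rc(7) cmap_comp[OF c\<theta> U3(2)]]
      hty_comp_left[OF 1 rc(7)] by (blast intro: hty_trans)
  have st': "hty U4 X (s \<odot> t \<odot> a \<odot> \<omega>) (s1 \<odot> t1 \<odot> \<gamma> \<odot> \<omega>)"
    using hty_pre[OF st cmap_comp[OF a(2) ct(1)] rc(2) cmap_comp[OF c\<gamma> ct(2)] rc(6) \<omega>(2)]
      chcomp_assoc[OF \<omega>(2) a(2) ct(1)] chcomp_assoc[OF \<omega>(2) c\<gamma> ct(2)] by simp
  have a\<omega>: "qis U4 W (a \<odot> \<omega>)" "qis U4 W1 (\<gamma> \<odot> \<omega>)" using qis_comp[OF \<omega>(1) a(1)] qis_comp[OF \<omega>(1) U2(1)] .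
  note ca = qisD(1)[OF a\<omega>(1)] qisD(1)[OF a\<omega>(2)]
  have "hty U4 X ((s \<odot> t) \<odot> a \<odot> \<omega>) ((s1 \<odot> t1) \<odot> \<gamma> \<odot> \<omega>)"
    using st' chcomp_assoc[OF ca(1) ct(1) rc(2)] chcomp_assoc[OF ca(2) ct(2) rc(6)] by simp
  moreover have "hty U4 Z ((g \<odot> h) \<odot> a \<odot> \<omega>) ((g1 \<odot> h1) \<odot> \<gamma> \<odot> \<omega>)"
    using gh chcomp_assoc[OF ca(1) W(2) rc(3)] chcomp_assoc[OF ca(2) W1(2) rc(7)] by simp
  ultimately show ?thesis
    unfolding darr_of_eq_iff[OF roof_comp[OF r(1,2) W(1,2)] roof_comp[OF r(3,4) W1(1,2)]] using a\<omega> by blast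
qed

text \<open>By the previous lemma all members of the family in \<open>darr_comp\<close> are the same
  class, and the given square shows that the family is inhabited; its union is therefore that
  class.\<close>

lemma comp_darr_of:
  assumes r: "roof X Y V s f" "roof Y Z V' u g"
    and W: "qis W V t" "cmap W V' h" "hty W Y (f \<odot> t) (u \<odot> h)"
  shows "darr_comp C (darr_of Y Z V' u g) (darr_of X Y V s f) = darr_of X Z W (s \<odot> t) (g \<odot> h)"
proof -
  let ?P = "roof_rel C X Y `` {(V, s, f)}" and ?Q = "roof_rel C Y Z `` {(V', u, g)}"
  let ?R = "roof_rel C X Z `` {(W, s \<odot> t, g \<odot> h)}"
  have Yb: "bounded_complex C Y" using roofD(2)[OF r(1)] unfolding cmap_def by blast
  let ?S = "{roof_rel C X Z `` {(W, ch_comp C s t, ch_comp C g h)} | V s f V' u g W t h.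
      (V, s, f) \<in> ?P \<and> (V', u, g) \<in> ?Q \<and> bounded_complex C W \<and>
      quasi_iso C W V t \<and> chain_map C W V' h \<and> homotopic C W Y (ch_comp C f t) (ch_comp C u h)}"
  have 1: "R = ?R" if RS: "R \<in> ?S" for R
  proof -
    obtain V1 s1 f1 V1' u1 g1 W1 t1 h1 where R: "R = roof_rel C X Z `` {(W1, s1 \<odot> t1, g1 \<odot> h1)}"
      and m: "(V1, s1, f1) \<in> ?P" "(V1', u1, g1) \<in> ?Q"
      and W1: "bounded_complex C W1" "quasi_iso C W1 V1 t1" "chain_map C W1 V1' h1" "homotopic C W1 Y (f1 \<odot> t1) (u1 \<odot> h1)"
      using RS unfolding mem_Collect_eq by blast
    note m1 = mem_darr_of[OF darr_of_def m(1) r(1)] note m2 = mem_darr_of[OF darr_of_def m(2) r(2)]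
    have t1: "qis W1 V1 t1" "cmap W1 V1' h1"
      using W1 roofD(2)[OF m1(1)] roofD(2)[OF m2(1)] unfolding qis_iff cmap_def by auto
    have "hty W1 Y (f1 \<odot> t1) (u1 \<odot> h1)" unfolding hty_def
      using W1(4) cmap_comp[OF qisD(1)[OF t1(1)] roofD(2)[OF m1(1)]] cmap_comp[OF t1(2) roofD(3)[OF m2(1)]] by blast
    from comp_well_defined[OF m1(1) m2(1) r m1(2) m2(2) t1 this W]
    show ?thesis unfolding R darr_of_def by simp
  qed
  have 2: "?R \<in> ?S"
    using self_mem[OF r(1)] self_mem[OF r(2)] W unfolding qis_iff cmap_def hty_def by blast
  have "?S = {?R}" using 1 2 by blast
  then have "\<Union>?S = ?R" by simp
  then show ?thesis unfolding darr_of_def darr_comp.simps by (rule arg_cong)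
qed

lemma comp_loc:
  assumes "cmap X Y f" "cmap Y Z g"
  shows "darr_comp C (loc C Y Z g) (loc C X Y f) = loc C X Z (g \<odot> f)"
proof -
  have X: "bounded_complex C X" using assms unfolding cmap_def by blast
  show ?thesis unfolding loc_darr_of
    using comp_darr_of[OF roof_loc[OF assms(1)] roof_loc[OF assms(2)] qis_id[OF X] assms(1)]
      hty_refl[OF assms(1)] chcomp_id[OF assms(1)] chcomp_id[OF cmap_id[OF X]] by simp
qed

text \<open>The inverse is the roof with its legs exchanged. Identities of \<open>W\<close> complete
  the square, and the composite with two equal legs \<open>s\<close> is equivalent to the identity
  via \<open>s\<close> itself.\<close>

lemma iso_darr_of:
  assumes "qis W X s" "qis W Y g"
  shows "iso_arr (Db_cat C) (darr_of X Y W s g)"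
proof -
  have *: "darr_comp C (darr_of Y X W g s) (darr_of X Y W s g) = loc C X X (ch_id C X)"
    if "qis W X s" "qis W Y g" for X Y s g
  proof -
    note c = qisD(1)[OF that(1)] qisD(1)[OF that(2)]
    have X: "bounded_complex C X" "bounded_complex C W" using c unfolding cmap_def by auto
    have r: "roof X Y W s g" "roof Y X W g s" "roof X X W s s" using that c unfolding roof_def by auto
    have "darr_comp C (darr_of Y X W g s) (darr_of X Y W s g) = darr_of X X W (s \<odot> ch_id C W) (s \<odot> ch_id C W)"
      using comp_darr_of[OF r(1,2) qis_id[OF X(2)] cmap_id[OF X(2)]] hty_refl[OF c(2)] chcomp_id[OF c(2)] by simp
    also have "\<dots> = darr_of X X W s s" using chcomp_id[OF c(1)] by simp
    also have "\<dots> = loc C X X (ch_id C X)"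
      unfolding loc_darr_of darr_of_eq_iff[OF r(3) roof_loc[OF cmap_id[OF X(1)]]]
      using qis_id[OF X(2)] that(1) hty_refl[OF c(1)] chcomp_id[OF c(1)] by metis
    finally show ?thesis .
  qed
  have r: "roof X Y W s g" "roof Y X W g s" using assms qisD(1) unfolding roof_def by auto
  note h = darr_of_hom[OF r(1)] darr_of_hom[OF r(2)]
  have d: "Dom (Db_cat C) (darr_of X Y W s g) = X" "Cod (Db_cat C) (darr_of X Y W s g) = Y" by (simp_all add: darr_of_def)
  have "darr_of X Y W s g \<in> Arr (Db_cat C)" using h(1) unfolding Hom_def by blast
  moreover have "Comp (Db_cat C) (darr_of Y X W g s) (darr_of X Y W s g) = Ident (Db_cat C) X"
    "Comp (Db_cat C) (darr_of X Y W s g) (darr_of Y X W g s) = Ident (Db_cat C) Y"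
    unfolding Db_cat_simps using *[OF assms] *[OF assms(2,1)] by simp_all
  ultimately show ?thesis unfolding iso_arr_def d using h(2) by blast
qed

lemma isomorphicI:
  assumes "qis W X s" "qis W Y g"
  shows "isomorphic (Db_cat C) X Y"
  unfolding isomorphic_def using iso_darr_of[OF assms] darr_of_hom[of X Y W s g] assms qisD(1) unfolding roof_def by blast

text \<open>The identity roof belongs to the union defining the composite. That membership supplies
  representatives of both factors and a completed square whose right leg \<open>g \<odot> h\<close>
  becomes a quasi-isomorphism after composition with \<open>p\<close>.\<close>

lemma comp_ident_mem:
  assumes u: "u = darr_of X Y V0 s0 f0" "roof X Y V0 s0 f0" and v: "v = darr_of Y X V1 s1 f1" "roof Y X V1 s1 f1"
    and vu: "darr_comp C v u = loc C X X (ch_id C X)"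
  obtains V s f V' w g W t h M p where "roof X Y V s f" "darr_of X Y V s f = u" "roof Y X V' w g" "darr_of Y X V' w g = v"
    "qis W V t" "cmap W V' h" "hty W Y (f \<odot> t) (w \<odot> h)" "qis M W p" "qis M X (g \<odot> h \<odot> p)"
proof -
  let ?P = "roof_rel C X Y `` {(V0, s0, f0)}" and ?Q = "roof_rel C Y X `` {(V1, s1, f1)}"
  let ?S = "{roof_rel C X X `` {(W, ch_comp C s t, ch_comp C g h)} | V s f V' u g W t h.
      (V, s, f) \<in> ?P \<and> (V', u, g) \<in> ?Q \<and> bounded_complex C W \<and>
      quasi_iso C W V t \<and> chain_map C W V' h \<and> homotopic C W Y (ch_comp C f t) (ch_comp C u h)}"
  have X: "bounded_complex C X" using roofD(3)[OF u(2)] unfolding cmap_def by blast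
  have "\<Union>?S = roof_rel C X X `` {(X, ch_id C X, ch_id C X)}"
    using vu unfolding u(1) v(1) darr_of_def loc_def darr_comp.simps by (simp only: prod.inject)
  then have "(X, ch_id C X, ch_id C X) \<in> \<Union>?S" using self_mem[OF roof_loc[OF cmap_id[OF X]]] by blast
  then obtain V s f V' w g W t h where m: "(V, s, f) \<in> ?P" "(V', w, g) \<in> ?Q"
    and W: "bounded_complex C W" "quasi_iso C W V t" "chain_map C W V' h" "homotopic C W Y (f \<odot> t) (w \<odot> h)"
    and i: "(X, ch_id C X, ch_id C X) \<in> roof_rel C X X `` {(W, s \<odot> t, g \<odot> h)}" by blast
  note m1 = mem_darr_of[OF darr_of_def m(1) u(2)] note m2 = mem_darr_of[OF darr_of_def m(2) v(2)]
  have t: "qis W V t" "cmap W V' h"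
    using W roofD(2)[OF m1(1)] roofD(2)[OF m2(1)] unfolding qis_iff cmap_def by auto
  have fh: "hty W Y (f \<odot> t) (w \<odot> h)" unfolding hty_def
    using W(4) cmap_comp[OF qisD(1)[OF t(1)] roofD(2)[OF m1(1)]] cmap_comp[OF t(2) roofD(3)[OF m2(1)]] by blast
  obtain M p p' where M: "qis M W p" "qis M X p'" "hty M X ((g \<odot> h) \<odot> p) (ch_id C X \<odot> p')"
    using i roof_rel_iff[OF X X] by auto
  have "qis M X ((g \<odot> h) \<odot> p)" using qis_hty[OF M(3)] chcomp_id[OF qisD(1)[OF M(2)]] M(2) by simp
  then have "qis M X (g \<odot> h \<odot> p)" using chcomp_assoc[OF qisD(1)[OF M(1)] t(2) roofD(2)[OF m2(1)]] by simp
  then show thesis using that[OF m1(1) _ m2(1) _ t fh M(1)] m1(2) m2(2) u(1) v(1) by blast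
qed

text \<open>An isomorphism is represented by a roof whose second leg is a quasi-isomorphism as well: a left
  inverse makes the second leg injective on cohomology, a right inverse makes it surjective.\<close>

lemma isomorphicE:
  assumes "isomorphic (Db_cat C) X Y"
  obtains V s f where "qis V X s" "qis V Y f"
proof -
  obtain u where u: "u \<in> Hom (Db_cat C) X Y" "iso_arr (Db_cat C) u" using assms unfolding isomorphic_def by blast
  obtain V0 s0 f0 where r0: "roof X Y V0 s0 f0" "u = darr_of X Y V0 s0 f0" using hom_darr_of[OF u(1)] .
  have uD: "Dom (Db_cat C) u = X" "Cod (Db_cat C) u = Y" using r0 by (simp_all add: darr_of_def)
  obtain v where v: "v \<in> Hom (Db_cat C) Y X" and vu: "darr_comp C v u = loc C X X (ch_id C X)"
    and uv: "darr_comp C u v = loc C Y Y (ch_id C Y)"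
    using u(2) unfolding iso_arr_def uD by auto
  obtain V1 s1 f1 where r1: "roof Y X V1 s1 f1" "v = darr_of Y X V1 s1 f1" using hom_darr_of[OF v] .
  obtain V s f V' w g W t h M p where a: "roof X Y V s f" "darr_of X Y V s f = u" "roof Y X V' w g" "darr_of Y X V' w g = v"
    "qis W V t" "cmap W V' h" "hty W Y (f \<odot> t) (w \<odot> h)" "qis M W p" "qis M X (g \<odot> h \<odot> p)"
    using comp_ident_mem[OF r0(2,1) r1(2,1) vu] .
  obtain V2 s2 f2 V2' w2 g2 W2 t2 h2 M2 p2 where b: "roof Y X V2 s2 f2" "darr_of Y X V2 s2 f2 = v"
    "roof X Y V2' w2 g2" "darr_of X Y V2' w2 g2 = u" "cmap W2 V2' h2" "qis M2 W2 p2" "qis M2 Y (g2 \<odot> h2 \<odot> p2)"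
    using comp_ident_mem[OF r1(2,1) r0(2,1) uv] by metis
  note cp = qisD(1)[OF a(8)] note ct = qisD(1)[OF a(5)]
  have "hinj M V' (h \<odot> p) n" for n
    by (rule hinj_of_comp[OF cmap_comp[OF cp a(6)] roofD(2)[OF a(3)] qisD(2)[OF a(9)]])
  then have "hinj M Y (w \<odot> h \<odot> p) n" for n
    using hinj_comp[OF cmap_comp[OF cp a(6)] roofD(3)[OF a(3)]] qisD(2)[OF roofD(1)[OF a(3)]] by blast
  moreover have "hty M Y (w \<odot> h \<odot> p) (f \<odot> t \<odot> p)"
    by (rule hty_sym[OF hty_pre[OF a(7) ct roofD(2)[OF a(1)] a(6) roofD(3)[OF a(3)] cp]])
  ultimately have ftp: "hinj M Y (f \<odot> t \<odot> p) n" for n using hinj_hty by blast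
  have tp: "qis M V (t \<odot> p)" by (rule qis_comp[OF a(8,5)])
  note ctp = qisD(1)[OF tp] and cf = roofD(2)[OF a(1)]
  \<comment> \<open>Injectivity is known only after composition with \<open>t \<odot> p\<close>. As
    this is a quasi-isomorphism, every class of \<open>V\<close> comes locally from
    \<open>M\<close>, where injectivity applies.\<close>
  have inj: "hinj V Y f n" for n unfolding hinj_def
  proof (intro allI impI; elim conjE)
    note [simp] = cmapD[OF ctp] cmapD[OF cf]
    fix z assume z: "cyc V n z" "bdry Y n (f n \<bullet> z)"
    obtain e x where e: "epi_arr C e" "Cod C e = Dom C z" "cyc M n x" "Dom C x = Dom C e"
      "bdry V n (z \<bullet> e \<oplus> Neg C ((t \<odot> p) n \<bullet> x))" using qisD(3)[OF tp] z(1) unfolding hsurj_def by blast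
    note [simp] = e(1,2,4) cycD[OF z(1)] cycD[OF e(3)]
    have "bdry Y n (f n \<bullet> (z \<bullet> e) \<oplus> Neg C (f n \<bullet> ((t \<odot> p) n \<bullet> x)))" using cmap_bdry[OF cf e(5)] by simp
    moreover have "bdry Y n (f n \<bullet> (z \<bullet> e))" using bdry_comp[OF _ z(2), of e] by simp
    ultimately have "bdry Y n (f n \<bullet> ((t \<odot> p) n \<bullet> x))" using bdry_eq'[of Y n "f n \<bullet> (z \<bullet> e)"] by simp
    then have "bdry Y n ((f \<odot> t \<odot> p) n \<bullet> x)" by (simp add: ch_comp_def[of C f])
    then have "bdry M n x" using ftp e(3) unfolding hinj_def by blast
    then have "bdry V n ((t \<odot> p) n \<bullet> x)" by (rule cmap_bdry[OF ctp])
    then have ze: "bdry V n (z \<bullet> e)" using bdry_eq[OF _ e(5)] by simp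
    show "bdry V n z" by (rule bdry_descend[OF _ ze e(1)]) simp_all
  qed
  have surj2: "hsurj V2' Y g2 n" for n
    by (rule hsurj_of_comp[OF cmap_comp[OF qisD(1)[OF b(6)] b(5)] roofD(2)[OF b(3)] qisD(3)[OF b(7)]])
  \<comment> \<open>The two identities were read off with different representatives of
    \<open>u\<close>; surjectivity is carried over along their equivalence.\<close>
  have "darr_of X Y V s f = darr_of X Y V2' w2 g2" using a(2) b(4) by simp
  then obtain L m m2 where L: "qis L V m" "qis L V2' m2" "hty L Y (f \<odot> m) (g2 \<odot> m2)"
    unfolding darr_of_eq_iff[OF a(1) b(3)] by blast
  have "hsurj L Y (g2 \<odot> m2) n" for n
    by (rule hsurj_comp[OF qisD(1)[OF L(2)] roofD(2)[OF b(3)] qisD(3)[OF L(2)] surj2])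
  then have "hsurj L Y (f \<odot> m) n" for n using hsurj_hty[OF hty_sym[OF L(3)]] by blast
  then have "hsurj V Y f n" for n using hsurj_of_comp[OF qisD(1)[OF L(1)] cf] by blast
  then have "qis V Y f" using inj cf unfolding qis_def by blast
  then show thesis using that roofD(1)[OF a(1)] by blast
qed

section \<open>Invariants, zero morphisms and zero objects of the derived category\<close>

lemma isomorphic_coh: "isomorphic (Db_cat C) X Y \<Longrightarrow> coh X n A \<longleftrightarrow> coh Y n A"
  using isomorphicE qis_coh by metis

lemma isomorphic_acyc: "isomorphic (Db_cat C) X Y \<Longrightarrow> acyc X n \<longleftrightarrow> acyc Y n"
  using isomorphicE qis_acyc by metis

lemma isomorphic_bounded: "isomorphic (Db_cat C) X Y \<Longrightarrow> bounded_complex C X \<and> bounded_complex C Y"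
  using isomorphicE qisD(1) unfolding cmap_def by metis

text \<open>If the right leg becomes null-homotopic after \<open>p\<close>, then \<open>W\<close>
  with the maps \<open>p\<close> and \<open>s \<odot> p\<close> compares the roof with the zero
  roof.\<close>

lemma hom_zero:
  assumes X: "bounded_complex C X" and Y: "bounded_complex C Y"
    and k: "\<And>Z s f. qis Z X s \<Longrightarrow> cmap Z Y f \<Longrightarrow> \<exists>W p. qis W Z p \<and> hty W Y (f \<odot> p) (ch_zero C W Y)"
  shows "Hom (Db_cat C) X Y = {loc C X Y (ch_zero C X Y)}"
proof -
  have z: "roof X Y X (ch_id C X) (ch_zero C X Y)" by (rule roof_loc[OF cmap_zero[OF X Y]])
  have "u = loc C X Y (ch_zero C X Y)" if u: "u \<in> Hom (Db_cat C) X Y" for u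
  proof -
    obtain Z s f where r: "roof X Y Z s f" "u = darr_of X Y Z s f" using hom_darr_of[OF u] .
    note rD = roofD[OF r(1)]
    obtain W p where W: "qis W Z p" "hty W Y (f \<odot> p) (ch_zero C W Y)" using k rD by blast
    note sp = qis_comp[OF W(1) rD(1)] note csp = qisD(1)[OF sp]
    have "hty W X (s \<odot> p) (ch_id C X \<odot> s \<odot> p)" using hty_refl[OF csp] chcomp_id[OF csp] by simp
    moreover have "hty W Y (f \<odot> p) (ch_zero C X Y \<odot> s \<odot> p)" using W(2) chcomp_zero(2)[OF csp Y] by simp
    ultimately show ?thesis unfolding r(2) loc_darr_of darr_of_eq_iff[OF r(1) z] using W(1) sp by blast
  qed
  then show ?thesis using darr_of_hom[OF z] unfolding loc_darr_of by blast
qed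

lemma Db_zero_iff: "is_zero (Db_cat C) X \<longleftrightarrow> bounded_complex C X \<and> (\<forall>n. acyc X n)"
proof
  assume z: "is_zero (Db_cat C) X"
  then have X: "bounded_complex C X" unfolding is_zero_def by simp
  have r: "roof X X X (ch_id C X) (ch_id C X)" "roof X X X (ch_id C X) (ch_zero C X X)"
    using roof_loc[OF cmap_id[OF X]] roof_loc[OF cmap_zero[OF X X]] .
  have "darr_of X X X (ch_id C X) (ch_id C X) = darr_of X X X (ch_id C X) (ch_zero C X X)"
    using z X darr_of_hom[OF r(1)] darr_of_hom[OF r(2)] unfolding is_zero_def Db_cat_simps by blast
  then obtain W p p' where W: "qis W X p" "qis W X p'" "hty W X (ch_id C X \<odot> p) (ch_zero C X X \<odot> p')"
    unfolding darr_of_eq_iff[OF r] by blast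
  note c = qisD(1)[OF W(1)] qisD(1)[OF W(2)]
  have Wb: "bounded_complex C W" using c unfolding cmap_def by blast
  have "hty W X p (ch_zero C W X)" using W(3) chcomp_id[OF c(1)] chcomp_zero[OF c(2) X] by simp
  then have q: "qis W X (ch_zero C W X)" using qis_hty W(1) by blast
  \<comment> \<open>A zero map sends every cycle to a boundary; being a quasi-isomorphism here, it
    shows that the cycle was a boundary.\<close>
  have "acyc W n" for n unfolding acyc_def
  proof (intro allI impI)
    fix z assume z: "cyc W n z"
    have "bdry X n (ch_zero C W X n \<bullet> z)" using cycD[OF z] X Wb bdry_zero[OF X, of "Dom C z" n] by (simp add: ch_zero_def)
    then show "bdry W n z" using qisD(2)[OF q] z unfolding hinj_def by blast
  qed
  then show "bounded_complex C X \<and> (\<forall>n. acyc X n)" using qis_acyc[OF W(1)] X by blast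
next
  assume "bounded_complex C X \<and> (\<forall>n. acyc X n)"
  then have X: "bounded_complex C X" and a: "acyc X n" for n by auto
  show "is_zero (Db_cat C) X" unfolding is_zero_def Db_cat_simps
  proof (intro conjI ballI)
    show "X \<in> {X. bounded_complex C X}" using X by simp
    fix Y assume "Y \<in> {X. bounded_complex C X}"
    then have Y: "bounded_complex C Y" by simp
    have "Hom (Db_cat C) Y X = {loc C Y X (ch_zero C Y X)}"
      by (rule hom_zero[OF Y X]) (metis kill_acyclic a)
    then show "\<exists>!f. f \<in> Hom (Db_cat C) Y X" by simp
    have "Hom (Db_cat C) X Y = {loc C X Y (ch_zero C X Y)}"
    proof (rule hom_zero[OF X Y])
      fix Z s f assume s: "qis Z X s" and f: "cmap Z Y f"
      have Z: "bounded_complex C Z" using f unfolding cmap_def by blast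
      have Za: "acyc Z n" for n using a qis_acyc[OF s] by blast
      \<comment> \<open>For arrows out of \<open>X\<close> the apex \<open>Z\<close> is acyclic, so
        its identity can be killed, and with it every right leg.\<close>
      obtain W t where "qis W Z t" "hty W Z (ch_id C Z \<odot> t) (ch_zero C W Z)"
        using kill_acyclic[OF cmap_id[OF Z] Za] .
      then have t: "qis W Z t" "hty W Z t (ch_zero C W Z)" using chcomp_id[OF qisD(1)] by simp_all
      have "bounded_complex C W" using qisD(1)[OF t(1)] unfolding cmap_def by blast
      then have "hty W Y (f \<odot> t) (ch_zero C W Y)" using hty_comp_left[OF t(2) f] chcomp_zero(1)[OF f] by simp
      then show "\<exists>W p. qis W Z p \<and> hty W Y (f \<odot> p) (ch_zero C W Y)" using t(1) by blast
    qed
    then show "\<exists>!f. f \<in> Hom (Db_cat C) X Y" by simp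
  qed
qed

text \<open>\<open>darr_shift\<close> moves a class roof by roof, so the image has to be shown to be
  a whole class again. One inclusion is preservation of quasi-isomorphisms and homotopies.\<close>

lemma shift_darr_of:
  assumes r: "roof X Y Z s f"
  shows "darr_shift C k (darr_of X Y Z s f) = darr_of (sh_cplx C k X) (sh_cplx C k Y) (sh_cplx C k Z) (sh_map k s) (sh_map k f)"
proof -
  have XY: "bounded_complex C X" "bounded_complex C Y" using roofD[OF r] unfolding cmap_def by auto
  have Zb: "bounded_complex C Z" using roofD[OF r] unfolding cmap_def by auto
  have mm: "sh_map j (sh_map i g) = sh_map (j + i) g" "sh_map 0 g = g" for j i and g :: "int \<Rightarrow> 'b"
    by (simp_all add: sh_map_def algebra_simps)
  have cc: "sh_map k (a \<odot> b) = sh_map k a \<odot> sh_map k b" for k a b by (simp add: sh_map_def ch_comp_def)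
  have *: "((sh_cplx C k Z, sh_map k s, sh_map k f), (sh_cplx C k Z', sh_map k s', sh_map k f')) \<in>
      roof_rel C (sh_cplx C k X) (sh_cplx C k Y)"
    if "((Z, s, f), (Z', s', f')) \<in> roof_rel C X Y" "bounded_complex C X" "bounded_complex C Y"
    for k X Y Z s f Z' s' f'
    using that(1) unfolding roof_rel_iff[OF that(2,3)] roof_rel_iff[OF sh_bounded[OF that(2)] sh_bounded[OF that(3)]]
    unfolding roof_def using qis_sh[of _ _ _ k] cmap_sh[of _ _ _ k] hty_sh[of _ _ _ _ k] cc by metis
  have "(\<lambda>(Z, s, f). (sh_cplx C k Z, sh_map k s, sh_map k f)) ` (roof_rel C X Y `` {(Z, s, f)}) =
      roof_rel C (sh_cplx C k X) (sh_cplx C k Y) `` {(sh_cplx C k Z, sh_map k s, sh_map k f)}" (is "?l = ?r")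
  proof
    show "?l \<subseteq> ?r" using * XY by auto
    show "?r \<subseteq> ?l"
    proof
      fix x assume x: "x \<in> ?r"
      obtain Z' s' f' where x': "x = (Z', s', f')" by (cases x)
      note sXY = sh_bounded[OF XY(1), of k] sh_bounded[OF XY(2), of k]
      have m: "((sh_cplx C k Z, sh_map k s, sh_map k f), (Z', s', f')) \<in> roof_rel C (sh_cplx C k X) (sh_cplx C k Y)"
        using x x' by simp
      then have Z': "bounded_complex C Z'" unfolding roof_rel_iff[OF sXY] roof_def cmap_def by blast
      \<comment> \<open>For the other inclusion the roof is shifted back; shifts by \<open>k\<close>
        and \<open>- k\<close> are inverse on the nose.\<close>
      have "((Z, s, f), (sh_cplx C (- k) Z', sh_map (- k) s', sh_map (- k) f')) \<in> roof_rel C X Y"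
        using *[OF m sXY, of "- k"] by (simp add: sh_sh XY Zb mm)
      then have "(sh_cplx C k (sh_cplx C (- k) Z'), sh_map k (sh_map (- k) s'), sh_map k (sh_map (- k) f')) \<in> ?l"
        by force
      then show "x \<in> ?l" using x' by (simp add: sh_sh Z' mm)
    qed
  qed
  then show ?thesis unfolding darr_of_def by simp
qed

section \<open>Distinguished triangles and mapping cones\<close>

lemma shift_loc_id:
  assumes "bounded_complex C X"
  shows "darr_shift C k (loc C X X (ch_id C X)) = loc C (sh_cplx C k X) (sh_cplx C k X) (ch_id C (sh_cplx C k X))"
  unfolding loc_darr_of shift_darr_of[OF roof_loc[OF cmap_id[OF assms]]] by (simp add: sh_map_def ch_id_def)

text \<open>The cone sequence is compared with itself by identities, so only composites of localized
  chain maps and the shift of an identity have to be evaluated.\<close>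

lemma cone_triangle:
  assumes "cone C X Y K f i1 i2 p1 p2"
  shows "\<exists>u v w. triangle (Db C) X Y K u v w"
proof -
  interpret cone C X Y K f i1 i2 p1 p2 by fact
  let ?T = "sh_cplx C 1 X"
  have p: "cmap K ?T p1" by (rule cmapI) simp_all
  have b [simp]: "bounded_complex C X" "bounded_complex C Y" by simp_all
  let ?i = "\<lambda>X. loc C X X (ch_id C X)"
  have id: "?i Z \<in> Hom (Db_cat C) Z Z \<and> iso_arr (Db_cat C) (?i Z)" if "bounded_complex C Z" for Z
    using darr_of_hom[OF roof_loc[OF cmap_id[OF that]]] iso_darr_of[OF qis_id[OF that] qis_id[OF that]] unfolding loc_darr_of by blast
  have h: "loc C X Y f \<in> Hom (Db_cat C) X Y" "loc C Y K i2 \<in> Hom (Db_cat C) Y K" "loc C K ?T p1 \<in> Hom (Db_cat C) K ?T"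
    unfolding loc_darr_of by (intro darr_of_hom roof_loc cm i2_cmap p)+
  have lid: "darr_comp C (?i B) (loc C A B g) = darr_comp C (loc C A B g) (?i A)" if "cmap A B g" for A B g
    using comp_loc[OF cmap_id that] comp_loc[OF that cmap_id] chcomp_id[OF that] that unfolding cmap_def by simp
  have "(loc C X Y f, loc C Y K i2, loc C K ?T p1) \<in> Db_dist C"
    unfolding Db_dist_def mem_Collect_eq prod.case
    by (rule exI[of _ X], rule exI[of _ Y], rule exI[of _ K], rule exI[of _ X], rule exI[of _ Y], rule exI[of _ K],
        rule exI[of _ f], rule exI[of _ i1], rule exI[of _ i2], rule exI[of _ p1], rule exI[of _ p2],
        rule exI[of _ "?i X"], rule exI[of _ "?i Y"], rule exI[of _ "?i K"])
       (use h id[of X] id[of Y] id[of K] cm mc lid[OF cm] lid[OF i2_cmap] lid[OF p] in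
        \<open>simp add: shift_loc_id cmap_def\<close>)
  then show ?thesis unfolding triangle_def Db_defs Db_simps using h by blast
qed

text \<open>Of the comparison with a cone only the isomorphisms of the three vertices are retained;
  slices are determined by the cohomology of the vertices.\<close>

lemma triangle_cone:
  assumes "triangle (Db C) X Y Z u v w"
  obtains X' Y' K f i1 i2 p1 p2 where "cone C X' Y' K f i1 i2 p1 p2"
    "isomorphic (Db_cat C) X X'" "isomorphic (Db_cat C) Y Y'" "isomorphic (Db_cat C) Z K"
proof -
  have h: "u \<in> Hom (Db_cat C) X Y" "v \<in> Hom (Db_cat C) Y Z" and d: "(u, v, w) \<in> Db_dist C"
    using assms unfolding triangle_def by auto
  obtain X1 Y1 Z1 X' Y' K f i1 i2 p1 p2 a b c where
    "u \<in> Hom (Db_cat C) X1 Y1" "v \<in> Hom (Db_cat C) Y1 Z1"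
    and c: "bounded_complex C X'" "bounded_complex C Y'" "chain_map C X' Y' f" "mapping_cone C X' Y' f K i1 i2 p1 p2"
    and i: "a \<in> Hom (Db_cat C) X1 X'" "iso_arr (Db_cat C) a" "b \<in> Hom (Db_cat C) Y1 Y'" "iso_arr (Db_cat C) b"
      "c \<in> Hom (Db_cat C) Z1 K" "iso_arr (Db_cat C) c"
    using d unfolding Db_dist_def mem_Collect_eq prod.case by blast
  \<comment> \<open>An arrow determines its ends, so the objects quantified in
    \<open>Db_dist\<close> are the given vertices.\<close>
  moreover from this h have "X1 = X" "Y1 = Y" "Z1 = Z" unfolding Hom_def by auto
  moreover have "cone C X' Y' K f i1 i2 p1 p2" using c unfolding cmap_def by unfold_locales (simp_all add: cmap_def)
  ultimately show thesis using that unfolding isomorphic_def by blast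
qed

end

section \<open>Truncations and slices\<close>

context abelian_category
begin

lemma zero_obj: "is_zero C (zero_obj C)"
  unfolding zero_obj_def by (rule someI_ex[OF zero_exists])

lemma zero_obj_in [simp]: "zero_obj C \<in> Obj C"
  using zero_obj is_zero_iff by blast

lemma into_zero_obj: "z \<in> Arr C \<Longrightarrow> Cod C z = zero_obj C \<Longrightarrow> z = Zr (Dom C z) (zero_obj C)"
  using zero_obj_arr(2)[OF zero_obj] by blast

lemma acyc_zero_ob:
  assumes "bounded_complex C X" "is_zero C (ob X n)"
  shows "acyc X n"
  unfolding acyc_def
proof (intro allI impI)
  fix z assume z: "cyc X n z"
  have "z = Zr (Dom C z) (ob X n)" using zero_obj_arr(2)[OF assms(2)] cycD[OF z] by blast
  moreover have "bdry X n (Zr (Dom C z) (ob X n))" using bdry_zero[OF assms(1)] cycD[OF z] by simp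
  ultimately show "bdry X n z" by metis
qed

lemma hsurj_acyc:
  assumes "cmap X Y f" "acyc Y n"
  shows "hsurj X Y f n"
  unfolding hsurj_def
proof (intro allI impI)
  note [simp] = cmapD[OF assms(1)]
  fix z assume z: "cyc Y n z"
  note [simp] = cycD[OF z]
  let ?x = "Zr (Dom C z) (ob X n)" and ?e = "Ident C (Dom C z)"
  have "bdry Y n (z \<bullet> ?e \<oplus> Neg C (f n \<bullet> ?x))" using assms(2) z unfolding acyc_def by simp
  moreover have "cyc X n ?x" unfolding cyc_def by simp
  ultimately show "\<exists>e x. epi_arr C e \<and> Cod C e = Dom C z \<and> cyc X n x \<and> Dom C x = Dom C e \<and>
      bdry Y n (z \<bullet> e \<oplus> Neg C (f n \<bullet> x))" by (intro exI[of _ ?e] exI[of _ ?x]) simp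
qed

lemma hinj_acyc: "acyc X n \<Longrightarrow> hinj X Y f n"
  unfolding hinj_def acyc_def by blast

end

text \<open>\<open>m\<close> is a subobject of the cocycles in degree \<open>n\<close> that contains
  the boundaries. All cocycles give the canonical truncation, the boundaries give a truncation
  without cohomology in degree \<open>n\<close>, and the preimage of a subobject of the cohomology
  keeps exactly that subobject. All three occur below.\<close>

locale truncation = abelian_category C for C :: "('o, 'm, 'z) precat_scheme" (structure) +
  fixes X :: "('o, 'm) cplx" and n :: int and m l :: 'm
  assumes X [simp]: "bounded_complex C X" and m: "mono_arr C m" "Cod C m = ob X n" "df X n \<bullet> m = Zr (Dom C m) (ob X (n + 1))"
    and l [simp]: "l \<in> Arr C" "Dom C l = ob X (n - 1)" "Cod C l = Dom C m" and ml: "m \<bullet> l = df X (n - 1)"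
begin

lemma m_arr [simp]: "m \<in> Arr C" "Cod C m = ob X n" "Dom C m \<in> Obj C"
  using m by simp_all

definition tob where "tob j = (if j < n then ob X j else if j = n then Dom C m else zero_obj C)"

definition Tr :: "('o, 'm) cplx" where
  "Tr = \<lparr>ob = tob, df = (\<lambda>j. if j < n - 1 then df X j else if j = n - 1 then l else Zr (tob j) (tob (j + 1)))\<rparr>"

definition inc where
  "inc j = (if j < n then Ident C (ob X j) else if j = n then m else Zr (zero_obj C) (ob X j))"

lemma tob_obj [simp]: "tob j \<in> Obj C"
  by (simp add: tob_def)

lemma Tr_simps: "ob Tr = tob"
  "df Tr j = (if j < n - 1 then df X j else if j = n - 1 then l else Zr (tob j) (tob (j + 1)))"
  by (simp_all add: Tr_def)

lemma l_zero:
  assumes "w \<in> Arr C" "Cod C w = ob X (n - 1)"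
  shows "l \<bullet> w = Zr (Dom C w) (Dom C m) \<longleftrightarrow> df X (n - 1) \<bullet> w = Zr (Dom C w) (ob X n)"
proof -
  have *: "df X (n - 1) \<bullet> w = m \<bullet> (l \<bullet> w)" using assoc_eq[OF ml, of w] assms by simp
  show ?thesis
  proof
    assume "l \<bullet> w = Zr (Dom C w) (Dom C m)"
    then show "df X (n - 1) \<bullet> w = Zr (Dom C w) (ob X n)" unfolding * using assms by simp
  next
    assume "df X (n - 1) \<bullet> w = Zr (Dom C w) (ob X n)"
    then show "l \<bullet> w = Zr (Dom C w) (Dom C m)" unfolding * using assms mono_zero[OF m(1), of "l \<bullet> w"] by simp
  qed
qed

lemma Tr_bounded [simp]: "bounded_complex C Tr"
proof -
  have 1: "df Tr j \<in> Hom C (ob Tr j) (ob Tr (j + 1))" for j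
    by (auto simp: Tr_simps tob_def)
  \<comment> \<open>The only new composite at the junction. It vanishes because it does so after the
    monomorphism \<open>m\<close>.\<close>
  have ll: "l \<bullet> df X (n - 2) = Zr (ob X (n - 2)) (Dom C m)"
    using l_zero[of "df X (n - 2)"] by simp
  have "df Tr (j + 1) \<bullet> df Tr j = Zr (ob Tr j) (ob Tr (j + 1 + 1))" for j
  proof -
    consider "j < n - 2" | "j = n - 2" | "j = n - 1" | "j \<ge> n" by linarith
    then show ?thesis
    proof cases
      case 1
      then have *: "ob Tr j = ob X j" "ob Tr (j + 1 + 1) = ob X (j + 1 + 1)" "df Tr j = df X j" "df Tr (j + 1) = df X (j + 1)"
        by (auto simp: Tr_simps tob_def)
      show ?thesis unfolding * using dd_zero(1)[OF X refl, of j] by blast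
    next
      case 2
      then show ?thesis using ll by (simp add: Tr_simps tob_def)
    qed (simp_all add: Tr_simps tob_def)
  qed
  moreover obtain N where N: "\<And>j. \<bar>j\<bar> > N \<Longrightarrow> is_zero C (ob X j)" using X unfolding bounded_complex_def by blast
  have "is_zero C (ob Tr j)" if "\<bar>j\<bar> > max N \<bar>n\<bar>" for j
    using that N[of j] zero_obj unfolding Tr_simps tob_def by auto
  then have "\<exists>N. \<forall>j. \<bar>j\<bar> > N \<longrightarrow> is_zero C (ob Tr j)" by blast
  ultimately show ?thesis unfolding bounded_complex_def using 1 by (simp add: Tr_simps)
qed

lemma inc_cmap: "cmap Tr X inc"
proof (rule cmapI)
  fix j
  show "inc j \<in> Arr C \<and> Dom C (inc j) = ob Tr j \<and> Cod C (inc j) = ob X j"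
    by (simp add: inc_def Tr_simps tob_def)
  consider "j < n - 1" | "j = n - 1" | "j = n" | "j > n" by linarith
  then show "df X j \<bullet> inc j = inc (j + 1) \<bullet> df Tr j"
    by cases (simp_all add: inc_def Tr_simps tob_def ml m(3))
qed simp_all

lemma inc_low: "j < n \<Longrightarrow> z \<in> Arr C \<Longrightarrow> Cod C z = ob X j \<Longrightarrow> inc j \<bullet> z = z"
  by (simp add: inc_def)

lemma Tr_cyc_low: "j < n \<Longrightarrow> cyc Tr j z \<longleftrightarrow> cyc X j z"
  unfolding cyc_def using l_zero[of z]
  by (cases "j = n - 1") (auto simp: Tr_simps tob_def)

lemma Tr_bdry_low: "j < n \<Longrightarrow> bdry Tr j z \<longleftrightarrow> bdry X j z"
  unfolding bdry_def by (simp add: Tr_simps tob_def)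

lemma Tr_cyc_top: "cyc Tr n z \<longleftrightarrow> z \<in> Arr C \<and> Cod C z = Dom C m"
  unfolding cyc_def by (auto simp: Tr_simps tob_def)

text \<open>Shrinking degree \<open>n\<close> creates and destroys no boundaries: a primitive in
  \<open>X\<close> is still one for \<open>l\<close>, because \<open>m\<close> is mono.\<close>

lemma Tr_bdry_top:
  assumes "z \<in> Arr C" "Cod C z = Dom C m"
  shows "bdry Tr n z \<longleftrightarrow> bdry X n (m \<bullet> z)"
proof
  assume "bdry Tr n z"
  then show "bdry X n (m \<bullet> z)" using cmap_bdry[OF inc_cmap, of n z] by (simp add: inc_def)
next
  assume "bdry X n (m \<bullet> z)"
  then obtain e w where e: "epi_arr C e" "Cod C e = Dom C (m \<bullet> z)" "w \<in> Arr C" "Dom C w = Dom C e"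
    "Cod C w = ob X (n - 1)" "df X (n - 1) \<bullet> w = (m \<bullet> z) \<bullet> e" by (rule bdryE)
  have ez: "Cod C e = Dom C z" using e(2) assms by simp
  have "m \<bullet> (l \<bullet> w) = m \<bullet> (z \<bullet> e)" using assoc_eq[OF ml, of w] e ez assms by simp
  then have "l \<bullet> w = z \<bullet> e" using mono_cancel[OF m(1), of "l \<bullet> w" "z \<bullet> e"] e ez assms by simp
  then show "bdry Tr n z" by (intro bdryI[of _ _ _ e w]) (use e ez assms in \<open>simp_all add: Tr_simps tob_def\<close>)
qed

lemma Tr_acyc_low: "j < n \<Longrightarrow> acyc Tr j \<longleftrightarrow> acyc X j"
  unfolding acyc_def using Tr_cyc_low Tr_bdry_low by blast

lemma Tr_acyc_high: "j > n \<Longrightarrow> acyc Tr j"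
  by (rule acyc_zero_ob) (simp_all add: Tr_simps tob_def zero_obj)

text \<open>Cycles of the truncation have the same boundaries as in \<open>X\<close> up to degree
  \<open>n\<close>, and above \<open>n\<close> there are no nonzero cycles; no assumption on the
  size of \<open>m\<close> enters.\<close>

lemma inc_hinj: "hinj Tr X inc j"
proof -
  consider "j < n" | "j = n" | "j > n" by linarith
  then show ?thesis
  proof cases
    case 1
    then show ?thesis unfolding hinj_def using Tr_cyc_low[OF 1] Tr_bdry_low[OF 1] inc_low[OF 1] cycD by metis
  next
    case 2
    then show ?thesis unfolding hinj_def using Tr_cyc_top Tr_bdry_top by (simp add: inc_def)
  next
    case 3
    then show ?thesis using Tr_acyc_high hinj_acyc by blast
  qed
qed

lemma inc_hsurj_low:
  assumes "j < n"
  shows "hsurj Tr X inc j"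
  unfolding hsurj_def
proof (intro allI impI)
  fix z assume z: "cyc X j z"
  note [simp] = cycD[OF z]
  have "bdry X j (z \<bullet> Ident C (Dom C z) \<oplus> Neg C (inc j \<bullet> z))"
    using inc_low[OF assms, of z] bdry_zero[OF X, of "Dom C z" j] by simp
  then show "\<exists>e x. epi_arr C e \<and> Cod C e = Dom C z \<and> cyc Tr j x \<and> Dom C x = Dom C e \<and>
      bdry X j (z \<bullet> e \<oplus> Neg C (inc j \<bullet> x))"
    using Tr_cyc_low[OF assms] z by (intro exI[of _ "Ident C (Dom C z)"] exI[of _ z]) simp
qed

lemma inc_qis:
  assumes "\<And>j. j > n \<Longrightarrow> acyc X j" "is_kernel C (df X n) m"
  shows "qis Tr X inc"
proof -
  have "hsurj Tr X inc n" unfolding hsurj_def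
  proof (intro allI impI)
    fix z assume z: "cyc X n z"
    note [simp] = cycD[OF z]
    obtain u where u: "u \<in> Arr C" "Dom C u = Dom C z" "Cod C u = Dom C m" "m \<bullet> u = z"
      using kernel_lift[OF assms(2), of z] by auto
    have "bdry X n (z \<bullet> Ident C (Dom C z) \<oplus> Neg C (inc n \<bullet> u))"
      using u bdry_zero[OF X, of "Dom C z" n] by (simp add: inc_def)
    then show "\<exists>e x. epi_arr C e \<and> Cod C e = Dom C z \<and> cyc Tr n x \<and> Dom C x = Dom C e \<and>
        bdry X n (z \<bullet> e \<oplus> Neg C (inc n \<bullet> x))"
      using Tr_cyc_top u by (intro exI[of _ "Ident C (Dom C z)"] exI[of _ u]) simp
  qed
  then have "hsurj Tr X inc j" for j
    using inc_hsurj_low[of j] hsurj_acyc[OF inc_cmap assms(1), of j] by (metis linorder_neqE)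
  then show ?thesis unfolding qis_def using inc_cmap inc_hinj by blast
qed

end

context abelian_category
begin

lemma coh_kernel_truncation:
  assumes "bounded_complex C X" "cohomology_at C X n k q"
  obtains l where "truncation C X n k l" "q \<bullet> l = Zr (ob X (n - 1)) (Cod C q)"
proof -
  note c = cohD[OF assms]
  obtain l where l: "l \<in> Arr C" "Dom C l = ob X (n - 1)" "Cod C l = Dom C k" "k \<bullet> l = df X (n - 1)"
    "is_cokernel C l q"
    using assms(2) unfolding cohomology_at_def Bex_def Hom_iff by blast
  have "truncation C X n k l"
    by unfold_locales (use assms(1) l(1-4) cycD[OF c(7)] is_kernelD(5)[OF c(1)] in auto)
  then show thesis using that is_cokernelD(4)[OF l(5)] l(2) by simp
qed

section \<open>Complexes concentrated in one degree and the description of slices\<close>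

lemma deg0_bounded [simp]:
  assumes "A \<in> Obj C"
  shows "bounded_complex C (deg0 C A)"
proof -
  have "\<exists>N. \<forall>j. \<bar>j\<bar> > N \<longrightarrow> is_zero C (ob (deg0 C A) j)"
    by (rule exI[of _ 0]) (simp add: deg0_def zero_obj)
  moreover have "ob (deg0 C A) j \<in> Obj C" for j using assms by (simp add: deg0_def)
  ultimately show ?thesis unfolding bounded_complex_def Hom_iff using assms by (simp add: deg0_def)
qed

lemma deg0_df: "df (deg0 C A) j = Zr (ob (deg0 C A) j) (ob (deg0 C A) (j + 1))"
  by (simp add: deg0_def)

lemma deg0_ob: "ob (deg0 C A) j = (if j = 0 then A else zero_obj C)"
  by (simp add: deg0_def)

lemma bdry_zero_df:
  assumes "bounded_complex C D" "df D (n - 1) = Zr (ob D (n - 1)) (ob D n)"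
  shows "bdry D n z \<longleftrightarrow> z \<in> Arr C \<and> Cod C z = ob D n \<and> z = Zr (Dom C z) (ob D n)"
proof
  assume b: "bdry D n z"
  note z = bdryD[OF b]
  obtain e w where e: "epi_arr C e" "Cod C e = Dom C z" "w \<in> Arr C" "Dom C w = Dom C e"
    "Cod C w = ob D (n - 1)" "df D (n - 1) \<bullet> w = z \<bullet> e" using bdryE[OF b] .
  have "z \<bullet> e = Zr (Dom C e) (Cod C z)" unfolding e(6)[symmetric] assms(2) using e(1-5) assms(1) z by simp
  then have "z = Zr (Dom C z) (ob D n)" using epi_zero[OF e(1) z(1)] e(2) z(2) by simp
  then show "z \<in> Arr C \<and> Cod C z = ob D n \<and> z = Zr (Dom C z) (ob D n)" using z by blast
next
  assume "z \<in> Arr C \<and> Cod C z = ob D n \<and> z = Zr (Dom C z) (ob D n)"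
  then show "bdry D n z" using bdry_zero[OF assms(1)] dom_obj by metis
qed

lemma deg0_acyc: "A \<in> Obj C \<Longrightarrow> j \<noteq> 0 \<Longrightarrow> acyc (deg0 C A) j"
  by (rule acyc_zero_ob) (simp_all add: deg0_ob zero_obj)

lemma deg0_coh:
  assumes "A \<in> Obj C"
  shows "coh (deg0 C A) 0 A"
proof -
  have "cohomology_at C (deg0 C A) 0 (Ident C A) (Ident C A)"
  proof (rule cohI)
    show "is_kernel C (df (deg0 C A) 0) (Ident C A)"
      by (rule is_kernelI) (use assms in \<open>auto simp: deg0_df deg0_ob iso_mono iso_arrI[of "Ident C A" "Ident C A"]\<close>)
    fix \<zeta> assume z: "\<zeta> \<in> Arr C" "Cod C \<zeta> = Dom C (Ident C A)"
    have "bdry (deg0 C A) 0 \<zeta> \<longleftrightarrow> \<zeta> = Zr (Dom C \<zeta>) A"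
      using bdry_zero_df[of "deg0 C A" 0 \<zeta>] z assms by (simp add: deg0_df deg0_ob)
    then show "Ident C A \<bullet> \<zeta> = Zr (Dom C \<zeta>) (Cod C (Ident C A)) \<longleftrightarrow> bdry (deg0 C A) 0 (Ident C A \<bullet> \<zeta>)"
      using z assms by simp
  qed (use assms in simp_all)
  then show ?thesis unfolding coh_def using assms by (metis ident_arr(3))
qed

text \<open>The roof goes through the canonical truncation: its inclusion is a quasi-isomorphism
  since \<open>X\<close> is acyclic above \<open>n\<close>, and \<open>q\<close> in degree
  \<open>n\<close> maps it onto the complex consisting of \<open>A\<close> alone.\<close>

lemma concentrated_isomorphic:
  assumes X: "bounded_complex C X" and a: "\<And>j. j \<noteq> n \<Longrightarrow> acyc X j" and A: "coh X n A"
  shows "isomorphic (Db_cat C) X (sh_cplx C (- n) (deg0 C A))"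
proof -
  obtain k q where k: "cohomology_at C X n k q" "Cod C q = A" using A unfolding coh_def by blast
  note c = cohD[OF X k(1)]
  obtain l where "truncation C X n k l" and ql: "q \<bullet> l = Zr (ob X (n - 1)) (Cod C q)"
    using coh_kernel_truncation[OF X k(1)] .
  then interpret truncation C X n k l by simp
  have [simp]: "A \<in> Obj C" "q \<in> Arr C" "Cod C q = A" "Dom C q = Dom C k" using coh_obj[OF X A] c k(2) by simp_all
  let ?D = "sh_cplx C (- n) (deg0 C A)"
  have Db [simp]: "bounded_complex C ?D" by simp
  have Do: "ob ?D j = (if j = n then A else zero_obj C)" for j by (simp add: deg0_ob)
  have Dd: "df ?D j = Zr (ob ?D j) (ob ?D (j + 1))" for j
    by (simp add: deg0_df) (simp add: algebra_simps)
  note [simp del] = sh_simps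
  define g where "g j = (if j = n then q else Zr (ob Tr j) (ob ?D j))" for j
  have g: "cmap Tr ?D g"
  proof (rule cmapI)
    fix j
    show "g j \<in> Arr C \<and> Dom C (g j) = ob Tr j \<and> Cod C (g j) = ob ?D j"
      by (simp add: g_def Do Tr_simps tob_def)
    then have gj: "g j \<in> Arr C" "Dom C (g j) = ob Tr j" "Cod C (g j) = ob ?D j" by auto
    have "df ?D j \<bullet> g j = Zr (ob Tr j) (ob ?D (j + 1))" unfolding Dd using gj by simp
    also have "\<dots> = g (j + 1) \<bullet> df Tr j"
    proof (cases "j = n - 1")
      case True
      then show ?thesis using ql by (simp add: g_def Do Tr_simps tob_def)
    next
      case False
      then have "g (j + 1) = Zr (ob Tr (j + 1)) (ob ?D (j + 1))" by (simp add: g_def)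
      then show ?thesis by simp
    qed
    finally show "df ?D j \<bullet> g j = g (j + 1) \<bullet> df Tr j" .
  qed simp_all
  have "hinj Tr ?D g j \<and> hsurj Tr ?D g j" for j
  proof (cases "j = n")
    case False
    then have "acyc Tr j" using Tr_acyc_low Tr_acyc_high a by (metis linorder_neqE)
    moreover have "acyc ?D j" by (rule acyc_zero_ob) (use False in \<open>simp_all add: Do zero_obj\<close>)
    ultimately show ?thesis using hinj_acyc hsurj_acyc[OF g] by blast
  next
    case True
    have b: "bdry ?D n z \<longleftrightarrow> z \<in> Arr C \<and> Cod C z = A \<and> z = Zr (Dom C z) A" for z
      using bdry_zero_df[of ?D n z] Dd[of "n - 1"] by (simp add: Do)
    have gn: "g n = q" by (simp add: g_def)
    have "hinj Tr ?D g n" unfolding hinj_def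
    proof (intro allI impI; elim conjE)
      fix z assume z: "cyc Tr n z" "bdry ?D n (g n \<bullet> z)"
      note z1 = z(1)[unfolded Tr_cyc_top]
      have "q \<bullet> z = Zr (Dom C (q \<bullet> z)) A" using z(2) unfolding b gn by blast
      then have "bdry X n (k \<bullet> z)" using c(8)[of z] z1 by simp
      then show "bdry Tr n z" using Tr_bdry_top z1 by blast
    qed
    moreover have "hsurj Tr ?D g n" unfolding hsurj_def
    proof (intro allI impI)
      fix z assume "cyc ?D n z"
      then have z: "z \<in> Arr C" "Cod C z = Cod C q" using cycD[of ?D n z] by (simp_all add: Do)
      obtain e x where e: "epi_arr C e" "Cod C e = Dom C z" "x \<in> Arr C" "Dom C x = Dom C e"
        "Cod C x = Dom C q" "q \<bullet> x = z \<bullet> e" using epi_lift[OF c(2) z] .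
      have "bdry ?D n (z \<bullet> e \<oplus> Neg C (g n \<bullet> x))" unfolding gn e(6) b using e(1-5) z by simp
      moreover have "cyc Tr n x" unfolding Tr_cyc_top using e by simp
      ultimately show "\<exists>e x. epi_arr C e \<and> Cod C e = Dom C z \<and> cyc Tr n x \<and> Dom C x = Dom C e \<and>
          bdry ?D n (z \<bullet> e \<oplus> Neg C (g n \<bullet> x))" using e by blast
    qed
    ultimately show ?thesis using True by blast
  qed
  then have "qis Tr ?D g" unfolding qis_def using g by blast
  then show ?thesis using isomorphicI[OF inc_qis[OF a c(1)]] by auto
qed

lemma slice_iff:
  assumes "strictly_full C P"
  shows "X \<in> shifted_slice C P i \<longleftrightarrow>
    bounded_complex C X \<and> (\<forall>j. j \<noteq> - i \<longrightarrow> acyc X j) \<and> (\<exists>A\<in>P. coh X (- i) A)"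
proof
  assume "X \<in> shifted_slice C P i"
  then obtain A where A: "A \<in> P" and iso: "isomorphic (Db_cat C) X (sh_cplx C i (deg0 C A))"
    unfolding shifted_slice_def by auto
  have AO: "A \<in> Obj C" using A assms unfolding strictly_full_def by blast
  have "coh X (- i) A" unfolding isomorphic_coh[OF iso] sh_coh[OF deg0_bounded[OF AO]] using deg0_coh[OF AO] by simp
  moreover have "acyc X j" if "j \<noteq> - i" for j
    unfolding isomorphic_acyc[OF iso] sh_acyc[OF deg0_bounded[OF AO]] using deg0_acyc[OF AO, of "j + i"] that by simp
  ultimately show "bounded_complex C X \<and> (\<forall>j. j \<noteq> - i \<longrightarrow> acyc X j) \<and> (\<exists>A\<in>P. coh X (- i) A)"
    using A isomorphic_bounded[OF iso] by blast
next
  assume a: "bounded_complex C X \<and> (\<forall>j. j \<noteq> - i \<longrightarrow> acyc X j) \<and> (\<exists>A\<in>P. coh X (- i) A)"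
  then obtain A where A: "A \<in> P" "coh X (- i) A" by blast
  have "isomorphic (Db_cat C) X (sh_cplx C (- (- i)) (deg0 C A))"
    by (rule concentrated_isomorphic[OF _ _ A(2)]) (use a in auto)
  then show "X \<in> shifted_slice C P i" unfolding shifted_slice_def using a A by auto
qed

text \<open>Adjoining zero complexes to a slice amounts to adjoining zero objects to
  \<open>P\<close>: a complex concentrated in one degree is zero exactly when its remaining
  cohomology is.\<close>

lemma slice_zeros_iff:
  assumes "strictly_full C P"
  shows "X \<in> with_zeros (Db C) (shifted_slice C P i) \<longleftrightarrow>
    bounded_complex C X \<and> (\<forall>j. j \<noteq> - i \<longrightarrow> acyc X j) \<and> (\<exists>A\<in>with_zeros C P. coh X (- i) A)"
proof
  assume "X \<in> with_zeros (Db C) (shifted_slice C P i)"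
  then consider "X \<in> shifted_slice C P i" | "is_zero (Db_cat C) X" unfolding with_zeros_def by auto
  then show "bounded_complex C X \<and> (\<forall>j. j \<noteq> - i \<longrightarrow> acyc X j) \<and> (\<exists>A\<in>with_zeros C P. coh X (- i) A)"
  proof cases
    case 1
    then show ?thesis unfolding slice_iff[OF assms] with_zeros_def by blast
  next
    case 2
    then have X: "bounded_complex C X" "\<And>j. acyc X j" using Db_zero_iff by auto
    obtain A where A: "coh X (- i) A" using coh_obtain[OF X(1)] .
    then have "is_zero C A" using acyc_coh[OF X(1) A] X(2) by blast
    then show ?thesis using X A unfolding with_zeros_def by blast
  qed
next
  assume a: "bounded_complex C X \<and> (\<forall>j. j \<noteq> - i \<longrightarrow> acyc X j) \<and> (\<exists>A\<in>with_zeros C P. coh X (- i) A)"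
  then obtain A where A: "A \<in> P \<or> is_zero C A" "coh X (- i) A" unfolding with_zeros_def by blast
  show "X \<in> with_zeros (Db C) (shifted_slice C P i)"
  proof (cases "A \<in> P")
    case True
    then show ?thesis using a A slice_iff[OF assms] unfolding with_zeros_def by blast
  next
    case False
    then have "acyc X (- i)" using A a acyc_coh by blast
    then have "is_zero (Db_cat C) X" using a Db_zero_iff by metis
    then show ?thesis unfolding with_zeros_def by simp
  qed
qed

text \<open>On cocycles in degree \<open>n\<close> a right leg takes values in boundaries. It
  therefore maps the canonical truncation of its source into the truncation of \<open>Y\<close> at
  the boundaries, which is acyclic: below \<open>n\<close> by hypothesis, in degree \<open>n\<close>
  by construction.\<close>

lemma hom_vanishing:
  assumes X: "bounded_complex C X" and Y: "bounded_complex C Y"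
    and aX: "\<And>j. j > n \<Longrightarrow> acyc X j" and aY: "\<And>j. j < n \<Longrightarrow> acyc Y j"
    and H: "\<And>A B. coh X n A \<Longrightarrow> coh Y n B \<Longrightarrow> Hom C A B = {Zr A B}"
  shows "Hom (Db_cat C) X Y = {loc C X Y (ch_zero C X Y)}"
proof (rule hom_zero[OF X Y])
  fix Z s f assume s: "qis Z X s" and f: "cmap Z Y f"
  have Z: "bounded_complex C Z" and ch: "chain_map C Z Y f" using f unfolding cmap_def by auto
  have aZ: "\<And>j. j > n \<Longrightarrow> acyc Z j" using aX qis_acyc[OF s] by blast
  obtain k q where k: "cohomology_at C Z n k q" using cohomology_exists[OF Z] .
  obtain k' q' where k': "cohomology_at C Y n k' q'" using cohomology_exists[OF Y] .
  note c = cohD[OF Z k] note c' = cohD[OF Y k']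
  obtain l where "truncation C Z n k l" using coh_kernel_truncation[OF Z k] .
  then interpret W: truncation C Z n k l .
  note t = W.inc_qis[OF aZ c(1)]
  obtain \<kappa> \<eta> where h: "cohmap f n k q k' q' \<kappa> \<eta>" using cohmap_exists[OF Z Y ch k k'] by blast
  have "coh X n (Cod C q)" using k qis_coh[OF s] unfolding coh_def by blast
  moreover have "coh Y n (Cod C q')" using k' unfolding coh_def by blast
  ultimately have "\<eta> = Zr (Cod C q) (Cod C q')" using H h unfolding cohmap_def by blast
  \<comment> \<open>The vanishing of \<eta> is evaluated on the universal cycle.\<close>
  then have "bdry Y n (f n \<bullet> (k \<bullet> Ident C (Dom C k)))"
    using cohmap_zero(1)[OF Z Y ch k k' h, of "Ident C (Dom C k)"] c(3-5) c'(5) by simp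
  then have fk: "bdry Y n (f n \<bullet> k)" using c(4) by simp
  note [simp] = Y cmapD[OF f]
  \<comment> \<open>The kernel \<open>m\<close> of the cokernel of the incoming differential is its
    image, that is, the subobject of boundaries.\<close>
  obtain co where co: "is_cokernel C (df Y (n - 1)) co" using cokernel_exists[of "df Y (n - 1)"] by auto
  note coD = is_cokernelD[OF co]
  have [simp]: "co \<in> Arr C" "Dom C co = ob Y n" using coD by simp_all
  obtain m where m: "is_kernel C co m" using kernel_exists[of co] by auto
  note mD = is_kernelD[OF m]
  have [simp]: "m \<in> Arr C" "Cod C m = ob Y n" using mD by simp_all
  have co_bdry: "bdry Y n z \<longleftrightarrow> co \<bullet> z = Zr (Dom C z) (Cod C co)" if z: "z \<in> Arr C" "Cod C z = ob Y n" for z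
  proof
    assume "bdry Y n z"
    then obtain e w where e: "epi_arr C e" "Cod C e = Dom C z" "w \<in> Arr C" "Dom C w = Dom C e"
      "Cod C w = ob Y (n - 1)" "df Y (n - 1) \<bullet> w = z \<bullet> e" by (rule bdryE)
    have "(co \<bullet> z) \<bullet> e = co \<bullet> (df Y (n - 1) \<bullet> w)" using e z by simp
    also have "\<dots> = Zr (Dom C e) (Cod C co)" using e(3-5) by (simp add: assoc_eq[OF coD(4)])
    finally show "co \<bullet> z = Zr (Dom C z) (Cod C co)" using epi_zero[OF e(1), of "co \<bullet> z"] e(2) z by simp
  next
    assume "co \<bullet> z = Zr (Dom C z) (Cod C co)"
    then obtain e y where "epi_arr C e" "Cod C e = Dom C z" "y \<in> Arr C" "Dom C y = Dom C e"
      "Cod C y = Dom C (df Y (n - 1))" "df Y (n - 1) \<bullet> y = z \<bullet> e" using cokernel_exact[OF co, of z] z by auto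
    then show "bdry Y n z" by (intro bdryI[of _ _ _ e y]) (use z in simp_all)
  qed
  obtain l' where l': "l' \<in> Arr C" "Dom C l' = ob Y (n - 1)" "Cod C l' = Dom C m" "m \<bullet> l' = df Y (n - 1)"
    using kernel_lift[OF m, of "df Y (n - 1)"] coD(4) by auto
  obtain d' where d': "d' \<in> Arr C" "Dom C d' = Cod C co" "Cod C d' = ob Y (n + 1)" "d' \<bullet> co = df Y n"
    using cokernel_desc[OF co, of "df Y n"] by auto
  have "df Y n \<bullet> m = d' \<bullet> (co \<bullet> m)" using assoc_eq[OF d'(4), of m] d'(1-3) by simp
  also have "\<dots> = Zr (Dom C m) (ob Y (n + 1))" unfolding mD(4) using d'(1-3) by simp
  finally have "truncation C Y n m l'" by unfold_locales (use l' mD(5) in simp_all)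
  then interpret E: truncation C Y n m l' .
  have aE: "acyc E.Tr j" for j
  proof -
    consider "j < n" | "j = n" | "j > n" by linarith
    then show ?thesis
    proof cases
      case 2
      have "bdry E.Tr n z" if z: "cyc E.Tr n z" for z
      proof -
        have z': "z \<in> Arr C" "Cod C z = Dom C m" using z E.Tr_cyc_top by auto
        have "co \<bullet> (m \<bullet> z) = Zr (Dom C z) (Cod C co)" using z' by (simp add: assoc_eq[OF mD(4)])
        then show ?thesis using E.Tr_bdry_top co_bdry[of "m \<bullet> z"] z' by simp
      qed
      then show ?thesis unfolding acyc_def 2 by blast
    qed (use E.Tr_acyc_low aY E.Tr_acyc_high in blast)+
  qed
  have fkZ: "co \<bullet> (f n \<bullet> k) = Zr (Dom C k) (Cod C co)" using co_bdry[of "f n \<bullet> k"] fk by simp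
  \<comment> \<open>The top component of the restricted map, from all cocycles of \<open>Z\<close>
    to the boundaries of \<open>Y\<close>.\<close>
  then obtain \<psi> where \<psi>: "\<psi> \<in> Arr C" "Dom C \<psi> = Dom C k" "Cod C \<psi> = Dom C m" "m \<bullet> \<psi> = f n \<bullet> k"
    using kernel_lift[OF m, of "f n \<bullet> k"] by auto
  define \<phi> where "\<phi> j = (if j < n then f j else if j = n then \<psi> else Zr (zero_obj C) (zero_obj C))" for j
  have \<phi>: "cmap W.Tr E.Tr \<phi>"
  proof (rule cmapI)
    fix j
    show "\<phi> j \<in> Arr C \<and> Dom C (\<phi> j) = ob W.Tr j \<and> Cod C (\<phi> j) = ob E.Tr j"
      using \<psi> by (simp add: \<phi>_def W.Tr_simps E.Tr_simps W.tob_def E.tob_def)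
    consider "j < n - 1" | "j = n - 1" | "j \<ge> n" by linarith
    then show "df E.Tr j \<bullet> \<phi> j = \<phi> (j + 1) \<bullet> df W.Tr j"
    proof cases
      case 1
      then show ?thesis by (simp add: \<phi>_def W.Tr_simps E.Tr_simps)
    next
      case 2
      have "m \<bullet> (l' \<bullet> f (n - 1)) = f n \<bullet> (k \<bullet> l)"
        unfolding W.ml using assoc_eq[OF l'(4), of "f (n - 1)"] l'(1-3) by simp
      also have "\<dots> = m \<bullet> (\<psi> \<bullet> l)" using assoc_eq[OF \<psi>(4), of l] \<psi>(1-3) by simp
      finally have "l' \<bullet> f (n - 1) = \<psi> \<bullet> l"
        using mono_cancel[OF mD(5), of "l' \<bullet> f (n - 1)" "\<psi> \<bullet> l"] l' \<psi>(1-3) by simp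
      then show ?thesis using 2 by (simp add: \<phi>_def W.Tr_simps E.Tr_simps)
    next
      case 3
      then show ?thesis using \<psi> by (simp add: \<phi>_def W.Tr_simps E.Tr_simps W.tob_def E.tob_def)
    qed
  qed simp_all
  have eq: "E.inc \<odot> \<phi> = f \<odot> W.inc"
  proof
    fix j
    consider "j < n" | "j = n" | "j > n" by linarith
    then show "(E.inc \<odot> \<phi>) j = (f \<odot> W.inc) j"
      by cases (simp_all add: ch_comp_def \<phi>_def E.inc_def W.inc_def \<psi>)
  qed
  obtain U p where p: "qis U W.Tr p" "hty U E.Tr (\<phi> \<odot> p) (ch_zero C U E.Tr)" using kill_acyclic[OF \<phi> aE] .
  note cp = qisD(1)[OF p(1)]
  have U: "bounded_complex C U" using cp unfolding cmap_def by blast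
  have "hty U Y (E.inc \<odot> \<phi> \<odot> p) (E.inc \<odot> ch_zero C U E.Tr)" by (rule hty_comp_left[OF p(2) E.inc_cmap])
  moreover have "E.inc \<odot> \<phi> \<odot> p = f \<odot> W.inc \<odot> p"
    using chcomp_assoc[OF cp \<phi> E.inc_cmap] chcomp_assoc[OF cp W.inc_cmap f] eq by simp
  ultimately have "hty U Y (f \<odot> W.inc \<odot> p) (ch_zero C U Y)" using chcomp_zero(1)[OF E.inc_cmap U] by simp
  then show "\<exists>U p. qis U Z p \<and> hty U Y (f \<odot> p) (ch_zero C U Y)" using qis_comp[OF p(1) t] by blast
qed

end

section \<open>Fragments of the long exact cohomology sequence of a cone\<close>

context cone
begin

lemma mid_exact:
  assumes "cyc Y n y" "bdry K n (i2 n \<bullet> y)"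
  obtains e x where "epi_arr C e" "Cod C e = Dom C y" "cyc X n x" "Dom C x = Dom C e"
    "bdry Y n (y \<bullet> e \<oplus> Neg C (f n \<bullet> x))"
proof -
  note [simp] = cycD[OF assms(1)]
  obtain e a b where e: "epi_arr C e" "Cod C e = Dom C (i2 n \<bullet> y)"
    "a \<in> Arr C" "Dom C a = Dom C e" "Cod C a = ob X n" "b \<in> Arr C" "Dom C b = Dom C e" "Cod C b = ob Y (n - 1)"
    "Neg C (df X n \<bullet> a) = p1 n \<bullet> ((i2 n \<bullet> y) \<bullet> e)" "f n \<bullet> a \<oplus> df Y (n - 1) \<bullet> b = p2 n \<bullet> ((i2 n \<bullet> y) \<bullet> e)"
    using K_bdryE[OF assms(2)] .
  note [simp] = e(1,3-8)
  have [simp]: "Cod C e = Dom C y" using e(2) by simp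
  have "cyc X n a" unfolding cyc_def using e(9) by simp
  moreover have "y \<bullet> e \<oplus> Neg C (f n \<bullet> a) = df Y (n - 1) \<bullet> b"
    using e(10) add_eq_iff[of "f n \<bullet> a" "df Y (n - 1) \<bullet> b" "y \<bullet> e"] by simp
  then have "bdry Y n (y \<bullet> e \<oplus> Neg C (f n \<bullet> a))" using bdry_d[of Y b n] by simp
  ultimately show thesis using that[of e a] e(1,4) by simp
qed

lemma Y_acyc:
  assumes "acyc X n" "acyc K n"
  shows "acyc Y n"
  unfolding acyc_def
proof (intro allI impI)
  fix y assume y: "cyc Y n y"
  have "bdry K n (i2 n \<bullet> y)" using cmap_cyc[OF i2_cmap y] assms(2) unfolding acyc_def by blast
  then obtain e x where e: "epi_arr C e" "Cod C e = Dom C y" "cyc X n x" "Dom C x = Dom C e"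
    "bdry Y n (y \<bullet> e \<oplus> Neg C (f n \<bullet> x))" using mid_exact[OF y] by blast
  have "bdry Y n (f n \<bullet> x)" using cmap_bdry[OF cm] e(3) assms(1) unfolding acyc_def by blast
  then have ye: "bdry Y n (y \<bullet> e)" using bdry_eq[OF _ e(5)] e cycD[OF y] cycD[OF e(3)] by simp
  show "bdry Y n y" by (rule bdry_descend[OF _ ye e(1)]) (use e(2) cycD[OF y] in simp_all)
qed

text \<open>If \<open>f z\<close> has a primitive \<open>y\<close>, then \<open>(z, - y)\<close> is
  a cycle of the cone one degree lower. A primitive of it has, up to sign, a primitive of
  \<open>z\<close> as first coordinate.\<close>

lemma f_hinj:
  assumes "acyc K (n - 1)"
  shows "hinj X Y f n"
  unfolding hinj_def
proof (intro allI impI; elim conjE)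
  fix z assume z: "cyc X n z" "bdry Y n (f n \<bullet> z)"
  note [simp] = cycD[OF z(1)]
  obtain e y where e: "epi_arr C e" "Cod C e = Dom C (f n \<bullet> z)" "y \<in> Arr C" "Dom C y = Dom C e"
    "Cod C y = ob Y (n - 1)" "df Y (n - 1) \<bullet> y = (f n \<bullet> z) \<bullet> e" using bdryE[OF z(2)] .
  note [simp] = e(1,3-5)
  have [simp]: "Cod C e = Dom C z" using e(2) by simp
  let ?\<kappa> = "i1 (n - 1) \<bullet> (z \<bullet> e) \<oplus> Neg C (i2 (n - 1) \<bullet> y)"
  have "cyc K (n - 1) ?\<kappa>" unfolding K_cyc by (simp add: cyc_comp[OF _ z(1)] e(6))
  then have "bdry K (n - 1) ?\<kappa>" using assms unfolding acyc_def by blast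
  then obtain e' a b where e': "epi_arr C e'" "Cod C e' = Dom C ?\<kappa>"
    "a \<in> Arr C" "Dom C a = Dom C e'" "Cod C a = ob X (n - 1)"
    "Neg C (df X (n - 1) \<bullet> a) = p1 (n - 1) \<bullet> (?\<kappa> \<bullet> e')" by (rule K_bdryE)
  note [simp] = e'(1,3-5)
  have [simp]: "Cod C e' = Dom C e" using e'(2) by simp
  show "bdry X n z"
    by (rule bdryI[of _ _ _ "e \<bullet> e'" "Neg C a"]) (use e'(6) epi_comp[OF e'(1) e(1)] in simp_all)
qed

text \<open>If the first coordinate of a cycle of the cone has a primitive \<open>w\<close>, the
  cycle differs by the boundary of \<open>(- w, 0)\<close> from one that comes from
  \<open>Y\<close>.\<close>

lemma i2_hsurj:
  assumes "acyc X (n + 1)"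
  shows "hsurj Y K i2 n"
  unfolding hsurj_def
proof (intro allI impI)
  fix z assume z: "cyc K n z"
  note [simp] = cycD(1,2)[OF z]
  have "bdry X (n + 1) (p1 n \<bullet> z)" using z assms unfolding K_cyc acyc_def by blast
  then obtain e w where e: "epi_arr C e" "Cod C e = Dom C (p1 n \<bullet> z)" "w \<in> Arr C" "Dom C w = Dom C e"
    "Cod C w = ob X (n + 1 - 1)" "df X (n + 1 - 1) \<bullet> w = (p1 n \<bullet> z) \<bullet> e" by (rule bdryE)
  note [simp] = e(1,3,4)
  have e2 [simp]: "Cod C e = Dom C z" "Cod C w = ob X n" and w: "df X n \<bullet> w = p1 n \<bullet> (z \<bullet> e)" using e by simp_all
  let ?y = "p2 n \<bullet> (z \<bullet> e) \<oplus> f n \<bullet> w"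
  have y: "cyc Y n ?y" using K_bdry(1)[OF z e(1) e2(1) e(3,4) e2(2) w] .
  have "bdry K n (z \<bullet> e \<oplus> Neg C (i2 n \<bullet> ?y))"
  proof (rule K_bdryI[of _ n "Ident C (Dom C e)" "Neg C w" "Zr (Dom C e) (ob Y (n - 1))"])
    show "f n \<bullet> Neg C w \<oplus> df Y (n - 1) \<bullet> Zr (Dom C e) (ob Y (n - 1)) =
        p2 n \<bullet> ((z \<bullet> e \<oplus> Neg C (i2 n \<bullet> ?y)) \<bullet> Ident C (Dom C e))" by (simp add: add_ac)
  qed (simp_all add: w)
  then show "\<exists>e x. epi_arr C e \<and> Cod C e = Dom C z \<and> cyc Y n x \<and> Dom C x = Dom C e \<and>
      bdry K n (z \<bullet> e \<oplus> Neg C (i2 n \<bullet> x))"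
    using y by (intro exI[of _ e] exI[of _ ?y]) simp
qed

lemma i2_f_bdry:
  assumes "cyc X n z"
  shows "bdry K n (i2 n \<bullet> (f n \<bullet> z))"
  by (rule K_bdryI[of _ n "Ident C (Dom C z)" z "Zr (Dom C z) (ob Y (n - 1))"]) (use cycD[OF assms] in simp_all)

lemma cohomology_short_exact:
  assumes a: "acyc X (n + 1)" "acyc K (n - 1)" and A: "coh X n A" and B: "coh K n B"
  obtains i p where "short_exact C i p" "Dom C i = A" "Cod C p = B" "coh Y n (Cod C i)"
proof -
  note b = f_simps(1,2) K_bounded
  have ch: "chain_map C X Y f" "chain_map C Y K i2" using cm i2_cmap unfolding cmap_def by auto
  obtain k1 q1 where k1: "cohomology_at C X n k1 q1" "Cod C q1 = A" using A unfolding coh_def by blast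
  obtain k2 q2 where k2: "cohomology_at C Y n k2 q2" using cohomology_exists[OF b(2)] .
  obtain k3 q3 where k3: "cohomology_at C K n k3 q3" "Cod C q3 = B" using B unfolding coh_def by blast
  note c1 = cohD[OF b(1) k1(1)] note c2 = cohD[OF b(2) k2] note c3 = cohD[OF b(3) k3(1)]
  obtain \<kappa> \<eta> where h: "cohmap f n k1 q1 k2 q2 \<kappa> \<eta>" using cohmap_exists[OF b(1,2) ch(1) k1(1) k2] by blast
  obtain \<kappa>' \<theta> where h': "cohmap i2 n k2 q2 k3 q3 \<kappa>' \<theta>" using cohmap_exists[OF b(2,3) ch(2) k2 k3(1)] by blast
  note z = cohmap_zero[OF b(1,2) ch(1) k1(1) k2 h] note z' = cohmap_zero[OF b(2,3) ch(2) k2 k3(1) h']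
  have [simp]: "\<eta> \<in> Arr C" "Dom C \<eta> = Cod C q1" "Cod C \<eta> = Cod C q2" "\<kappa> \<in> Arr C" "Dom C \<kappa> = Dom C k1" "Cod C \<kappa> = Dom C k2"
    "\<theta> \<in> Arr C" "Dom C \<theta> = Cod C q2" "Cod C \<theta> = Cod C q3"
    using h h' unfolding cohmap_def Hom_iff by auto
  note [simp] = c1(3-6) c2(3-6) c3(3-6)
  have m: "mono_arr C \<eta>" using cohmap_mono[OF b(1,2) ch(1) k1(1) k2 h] f_hinj[OF a(2)] by blast
  have e: "epi_arr C \<theta>" using cohmap_epi[OF b(2,3) ch(2) k2 k3(1) h'] i2_hsurj[OF a(1)] by blast
  have "short_exact C \<eta> \<theta>"
  proof (rule short_exactI[OF m e])
    let ?i = "Ident C (Dom C k1)"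
    \<comment> \<open>The composite of the two maps on cohomology is tested on the universal cycle
      of \<open>X\<close>.\<close>
    have "bdry K n (i2 n \<bullet> (k2 \<bullet> (\<kappa> \<bullet> ?i)))"
      using i2_f_bdry[OF c1(7)] z(3)[of ?i] by simp
    then have "\<theta> \<bullet> (\<eta> \<bullet> (q1 \<bullet> ?i)) = Zr (Dom C k1) (Cod C q3)"
      using z(2)[of ?i] z'(1)[of "\<kappa> \<bullet> ?i"] by simp
    then have "(\<theta> \<bullet> \<eta>) \<bullet> q1 = Zr (Dom C q1) (Cod C q3)" by simp
    then show "\<theta> \<bullet> \<eta> = Zr (Dom C \<eta>) (Cod C \<theta>)" using epi_zero[OF c1(2), of "\<theta> \<bullet> \<eta>"] by simp
    fix t assume t: "t \<in> Arr C" "Cod C t = Dom C \<theta>" "\<theta> \<bullet> t = Zr (Dom C t) (Cod C \<theta>)"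
    obtain e \<zeta> where e: "epi_arr C e" "Cod C e = Dom C t" "\<zeta> \<in> Arr C" "Dom C \<zeta> = Dom C e"
      "Cod C \<zeta> = Dom C q2" "q2 \<bullet> \<zeta> = t \<bullet> e" using epi_lift[OF c2(2) t(1)] t(2) by auto
    note [simp] = t(1,2) e(1-4)
    have \<zeta> [simp]: "Cod C \<zeta> = Dom C k2" using e(5) by simp
    have "\<theta> \<bullet> (q2 \<bullet> \<zeta>) = Zr (Dom C \<zeta>) (Cod C q3)" unfolding e(6) by (simp add: assoc_eq[OF t(3)])
    \<comment> \<open>The element \<open>t\<close> is represented by a cycle of \<open>Y\<close>
      that dies in the cone, so exactness at \<open>Y\<close> applies.\<close>
    then have "bdry K n (i2 n \<bullet> (k2 \<bullet> \<zeta>))" using z'(1)[of \<zeta>] by simp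
    moreover have "cyc Y n (k2 \<bullet> \<zeta>)" by (rule cyc_comp[OF _ c2(7)]) simp_all
    ultimately obtain e' x where e': "epi_arr C e'" "Cod C e' = Dom C (k2 \<bullet> \<zeta>)" "cyc X n x" "Dom C x = Dom C e'"
      "bdry Y n ((k2 \<bullet> \<zeta>) \<bullet> e' \<oplus> Neg C (f n \<bullet> x))" using mid_exact by blast
    obtain \<xi> where \<xi>: "\<xi> \<in> Arr C" "Dom C \<xi> = Dom C x" "Cod C \<xi> = Dom C k1" "k1 \<bullet> \<xi> = x"
      using cyc_factor[OF b(1) k1(1) e'(3)] .
    note [simp] = e'(1,4) \<xi>(1-3)
    have [simp]: "Cod C e' = Dom C e" using e'(2) by simp
    have "(k2 \<bullet> \<zeta>) \<bullet> e' \<oplus> Neg C (f n \<bullet> x) = k2 \<bullet> (\<zeta> \<bullet> e' \<oplus> Neg C (\<kappa> \<bullet> \<xi>))"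
      unfolding \<xi>(4)[symmetric] using z(3)[of \<xi>] by simp
    then have "q2 \<bullet> (\<zeta> \<bullet> e' \<oplus> Neg C (\<kappa> \<bullet> \<xi>)) = Zr (Dom C e') (Cod C q2)"
      using c2(8)[of "\<zeta> \<bullet> e' \<oplus> Neg C (\<kappa> \<bullet> \<xi>)"] e'(5) by simp
    then have "q2 \<bullet> (\<zeta> \<bullet> e') = q2 \<bullet> (\<kappa> \<bullet> \<xi>)"
      using eq_neg_iff(1)[of "q2 \<bullet> (\<zeta> \<bullet> e')" "q2 \<bullet> (\<kappa> \<bullet> \<xi>)"] by simp
    then have "\<eta> \<bullet> (q1 \<bullet> \<xi>) = t \<bullet> (e \<bullet> e')" using z(2)[of \<xi>] by (simp add: assoc_eq[OF e(6)])
    then show "\<exists>e y. epi_arr C e \<and> Cod C e = Dom C t \<and> y \<in> Arr C \<and> Dom C y = Dom C e \<and> Cod C y = Dom C \<eta> \<and> \<eta> \<bullet> y = t \<bullet> e"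
      using epi_comp[OF e'(1) e(1)] by (intro exI[of _ "e \<bullet> e'"] exI[of _ "q1 \<bullet> \<xi>"]) simp
  qed simp_all
  then show thesis using that[of \<eta> \<theta>] k1(2) k2 k3(2) unfolding coh_def by auto
qed

end

section \<open>Extension-closed slices and filtrations\<close>

context abelian_category
begin

lemma strictly_full_zeros:
  assumes "strictly_full C P" "A \<in> with_zeros C P" "isomorphic C A B"
  shows "B \<in> with_zeros C P"
  using assms is_zero_isomorphic isomorphic_obj unfolding strictly_full_def with_zeros_def by blast

text \<open>When an end of the sequence is an adjoined zero object, extension-closedness of
  \<open>P\<close> says nothing. The middle term is then isomorphic to the other end.\<close>

lemma extension_closed_zeros:
  assumes P: "strictly_full C P" "extension_closed C P"
    and s: "short_exact C i p" "Dom C i \<in> with_zeros C P" "Cod C p \<in> with_zeros C P"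
  shows "Cod C i \<in> with_zeros C P"
proof -
  have k: "is_kernel C p i" and c: "is_cokernel C i p" using s(1) unfolding short_exact_def by auto
  note kD = is_kernelD[OF k] note cD = is_cokernelD[OF c]
  note [simp] = kD(1-3)
  consider "Dom C i \<in> P" "Cod C p \<in> P" | "is_zero C (Dom C i)" | "is_zero C (Cod C p)"
    using s(2,3) unfolding with_zeros_def by blast
  then show ?thesis
  proof cases
    case 1
    then show ?thesis using P(2) s(1) unfolding extension_closed_def with_zeros_def by blast
  next
    case 2
    have "mono_arr C p" unfolding mono_iff
    proof (intro conjI ballI impI kD(1))
      fix t assume t: "t \<in> Arr C" "Cod C t = Dom C p" "p \<bullet> t = Zr (Dom C t) (Cod C p)"
      obtain u where u: "u \<in> Arr C" "Dom C u = Dom C t" "Cod C u = Dom C i" "i \<bullet> u = t" using kernel_lift[OF k t] .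
      have u0: "u = Zr (Dom C t) (Dom C i)" using zero_obj_arr(2)[OF 2 u(1,3)] unfolding u(2) .
      have "i \<bullet> u = Zr (Dom C t) (Dom C p)" unfolding u0 using t(1) by simp
      then show "t = Zr (Dom C t) (Dom C p)" unfolding u(4) .
    qed
    then have "iso_arr C p" using iso_if_mono_epi cD(5) by blast
    then have "isomorphic C (Cod C p) (Cod C i)"
      using isomorphic_sym unfolding isomorphic_iff by (metis kD(3))
    then show ?thesis using strictly_full_zeros[OF P(1) s(3)] by blast
  next
    case 3
    let ?I = "Ident C (Dom C p)"
    have "p \<bullet> ?I = Zr (Dom C ?I) (Cod C p)" using zero_obj_arr(2)[OF 3 kD(1)] by simp
    then obtain u where u: "u \<in> Arr C" "Dom C u = Dom C p" "Cod C u = Dom C i" "i \<bullet> u = ?I"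
      using kernel_lift[OF k, of ?I] by auto
    have "epi_arr C (i \<bullet> u)" unfolding u(4) by simp
    then have "epi_arr C i" by (rule epi_right_factor) (use u in simp_all)
    then have "iso_arr C i" using iso_if_mono_epi kD(5) by blast
    then show ?thesis using strictly_full_zeros[OF P(1) s(2)] unfolding isomorphic_iff by blast
  qed
qed

lemma slice_extension_closed:
  assumes P: "strictly_full C P" "extension_closed C P"
  shows "tri_extension_closed (Db C) (with_zeros (Db C) (shifted_slice C P i))"
  unfolding tri_extension_closed_def
proof (intro allI impI; elim conjE)
  fix X Y Z u v w
  assume t: "triangle (Db C) X Y Z u v w"
    and X: "X \<in> with_zeros (Db C) (shifted_slice C P i)" and Z: "Z \<in> with_zeros (Db C) (shifted_slice C P i)"
  obtain X' Y' K f i1 i2 p1 p2 where c: "cone C X' Y' K f i1 i2 p1 p2"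
    and iso: "isomorphic (Db_cat C) X X'" "isomorphic (Db_cat C) Y Y'" "isomorphic (Db_cat C) Z K"
    using triangle_cone[OF t] .
  interpret cone C X' Y' K f i1 i2 p1 p2 by fact
  have X': "\<And>j. j \<noteq> - i \<Longrightarrow> acyc X' j" and K: "\<And>j. j \<noteq> - i \<Longrightarrow> acyc K j"
    using X Z unfolding slice_zeros_iff[OF P(1)] isomorphic_acyc[OF iso(1)] isomorphic_acyc[OF iso(3)] by auto
  obtain A where A: "A \<in> with_zeros C P" "coh X' (- i) A"
    using X unfolding slice_zeros_iff[OF P(1)] isomorphic_coh[OF iso(1)] by blast
  obtain B where B: "B \<in> with_zeros C P" "coh K (- i) B"
    using Z unfolding slice_zeros_iff[OF P(1)] isomorphic_coh[OF iso(3)] by blast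
  have "acyc X' (- i + 1)" "acyc K (- i - 1)" using X' K by simp_all
  then obtain j p where jp: "short_exact C j p" "Dom C j = A" "Cod C p = B" "coh Y' (- i) (Cod C j)"
    using cohomology_short_exact[OF _ _ A(2) B(2)] by blast
  have "Cod C j \<in> with_zeros C P" using extension_closed_zeros[OF P jp(1)] jp(2,3) A(1) B(1) by simp
  moreover have "coh Y (- i) (Cod C j)" unfolding isomorphic_coh[OF iso(2)] by (rule jp(4))
  moreover have "acyc Y j" if "j \<noteq> - i" for j
    unfolding isomorphic_acyc[OF iso(2)] using Y_acyc X' K that by blast
  ultimately show "Y \<in> with_zeros (Db C) (shifted_slice C P i)"
    unfolding slice_zeros_iff[OF P(1)] using isomorphic_bounded[OF iso(2)] by blast
qed

text \<open>Splitting off a quotient \<open>G\<close> of the top cohomology: replace \<open>X\<close> in degree \<open>n\<close> by the kernel of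
  the composite of the cocycles onto \<open>G\<close>, and by zero above; the cone of the inclusion has cohomology
  \<open>G\<close> in degree \<open>n\<close> only.\<close>

lemma peel_top_cohomology:
  assumes X: "bounded_complex C X" and a: "\<And>j. j > n \<Longrightarrow> acyc X j" and B: "coh X n B"
    and s: "short_exact C i p" "Cod C i = B"
  obtains X' K u v w where "triangle (Db C) X' X K u v w" "bounded_complex C X'" "bounded_complex C K"
    "\<And>j. j > n \<Longrightarrow> acyc X' j" "\<And>j. j < n \<Longrightarrow> acyc X j \<Longrightarrow> acyc X' j" "coh X' n (Dom C i)"
    "\<And>j. j \<noteq> n \<Longrightarrow> acyc K j" "coh K n (Cod C p)"
proof -
  have ki: "is_kernel C p i" and cp: "is_cokernel C i p" using s(1) unfolding short_exact_def by auto
  note iD = is_kernelD[OF ki] note pD = is_cokernelD[OF cp]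
  obtain k q where k: "cohomology_at C X n k q" "Cod C q = B" using B unfolding coh_def by blast
  note c = cohD[OF X k(1)]
  obtain l0 where l0: "truncation C X n k l0" "q \<bullet> l0 = Zr (ob X (n - 1)) (Cod C q)"
    using coh_kernel_truncation[OF X k(1)] .
  interpret T: truncation C X n k l0 by (rule l0(1))
  have [simp]: "i \<in> Arr C" "p \<in> Arr C" "Cod C i = B" "Dom C p = B" "q \<in> Arr C" "Cod C q = B" "Dom C q = Dom C k"
    "k \<in> Arr C" "Cod C k = ob X n"
    using iD pD c k(2) s(2) by simp_all
  have [simp]: "B \<in> Obj C" using cod_obj[of q] by simp
  \<comment> \<open>The map from the cocycles in degree \<open>n\<close> onto the quotient; its
    kernel consists of the cocycles whose class lies in the subobject \<open>i\<close>.\<close>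
  define r where "r = p \<bullet> q"
  have r [simp]: "r \<in> Arr C" "Dom C r = Dom C k" "Cod C r = Cod C p" by (simp_all add: r_def)
  obtain m' where m': "is_kernel C r m'" using kernel_exists[of r] by auto
  note mD = is_kernelD[OF m']
  have [simp]: "m' \<in> Arr C" "Cod C m' = Dom C k" using mD by simp_all
  have "r \<bullet> l0 = p \<bullet> Zr (ob X (n - 1)) B" using l0(2) by (simp add: r_def)
  also have "\<dots> = Zr (ob X (n - 1)) (Cod C p)" using X by simp
  finally have rl: "r \<bullet> l0 = Zr (ob X (n - 1)) (Cod C p)" .
  then obtain l where l: "l \<in> Arr C" "Dom C l = ob X (n - 1)" "Cod C l = Dom C m'" "m' \<bullet> l = l0"
    using kernel_lift[OF m', of l0] by auto
  note [simp] = l(1-3)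
  let ?m = "k \<bullet> m'"
  have "mono_arr C ?m" using mono_comp[OF mD(5) T.m(1)] by simp
  moreover have "df X n \<bullet> ?m = Zr (Dom C ?m) (ob X (n + 1))" using X by (simp add: assoc_eq[OF T.m(3)])
  moreover have "?m \<bullet> l = df X (n - 1)" using T.ml l(4) by simp
  ultimately have "truncation C X n ?m l" by unfold_locales (use X in simp_all)
  then interpret W: truncation C X n ?m l .
  obtain K i1 i2 p1 p2 where "cone C W.Tr X K W.inc i1 i2 p1 p2" using cone_exists[OF W.inc_cmap] .
  then interpret K: cone C W.Tr X K W.inc i1 i2 p1 p2 .
  obtain u v w where tri: "triangle (Db C) W.Tr X K u v w" using cone_triangle[OF K.cone_axioms] by blast
  \<comment> \<open>The inclusion is injective on cohomology in every degree. Away from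
    \<open>n\<close> it is also surjective: below \<open>n\<close> nothing was changed, above
    \<open>n\<close> the target is acyclic.\<close>
  have aK: "acyc K j" if "j \<noteq> n" for j
  proof (rule K.K_acyc[OF W.inc_hinj])
    show "hsurj W.Tr X W.inc j" using that W.inc_hsurj_low hsurj_acyc[OF W.inc_cmap] a by (metis linorder_neqE)
  qed
  have pq0: "p \<bullet> (q \<bullet> m') = Zr (Dom C m') (Cod C p)" using mD(4) unfolding r_def by simp
  \<comment> \<open>The class map restricted to the smaller cocycles lands in the subobject. It
    remains epi, since elements of the subobject lift locally along \<open>q\<close> to cocycles
    that \<open>r\<close> kills.\<close>
  obtain q' where q': "q' \<in> Arr C" "Dom C q' = Dom C m'" "Cod C q' = Dom C i" "i \<bullet> q' = q \<bullet> m'"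
    using kernel_lift[OF ki, of "q \<bullet> m'"] pq0 by auto
  note [simp] = q'(1-3)
  have q'e: "epi_arr C q'"
  proof -
    obtain e x where e: "epi_arr C e" "Cod C e = Dom C i" "x \<in> Arr C" "Dom C x = Dom C e"
      "Cod C x = Dom C q" "q \<bullet> x = i \<bullet> e" using epi_lift[OF c(2), of i] by auto
    note [simp] = e(1-4)
    have [simp]: "Cod C x = Dom C k" using e(5) by simp
    have "r \<bullet> x = p \<bullet> (i \<bullet> e)" unfolding r_def e(6)[symmetric] by simp
    also have "\<dots> = Zr (Dom C x) (Cod C r)" by (simp add: assoc_eq[OF iD(4)])
    finally obtain y where y: "y \<in> Arr C" "Dom C y = Dom C x" "Cod C y = Dom C m'" "m' \<bullet> y = x"
      using kernel_lift[OF m', of x] by auto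
    note [simp] = y(1-3)
    have "i \<bullet> (q' \<bullet> y) = i \<bullet> e" using assoc_eq[OF q'(4), of y] y(4) e(6) by simp
    then have "q' \<bullet> y = e" using mono_cancel[OF iD(5), of "q' \<bullet> y" e] by simp
    then show ?thesis using epi_right_factor[of q' y] e(1) by simp
  qed
  have X'coh: "coh W.Tr n (Dom C i)"
  proof -
    have "cohomology_at C W.Tr n (Ident C (Dom C m')) q'"
    proof (rule cohI[OF W.Tr_bounded])
      show "is_kernel C (df W.Tr n) (Ident C (Dom C m'))"
        by (rule is_kernelI)
           (auto simp: W.Tr_simps W.tob_def iso_mono iso_arrI[of "Ident C (Dom C m')" "Ident C (Dom C m')"])
      fix \<zeta> assume z: "\<zeta> \<in> Arr C" "Cod C \<zeta> = Dom C (Ident C (Dom C m'))"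
      then have [simp]: "\<zeta> \<in> Arr C" "Cod C \<zeta> = Dom C m'" by simp_all
      have "q' \<bullet> \<zeta> = Zr (Dom C \<zeta>) (Cod C q') \<longleftrightarrow> i \<bullet> (q' \<bullet> \<zeta>) = Zr (Dom C \<zeta>) B"
      proof
        assume "i \<bullet> (q' \<bullet> \<zeta>) = Zr (Dom C \<zeta>) B"
        then show "q' \<bullet> \<zeta> = Zr (Dom C \<zeta>) (Cod C q')" using mono_zero[OF iD(5), of "q' \<bullet> \<zeta>"] by simp
      qed simp
      also have "i \<bullet> (q' \<bullet> \<zeta>) = q \<bullet> (m' \<bullet> \<zeta>)" using assoc_eq[OF q'(4), of \<zeta>] by simp
      also have "q \<bullet> (m' \<bullet> \<zeta>) = Zr (Dom C \<zeta>) B \<longleftrightarrow> bdry X n (k \<bullet> (m' \<bullet> \<zeta>))" using c(8)[of "m' \<bullet> \<zeta>"] by simp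
      also have "\<dots> \<longleftrightarrow> bdry W.Tr n \<zeta>" using W.Tr_bdry_top[of \<zeta>] by simp
      finally show "q' \<bullet> \<zeta> = Zr (Dom C \<zeta>) (Cod C q') \<longleftrightarrow> bdry W.Tr n (Ident C (Dom C m') \<bullet> \<zeta>)" by simp
    qed (use q'e in simp_all)
    then show ?thesis unfolding coh_def using q'(3) by blast
  qed
  have Kcoh: "coh K n (Cod C p)"
  proof -
    have incn: "W.inc n = ?m" by (simp add: W.inc_def)
    \<comment> \<open>The truncation is zero in degree \<open>n + 1\<close>, so the cycles of the
      cone in degree \<open>n\<close> are the cocycles of \<open>X\<close>. The truncation
      contributes the kernel of \<open>r\<close> to the boundaries.\<close>
    have "cohomology_at C K n (i2 n \<bullet> k) r"
    proof (rule cohI[OF K.K_bounded])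
      show "is_kernel C (df K n) (i2 n \<bullet> k)"
      proof (rule is_kernelI)
        have "mono_arr C (i2 n)" unfolding mono_iff
        proof (intro conjI ballI impI)
          fix t assume t: "t \<in> Arr C" "Cod C t = Dom C (i2 n)" "i2 n \<bullet> t = Zr (Dom C t) (Cod C (i2 n))"
          have "t = p2 n \<bullet> (i2 n \<bullet> t)" using t(1,2) by simp
          then show "t = Zr (Dom C t) (Dom C (i2 n))" unfolding t(3) using t(1) by simp
        qed simp
        then show "mono_arr C (i2 n \<bullet> k)" using mono_comp[OF T.m(1)] by simp
        show "df K n \<bullet> (i2 n \<bullet> k) = Zr (Dom C (i2 n \<bullet> k)) (Cod C (df K n))" by (simp add: T.m(3))
        fix t assume t: "t \<in> Arr C" "Cod C t = Dom C (df K n)" "df K n \<bullet> t = Zr (Dom C t) (Cod C (df K n))"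
        note [simp] = t(1)
        have ct [simp]: "Cod C t = ob K n" using t(2) by simp
        have "cyc K n t" unfolding cyc_def using t by simp
        then have z: "W.inc (n + 1) \<bullet> (p1 n \<bullet> t) \<oplus> df X n \<bullet> (p2 n \<bullet> t) = Zr (Dom C t) (ob X (n + 1))"
          unfolding K.K_cyc by blast
        have "ob W.Tr (n + 1) = zero_obj C" by (simp add: W.Tr_simps W.tob_def)
        then have p1: "p1 n \<bullet> t = Zr (Dom C t) (zero_obj C)"
          using into_zero_obj[of "p1 n \<bullet> t"] by simp
        have "df X n \<bullet> (p2 n \<bullet> t) = Zr (Dom C t) (ob X (n + 1))"
          using z unfolding p1 by (simp add: W.inc_def)
        then obtain u where u: "u \<in> Arr C" "Dom C u = Dom C t" "Cod C u = Dom C k" "k \<bullet> u = p2 n \<bullet> t"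
          using kernel_lift[OF c(1), of "p2 n \<bullet> t"] by auto
        have "(i2 n \<bullet> k) \<bullet> u = t"
        proof (rule K.K_eqI[of _ n])
          have "p1 n \<bullet> ((i2 n \<bullet> k) \<bullet> u) = Zr (Dom C t) (ob W.Tr (n + 1))" using u(1-3) by simp
          then show "p1 n \<bullet> ((i2 n \<bullet> k) \<bullet> u) = p1 n \<bullet> t"
            unfolding p1 by (simp add: \<open>ob W.Tr (n + 1) = zero_obj C\<close>)
        qed (use u in simp_all)
        then show "\<exists>u. u \<in> Arr C \<and> Dom C u = Dom C t \<and> Cod C u = Dom C (i2 n \<bullet> k) \<and> (i2 n \<bullet> k) \<bullet> u = t"
          using u by auto
      qed simp_all
      show "epi_arr C r" unfolding r_def using epi_comp[OF c(2) pD(5)] by simp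
      fix \<zeta> assume z: "\<zeta> \<in> Arr C" "Cod C \<zeta> = Dom C (i2 n \<bullet> k)"
      then have [simp]: "\<zeta> \<in> Arr C" "Cod C \<zeta> = Dom C k" by simp_all
      show "r \<bullet> \<zeta> = Zr (Dom C \<zeta>) (Cod C r) \<longleftrightarrow> bdry K n ((i2 n \<bullet> k) \<bullet> \<zeta>)"
      proof
        assume "r \<bullet> \<zeta> = Zr (Dom C \<zeta>) (Cod C r)"
        then obtain y where y: "y \<in> Arr C" "Dom C y = Dom C \<zeta>" "Cod C y = Dom C m'" "m' \<bullet> y = \<zeta>"
          using kernel_lift[OF m', of \<zeta>] by auto
        note [simp] = y(1-3)
        have d: "df W.Tr n = Zr (ob W.Tr n) (ob W.Tr (n + 1))" "ob W.Tr n = Dom C m'"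
          by (simp_all add: W.Tr_simps W.tob_def)
        have "k \<bullet> (m' \<bullet> y) = k \<bullet> \<zeta>" unfolding y(4) ..
        then show "bdry K n ((i2 n \<bullet> k) \<bullet> \<zeta>)"
          using X by (intro K.K_bdryI[of _ n "Ident C (Dom C \<zeta>)" y "Zr (Dom C \<zeta>) (ob X (n - 1))"])
            (simp_all add: d incn)
      next
        assume "bdry K n ((i2 n \<bullet> k) \<bullet> \<zeta>)"
        then obtain e x y where e: "epi_arr C e" "Cod C e = Dom C ((i2 n \<bullet> k) \<bullet> \<zeta>)"
          "x \<in> Arr C" "Dom C x = Dom C e" "Cod C x = ob W.Tr n" "y \<in> Arr C" "Dom C y = Dom C e" "Cod C y = ob X (n - 1)"
          "W.inc n \<bullet> x \<oplus> df X (n - 1) \<bullet> y = p2 n \<bullet> (((i2 n \<bullet> k) \<bullet> \<zeta>) \<bullet> e)" by (rule K.K_bdryE)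
        note [simp] = e(1,3,4,6-8)
        have [simp]: "Cod C e = Dom C \<zeta>" "Cod C x = Dom C m'" using e(2,5) by (simp_all add: W.Tr_simps W.tob_def)
        have "k \<bullet> (m' \<bullet> x \<oplus> l0 \<bullet> y) = k \<bullet> (\<zeta> \<bullet> e)"
          using e(9) X by (simp add: incn assoc_eq[OF T.ml])
        then have "m' \<bullet> x \<oplus> l0 \<bullet> y = \<zeta> \<bullet> e" using mono_cancel[OF T.m(1), of "m' \<bullet> x \<oplus> l0 \<bullet> y" "\<zeta> \<bullet> e"] by simp
        then have "(r \<bullet> \<zeta>) \<bullet> e = r \<bullet> (m' \<bullet> x \<oplus> l0 \<bullet> y)" by simp
        also have "\<dots> = Zr (Dom C e) (Cod C r)" by (simp add: assoc_eq[OF mD(4)] assoc_eq[OF rl])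
        finally show "r \<bullet> \<zeta> = Zr (Dom C \<zeta>) (Cod C r)" using epi_zero[OF e(1), of "r \<bullet> \<zeta>"] by simp
      qed
    qed simp
    then show ?thesis unfolding coh_def using r(3) by blast
  qed
  show thesis
    by (rule that[OF tri W.Tr_bounded K.K_bounded _ _ X'coh aK Kcoh]) (use W.Tr_acyc_high W.Tr_acyc_low in blast)+
qed

text \<open>The phases form a list whose length counts the triangles. Zero complexes get the empty
  list, which gives the induction a base case that the definition of a t-stability excludes.\<close>

definition tri_filtration :: "('q \<Rightarrow> ('a, 'b) cplx set) \<Rightarrow> ('a, 'b) cplx \<Rightarrow> 'q list \<Rightarrow> bool" where
  "tri_filtration P X L \<longleftrightarrow> (\<exists>F G u v w. F (0::nat) = X \<and> is_zero (Db C) (F (length L)) \<and>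
    (\<forall>k<length L. triangle (Db C) (F (Suc k)) (F k) (G k) (u k) (v k) (w k) \<and>
      \<not> is_zero (Db C) (G k) \<and> G k \<in> P (L ! k)))"

lemma tri_filtration_Nil: "is_zero (Db C) X \<Longrightarrow> tri_filtration P X []"
  unfolding tri_filtration_def by (intro exI[of _ "\<lambda>_. X"]) simp

lemma tri_filtration_Cons:
  assumes "triangle (Db C) X' X K u v w" "\<not> is_zero (Db C) K" "K \<in> P \<phi>" "tri_filtration P X' L"
  shows "tri_filtration P X (\<phi> # L)"
proof -
  obtain F G us vs ws where f: "F (0::nat) = X'" "is_zero (Db C) (F (length L))"
    "\<forall>k<length L. triangle (Db C) (F (Suc k)) (F k) (G k) (us k) (vs k) (ws k) \<and>
      \<not> is_zero (Db C) (G k) \<and> G k \<in> P (L ! k)"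
    using assms(4) unfolding tri_filtration_def by blast
  show ?thesis unfolding tri_filtration_def
    by (rule exI[of _ "case_nat X F"], rule exI[of _ "case_nat K G"], rule exI[of _ "case_nat u us"],
        rule exI[of _ "case_nat v vs"], rule exI[of _ "case_nat w ws"])
       (use f assms(1-3) in \<open>auto simp: less_Suc_eq_0_disj split: nat.split simp del: Db_defs\<close>)
qed

section \<open>Assembling the filtration of a bounded complex\<close>

context
  fixes \<Phi> :: "'p set" and r :: "('p \<times> 'p) set" and S :: "'p \<Rightarrow> 'a set"
  assumes sd: "stability_data C \<Phi> r S"
begin

abbreviation "slice_of \<equiv> (\<lambda>(i, \<phi>). with_zeros (Db C) (shifted_slice C (S \<phi>) i))"

lemma S_full: "\<phi> \<in> \<Phi> \<Longrightarrow> strictly_full C (S \<phi>)"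
  using sd unfolding stability_data_def by blast

text \<open>\<open>N\<close> is the width of a window of degrees ending at \<open>n\<close> outside
  which \<open>X\<close> is acyclic. The lower bound on the integer parts of phases is carried along
  so that the lists from different degrees can be joined in order.\<close>

lemma filtration_exists_amplitude:
  "\<lbrakk>bounded_complex C X; \<forall>j>n. acyc X j; \<forall>j\<le>n - int N. acyc X j\<rbrakk> \<Longrightarrow>
    \<exists>L. set L \<subseteq> {(i, \<phi>). - n \<le> i \<and> \<phi> \<in> \<Phi>} \<and> sorted_wrt (less_in (int_lex \<Phi> r)) L \<and> tri_filtration slice_of X L"
proof (induction N arbitrary: X n)
  case 0
  have "acyc X j" for j using 0(2,3) by (cases "j > n") simp_all
  then have "is_zero (Db C) X" using Db_zero_iff[of X] 0(1) by simp
  then show ?case using tri_filtration_Nil by (intro exI[of _ "[]"]) simp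
next
  case (Suc N)
  \<comment> \<open>Once degree \<open>n\<close> is acyclic too, the window ends at
    \<open>n - 1\<close> and is shorter by one; the resulting integer parts are strictly larger than
    \<open>- n\<close>.\<close>
  have low: "\<exists>L. set L \<subseteq> {(i, \<phi>). - n < i \<and> \<phi> \<in> \<Phi>} \<and> sorted_wrt (less_in (int_lex \<Phi> r)) L \<and> tri_filtration slice_of Y L"
    if Y: "bounded_complex C Y" "\<forall>j>n. acyc Y j" "\<forall>j\<le>n - int (Suc N). acyc Y j" "acyc Y n" for Y
  proof -
    have "acyc Y j" if "j > n - 1" for j using Y(2,4) that by (cases "j = n") simp_all
    moreover have "\<forall>j\<le>n - 1 - int N. acyc Y j" using Y(3) by simp
    ultimately obtain L where "set L \<subseteq> {(i, \<phi>). - (n - 1) \<le> i \<and> \<phi> \<in> \<Phi>}" "sorted_wrt (less_in (int_lex \<Phi> r)) L"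
      "tri_filtration slice_of Y L" using Suc.IH[OF Y(1), of "n - 1"] by blast
    then show ?thesis by (intro exI[of _ L]) auto
  qed
  obtain B where B: "coh X n B" using coh_obtain[OF Suc.prems(1)] .
  show ?case
  proof (cases "is_zero C B")
    case True
    then have "acyc X n" using acyc_coh[OF Suc.prems(1) B] by blast
    then obtain L where "set L \<subseteq> {(i, \<phi>). - n < i \<and> \<phi> \<in> \<Phi>}" "sorted_wrt (less_in (int_lex \<Phi> r)) L"
      "tri_filtration slice_of X L" using low Suc.prems by blast
    then show ?thesis by (intro exI[of _ L]) auto
  next
    case False
    have "B \<in> Obj C" using coh_obj[OF Suc.prems(1) B] .
    then obtain N' :: nat and F G \<phi> i p where F: "F 0 = B" "is_zero C (F (Suc N'))"
      and ip: "\<And>k. k \<le> N' \<Longrightarrow> i k \<in> Hom C (F (Suc k)) (F k) \<and> p k \<in> Hom C (F k) (G k) \<and>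
          short_exact C (i k) (p k) \<and> \<not> is_zero C (G k) \<and> \<phi> k \<in> \<Phi> \<and> G k \<in> S (\<phi> k)"
      and lt: "\<And>k l. k < l \<Longrightarrow> l \<le> N' \<Longrightarrow> less_in r (\<phi> k) (\<phi> l)"
      using sd False unfolding stability_data_def by metis
    \<comment> \<open>Inner induction over the filtration of \<open>B\<close>: \<open>k\<close> is
      the number of quotients still to be split off, and the top cohomology of \<open>Y\<close> is
      the corresponding step of that filtration. The range of \<open>j\<close> records which phases
      are used up, so the next one lies below all of them.\<close>
    have "\<exists>L. set L \<subseteq> {x. (\<exists>j. Suc N' - k \<le> j \<and> j \<le> N' \<and> x = (- n, \<phi> j)) \<or> - n < fst x \<and> snd x \<in> \<Phi>} \<and>
        sorted_wrt (less_in (int_lex \<Phi> r)) L \<and> tri_filtration slice_of Y L"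
      if "k \<le> Suc N'" "bounded_complex C Y" "\<forall>j>n. acyc Y j" "\<forall>j\<le>n - int (Suc N). acyc Y j" "coh Y n (F (Suc N' - k))" for k Y
      using that
    proof (induction k arbitrary: Y)
      case 0
      then have "acyc Y n" using acyc_coh[OF 0(2), of n "F (Suc N')"] F(2) by simp
      then obtain L where "set L \<subseteq> {(i, \<phi>). - n < i \<and> \<phi> \<in> \<Phi>}" "sorted_wrt (less_in (int_lex \<Phi> r)) L"
        "tri_filtration slice_of Y L" using low 0 by blast
      then show ?case by (intro exI[of _ L]) auto
    next
      case (Suc k)
      \<comment> \<open>The index of the quotient split off now. The equations collected next
        resolve the truncated subtractions.\<close>
      define m where "m = N' - k"
      have m: "m \<le> N'" "Suc N' - Suc k = m" "Suc N' - k = Suc m" using Suc.prems(1) by (auto simp: m_def)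
      note q = ip[OF m(1), unfolded Hom_iff]
      obtain Y' K u v w where Y': "triangle (Db C) Y' Y K u v w" "bounded_complex C Y'" "bounded_complex C K"
        "\<And>j. j > n \<Longrightarrow> acyc Y' j" "\<And>j. j < n \<Longrightarrow> acyc Y j \<Longrightarrow> acyc Y' j" "coh Y' n (Dom C (i m))"
        "\<And>j. j \<noteq> n \<Longrightarrow> acyc K j" "coh K n (Cod C (p m))"
        using peel_top_cohomology[of Y n "F m" "i m" "p m"] Suc.prems q m(2) by metis
      have "\<forall>j\<le>n - int (Suc N). acyc Y' j" using Y'(5) Suc.prems(4) by simp
      then obtain L where L: "set L \<subseteq> {x. (\<exists>j. Suc N' - k \<le> j \<and> j \<le> N' \<and> x = (- n, \<phi> j)) \<or> - n < fst x \<and> snd x \<in> \<Phi>}"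
        "sorted_wrt (less_in (int_lex \<Phi> r)) L" "tri_filtration slice_of Y' L"
        using Suc.IH[of Y'] Suc.prems(1) Y'(2,4,6) q m(3) by auto
      have KG: "coh K n (G m)" "G m \<in> S (\<phi> m)" "\<phi> m \<in> \<Phi>" "\<not> is_zero C (G m)" using Y'(8) q by auto
      have "\<not> is_zero (Db C) K" using Db_zero_iff[of K] acyc_coh[OF Y'(3) KG(1)] KG(4) by auto
      moreover have "K \<in> slice_of (- n, \<phi> m)"
        unfolding prod.case slice_zeros_iff[OF S_full[OF KG(3)]]
        using Y'(3,7) KG unfolding with_zeros_def by auto
      ultimately have "tri_filtration slice_of Y ((- n, \<phi> m) # L)"
        using tri_filtration_Cons[OF Y'(1) _ _ L(3)] by blast
      moreover have "less_in (int_lex \<Phi> r) (- n, \<phi> m) x" if x: "x \<in> set L" for x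
      proof -
        consider j where "Suc m \<le> j" "j \<le> N'" "x = (- n, \<phi> j)" | "- n < fst x" "snd x \<in> \<Phi>"
          using L(1) x m(3) by auto
        then show ?thesis
        proof cases
          case 1
          then have "less_in r (\<phi> m) (\<phi> j)" "\<phi> j \<in> \<Phi>" using lt[of m j] ip[of j] by auto
          then show ?thesis using 1 KG(3) by (auto simp: less_in_def int_lex_def)
        next
          case 2
          then show ?thesis using KG(3) by (cases x) (auto simp: less_in_def int_lex_def)
        qed
      qed
      moreover have "set ((- n, \<phi> m) # L) \<subseteq> {x. (\<exists>j. Suc N' - Suc k \<le> j \<and> j \<le> N' \<and> x = (- n, \<phi> j)) \<or> - n < fst x \<and> snd x \<in> \<Phi>}"
        using L(1) m unfolding m(2,3) by (auto 4 4 dest: Suc_leD)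
      ultimately show ?case using L(2) by (intro exI[of _ "(- n, \<phi> m) # L"]) simp
    qed
    from this[of "Suc N'" X] obtain L where L: "set L \<subseteq> {x. (\<exists>j. j \<le> N' \<and> x = (- n, \<phi> j)) \<or> - n < fst x \<and> snd x \<in> \<Phi>}"
      "sorted_wrt (less_in (int_lex \<Phi> r)) L" "tri_filtration slice_of X L"
      using Suc.prems B F(1) by auto
    have "set L \<subseteq> {(i, \<phi>). - n \<le> i \<and> \<phi> \<in> \<Phi>}" using L(1) ip by fastforce
    then show ?thesis using L by blast
  qed
qed

lemma filtration_exists:
  assumes "bounded_complex C X"
  shows "\<exists>L. set L \<subseteq> UNIV \<times> \<Phi> \<and> sorted_wrt (less_in (int_lex \<Phi> r)) L \<and> tri_filtration slice_of X L"
proof -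
  obtain N where N: "\<And>n. \<bar>n\<bar> > N \<Longrightarrow> is_zero C (ob X n)" using assms unfolding bounded_complex_def by blast
  have a: "acyc X j" if "\<bar>j\<bar> > N" for j using acyc_zero_ob[OF assms] N that by blast
  \<comment> \<open>The bound \<open>N\<close> may be negative. The window from \<open>- M\<close>
    to \<open>M\<close> has width \<open>2 * M + 1\<close>.\<close>
  define M where "M = \<bar>N\<bar>"
  have "int (nat (2 * M + 1)) = 2 * M + 1" by (simp add: M_def)
  then have "\<forall>j\<le>M - int (nat (2 * M + 1)). acyc X j" by (intro allI impI a) (simp add: M_def)
  moreover have "\<forall>j>M. acyc X j" by (intro allI impI a) (simp add: M_def)
  ultimately obtain L where "set L \<subseteq> {(i, \<phi>). - M \<le> i \<and> \<phi> \<in> \<Phi>}" "sorted_wrt (less_in (int_lex \<Phi> r)) L"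
    "tri_filtration slice_of X L" using filtration_exists_amplitude[OF assms, of M] by blast
  then show ?thesis by (intro exI[of _ L]) auto
qed

end

end

section \<open>The t-stability\<close>

lemma linear_order_int_lex:
  assumes "linear_order_on \<Phi> r"
  shows "linear_order_on (UNIV \<times> \<Phi>) (int_lex \<Phi> r)"
proof -
  have r: "refl_on \<Phi> r" "r \<subseteq> \<Phi> \<times> \<Phi>" "trans r" "antisym r" "total_on \<Phi> r"
    using assms unfolding linear_order_on_def partial_order_on_def preorder_on_def by auto
  have "refl_on (UNIV \<times> \<Phi>) (int_lex \<Phi> r)" using r(1) unfolding refl_on_def int_lex_def by auto
  moreover have "int_lex \<Phi> r \<subseteq> (UNIV \<times> \<Phi>) \<times> (UNIV \<times> \<Phi>)" unfolding int_lex_def by auto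
  moreover have "trans (int_lex \<Phi> r)" using r(3) unfolding trans_def int_lex_def by fastforce
  moreover have "antisym (int_lex \<Phi> r)" using r(4) unfolding antisym_def int_lex_def by fastforce
  moreover have "total_on (UNIV \<times> \<Phi>) (int_lex \<Phi> r)"
    using r(1,5) unfolding total_on_def refl_on_def int_lex_def by fastforce
  ultimately show ?thesis unfolding linear_order_on_def partial_order_on_def preorder_on_def by auto
qed

context abelian_category
begin

context
  fixes \<Phi> :: "'p set" and r :: "('p \<times> 'p) set" and S :: "'p \<Rightarrow> 'a set"
  assumes sd: "stability_data C \<Phi> r S"
begin

lemma slice_full:
  assumes "\<phi> \<in> \<Phi>"
  shows "shifted_slice C (S \<phi>) i \<noteq> {} \<and> strictly_full (Db C) (shifted_slice C (S \<phi>) i)"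
proof -
  note full = S_full[OF sd assms]
  obtain A where A: "A \<in> S \<phi>" using sd assms unfolding stability_data_def by blast
  then have AO: "A \<in> Obj C" using full unfolding strictly_full_def by blast
  have "coh (sh_cplx C i (deg0 C A)) (- i) A"
    using sh_coh[OF deg0_bounded[OF AO]] deg0_coh[OF AO] by simp
  moreover have "acyc (sh_cplx C i (deg0 C A)) j" if "j \<noteq> - i" for j
    using sh_acyc[OF deg0_bounded[OF AO]] deg0_acyc[OF AO, of "j + i"] that by simp
  ultimately have "sh_cplx C i (deg0 C A) \<in> shifted_slice C (S \<phi>) i"
    unfolding slice_iff[OF full] using A sh_bounded[OF deg0_bounded[OF AO]] by blast
  moreover have "Y \<in> shifted_slice C (S \<phi>) i" if "X \<in> shifted_slice C (S \<phi>) i" "isomorphic (Db_cat C) X Y" for X Y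
    using that(1) isomorphic_bounded[OF that(2)]
    unfolding slice_iff[OF full] isomorphic_acyc[OF that(2)] isomorphic_coh[OF that(2)] by blast
  moreover have "shifted_slice C (S \<phi>) i \<subseteq> Obj (Db C)" unfolding shifted_slice_def by blast
  ultimately show ?thesis unfolding strictly_full_def by auto
qed

text \<open>An equality of sets of complexes, not only up to isomorphism. It holds because slices
  are described by cohomology, which a shift re-indexes, and because shifting by -1 is a strict
  inverse.\<close>

lemma shift_slice:
  assumes "\<phi> \<in> \<Phi>"
  shows "sh_cplx C 1 ` with_zeros (Db C) (shifted_slice C (S \<phi>) i) = with_zeros (Db C) (shifted_slice C (S \<phi>) (i + 1))"
    (is "_ ` ?P = ?Q")
proof -
  note full = S_full[OF sd assms]
  have *: "sh_cplx C 1 X \<in> ?Q \<longleftrightarrow> X \<in> ?P" if X: "bounded_complex C X" for X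
  proof -
    have "(\<forall>j. j \<noteq> - (i + 1) \<longrightarrow> acyc X (j + 1)) \<longleftrightarrow> (\<forall>j. j \<noteq> - i \<longrightarrow> acyc X j)"
    proof (intro iffI allI impI)
      fix j assume "\<forall>j. j \<noteq> - (i + 1) \<longrightarrow> acyc X (j + 1)" "j \<noteq> - i"
      then show "acyc X j" by (auto dest: spec[of _ "j - 1"])
    qed simp
    then show ?thesis unfolding slice_zeros_iff[OF full] using X by (simp add: sh_coh)
  qed
  have b: "bounded_complex C X" if "X \<in> ?P \<or> X \<in> ?Q" for X using that slice_zeros_iff[OF full] by blast
  show ?thesis
  proof
    show "sh_cplx C 1 ` ?P \<subseteq> ?Q" using * b by blast
    show "?Q \<subseteq> sh_cplx C 1 ` ?P"
    proof
      fix Y assume Y: "Y \<in> ?Q"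
      have bY: "bounded_complex C Y" using b Y by blast
      have "Y = sh_cplx C 1 (sh_cplx C (- 1) Y)" using sh_sh[OF bY] by simp
      moreover have "sh_cplx C (- 1) Y \<in> ?P" using *[OF sh_bounded[OF bY, of "- 1"]] calculation Y by simp
      ultimately show "Y \<in> sh_cplx C 1 ` ?P" by blast
    qed
  qed
qed

text \<open>The cohomology of the shifted \<open>Y\<close> sits in degree \<open>- i - m\<close>,
  which is at least \<open>- j\<close> as \<open>i \<le> j\<close> and \<open>m \<le> 0\<close>, so
  vanishing is decided in degree \<open>- j\<close>. There both sides can be nonzero only if
  \<open>i = j\<close> and \<open>m = 0\<close>, the case covered by the stability data.\<close>

lemma hom_slices_zero:
  assumes lt: "less_in (int_lex \<Phi> r) (i, \<phi>) (j, \<psi>)" and m: "m \<le> 0"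
    and X: "X \<in> with_zeros (Db C) (shifted_slice C (S \<psi>) j)" and Y: "Y \<in> with_zeros (Db C) (shifted_slice C (S \<phi>) i)"
  shows "Hom (Db C) X (sh_cplx C m Y) = {ZeroArr (Db C) X (sh_cplx C m Y)}"
proof -
  have \<Phi>: "\<phi> \<in> \<Phi>" "\<psi> \<in> \<Phi>" and c: "i < j \<or> i = j \<and> less_in r \<phi> \<psi>"
    using lt unfolding less_in_def int_lex_def by auto
  note f\<phi> = S_full[OF sd \<Phi>(1)] and f\<psi> = S_full[OF sd \<Phi>(2)]
  note Xs = X[unfolded slice_zeros_iff[OF f\<psi>]] and Ys = Y[unfolded slice_zeros_iff[OF f\<phi>]]
  then have b: "bounded_complex C X" "bounded_complex C Y" by auto
  have "Hom (Db_cat C) X (sh_cplx C m Y) = {loc C X (sh_cplx C m Y) (ch_zero C X (sh_cplx C m Y))}"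
  proof (rule hom_vanishing[of _ _ "- j"])
    show "acyc X k" if "k > - j" for k using Xs that by simp
    show "acyc (sh_cplx C m Y) k" if "k < - j" for k using Ys b c m that by auto
    fix A B assume A: "coh X (- j) A" and B: "coh (sh_cplx C m Y) (- j) B"
    have B': "coh Y (- j + m) B" using B sh_coh[OF b(2)] by blast
    have AB: "A \<in> Obj C" "B \<in> Obj C" using coh_obj[OF b(1) A] coh_obj[OF b(2) B'] .
    have z: "Hom C A B = {Zr A B}" if "is_zero C A \<or> is_zero C B"
      using that zero_obj_arr AB by auto
    show "Hom C A B = {Zr A B}"
    proof (cases "i = j \<and> m = 0")
      case True
      obtain A0 where "A0 \<in> with_zeros C (S \<psi>)" "coh X (- j) A0" using Xs by blast
      then have "A \<in> with_zeros C (S \<psi>)" using strictly_full_zeros[OF f\<psi>] coh_unique[OF b(1)] A by blast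
      moreover obtain B0 where "B0 \<in> with_zeros C (S \<phi>)" "coh Y (- i) B0" using Ys by blast
      then have "B \<in> with_zeros C (S \<phi>)" using strictly_full_zeros[OF f\<phi>] coh_unique[OF b(2)] B' True by auto
      moreover have "less_in r \<phi> \<psi>" using c True by simp
      ultimately show ?thesis using z sd \<Phi> unfolding with_zeros_def stability_data_def by blast
    next
      case False
      then have "- j + m \<noteq> - i" using c m by auto
      then have "acyc Y (- j + m)" using Ys by blast
      then have "is_zero C B" using acyc_coh[OF b(2) B'] by blast
      then show ?thesis using z by blast
    qed
  qed (use b in simp_all)
  then show ?thesis by simp
qed

lemma t_stability_slices:
  "t_stability (Db C) (UNIV \<times> \<Phi>) (int_lex \<Phi> r) (\<lambda>(i, \<phi>). shifted_slice C (S \<phi>) i)"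
proof -
  let ?P = "\<lambda>(i, \<phi>). with_zeros (Db C) (shifted_slice C (S \<phi>) i)"
  have P: "(\<lambda>x. with_zeros (Db C) ((\<lambda>(i, \<phi>). shifted_slice C (S \<phi>) i) x)) = ?P" by auto
  have lin: "linear_order_on (UNIV \<times> \<Phi>) (int_lex \<Phi> r)"
    using linear_order_int_lex sd unfolding stability_data_def by blast
  have full: "\<forall>x\<in>UNIV \<times> \<Phi>. (\<lambda>(i, \<phi>). shifted_slice C (S \<phi>) i) x \<noteq> {} \<and>
      strictly_full (Db C) ((\<lambda>(i, \<phi>). shifted_slice C (S \<phi>) i) x)"
    using slice_full by auto
  have ext: "\<forall>x\<in>UNIV \<times> \<Phi>. tri_extension_closed (Db C) (?P x)"
    using slice_extension_closed[OF S_full[OF sd]] sd unfolding stability_data_def by auto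
  have tau: "\<exists>\<tau>. bij_betw \<tau> (UNIV \<times> \<Phi>) (UNIV \<times> \<Phi>) \<and>
      (\<forall>x\<in>UNIV \<times> \<Phi>. \<forall>y\<in>UNIV \<times> \<Phi>. (x, y) \<in> int_lex \<Phi> r \<longleftrightarrow> (\<tau> x, \<tau> y) \<in> int_lex \<Phi> r) \<and>
      (\<forall>x\<in>UNIV \<times> \<Phi>. Shift (Db C) 1 ` ?P x = ?P (\<tau> x) \<and> (x, \<tau> x) \<in> int_lex \<Phi> r)"
  proof (intro exI[of _ "\<lambda>(i, \<phi>). (i + 1, \<phi>)"] conjI ballI)
    show "bij_betw (\<lambda>(i :: int, \<phi>). (i + 1, \<phi>)) (UNIV \<times> \<Phi>) (UNIV \<times> \<Phi>)"
      by (rule bij_betw_byWitness[where f' = "\<lambda>(i, \<phi>). (i - 1, \<phi>)"]) auto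
    fix x assume x: "x \<in> (UNIV :: int set) \<times> \<Phi>"
    show "Shift (Db C) 1 ` ?P x = ?P ((\<lambda>(i, \<phi>). (i + 1, \<phi>)) x)" using x shift_slice by auto
    show "(x, (\<lambda>(i, \<phi>). (i + 1, \<phi>)) x) \<in> int_lex \<Phi> r" using x by (auto simp: int_lex_def)
    fix y assume "y \<in> (UNIV :: int set) \<times> \<Phi>"
    show "(x, y) \<in> int_lex \<Phi> r \<longleftrightarrow> ((\<lambda>(i, \<phi>). (i + 1, \<phi>)) x, (\<lambda>(i, \<phi>). (i + 1, \<phi>)) y) \<in> int_lex \<Phi> r"
      by (cases x; cases y) (simp add: int_lex_def add1_zle_eq)
  qed
  have hom: "\<forall>x\<in>UNIV \<times> \<Phi>. \<forall>y\<in>UNIV \<times> \<Phi>. less_in (int_lex \<Phi> r) x y \<longrightarrow>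
      (\<forall>X\<in>?P y. \<forall>Y\<in>?P x. \<forall>i\<le>0. Hom (Db C) X (Shift (Db C) i Y) = {ZeroArr (Db C) X (Shift (Db C) i Y)})"
    using hom_slices_zero by fastforce
  have fil: "\<exists>n::nat. \<exists>F G \<phi> u v w. F 0 = X \<and> is_zero (Db C) (F (Suc n)) \<and>
      (\<forall>k\<le>n. triangle (Db C) (F (Suc k)) (F k) (G k) (u k) (v k) (w k) \<and>
        \<not> is_zero (Db C) (G k) \<and> \<phi> k \<in> UNIV \<times> \<Phi> \<and> G k \<in> ?P (\<phi> k)) \<and>
      (\<forall>k l. k < l \<and> l \<le> n \<longrightarrow> less_in (int_lex \<Phi> r) (\<phi> k) (\<phi> l))"
    if X: "X \<in> Obj (Db C)" "\<not> is_zero (Db C) X" for X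
  proof -
    have "bounded_complex C X" using X by simp
    then obtain L where L: "set L \<subseteq> UNIV \<times> \<Phi>" "sorted_wrt (less_in (int_lex \<Phi> r)) L" "tri_filtration ?P X L"
      using filtration_exists[OF sd] by blast
    obtain F G u v w where f: "F (0::nat) = X" "is_zero (Db C) (F (length L))"
      "\<forall>k<length L. triangle (Db C) (F (Suc k)) (F k) (G k) (u k) (v k) (w k) \<and>
        \<not> is_zero (Db C) (G k) \<and> G k \<in> ?P (L ! k)"
      using L(3) unfolding tri_filtration_def by blast
    \<comment> \<open>A filtration in the definition has \<open>n + 1\<close> triangles; that
      \<open>X\<close> is nonzero rules out the empty list.\<close>
    have "length L \<noteq> 0"
    proof
      assume "length L = 0"
      then have "is_zero (Db C) X" using f(1,2) by metis
      then show False using X(2) by blast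
    qed
    then obtain n where n: "length L = Suc n" using not0_implies_Suc by blast
    have "\<forall>k\<le>n. triangle (Db C) (F (Suc k)) (F k) (G k) (u k) (v k) (w k) \<and>
        \<not> is_zero (Db C) (G k) \<and> L ! k \<in> UNIV \<times> \<Phi> \<and> G k \<in> ?P (L ! k)"
    proof (intro allI impI)
      fix k assume "k \<le> n"
      then have k: "k < length L" using n by simp
      then have "L ! k \<in> UNIV \<times> \<Phi>" using L(1) nth_mem by blast
      moreover note f(3)[rule_format, OF k]
      ultimately show "triangle (Db C) (F (Suc k)) (F k) (G k) (u k) (v k) (w k) \<and>
        \<not> is_zero (Db C) (G k) \<and> L ! k \<in> UNIV \<times> \<Phi> \<and> G k \<in> ?P (L ! k)" by (intro conjI; elim conjE)
    qed
    moreover have "\<forall>k l. k < l \<and> l \<le> n \<longrightarrow> less_in (int_lex \<Phi> r) (L ! k) (L ! l)"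
      by (intro allI impI sorted_wrt_nth_less[OF L(2)]) (use n in auto)
    ultimately show ?thesis
      by (intro exI[of _ n] exI[of _ F] exI[of _ G] exI[of _ "\<lambda>k. L ! k"] exI[of _ u] exI[of _ v] exI[of _ w]
          conjI f(1) f(2)[unfolded n])
  qed
  show ?thesis unfolding t_stability_def Let_def P
    by (intro conjI lin full ext tau hom ballI impI fil)
qed

end

end

theorem corollary3p5:
  fixes A :: "('o, 'm) precat"
    and \<Phi> :: "'p set" and r :: "('p \<times> 'p) set"
    and S :: "'p \<Rightarrow> 'o set"
  assumes "abelian_category A"
    and "stability_data A \<Phi> r S"
  shows "t_stability (Db A) ((UNIV :: int set) \<times> \<Phi>) (int_lex \<Phi> r)
    (\<lambda>(i, \<phi>). shifted_slice A (S \<phi>) i)"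
  by (rule abelian_category.t_stability_slices[OF assms])

end
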